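(* Let $m\in L^\infty(\mathbf{S}^1)$ satisfy $m\ge 0$ and $\iint_{Y_r\times\mathbf{S}^1}m(\theta)\,d\mu_r(x,\theta)=1$. For $t^*>\sqrt2$ set $$\Lambda^m_+(t^* )=\limsup_{\epsilon\to0^+}\frac1{|\ln\epsilon|}\int_\epsilon^{\epsilon^*}\Phi^m_r\!\left(\frac{t^*}{r}\right)\frac{dr}{r},\qquad \Lambda^m_-(t^* )=\liminf_{\epsilon\to0^+}\frac1{|\ln\epsilon|}\int_\epsilon^{\epsilon^*}\Phi^m_r\!\left(\frac{t^*}{r}\right)\frac{dr}{r},$$ where $\epsilon^*\in(0,\tfrac12)$ is fixed (the values do not depend on the choice of $\epsilon^*$). Then $$\Lambda^m_+(t^* )\sim\frac{2}{\pi^2t^*}\quad\text{and}\quad \Lambda^m_-(t^* )\sim\frac{2}{\pi^2t^*}\qquad\text{as }t^*\to+\infty.$$ More precisely, for $t^*>3$, $$\left|\Lambda^m_\pm(t^* )-\frac{2}{\pi^2t^*}\right|\le\frac{8\|m\|_{L^\infty}}{(t^*-3)^2}.$$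
   Context: For $r\in(0,\tfrac12)$ let $Z_r=\{x\in\mathbf{R}^2 : \mathrm{dist}(x,\mathbf{Z}^2)>r/2\}$ and, for $(x,v)\in Z_r\times\mathbf{S}^1$, let $\tau_r(x,v)=\inf\{t>0 : x+tv\in\partial Z_r\}$ (the free path length, or forward exit time). Since $\tau_r(x+k,v)=\tau_r(x,v)$ for $k\in\mathbf{Z}^2$, $\tau_r$ is viewed as a function on $Y_r\times\mathbf{S}^1$, where $Y_r=Z_r/\mathbf{Z}^2$ is the punctured torus. Let $\mu_r$ be the uniform probability measure on $Y_r\times\mathbf{S}^1$, i.e. $\mu_r=\frac1{V_r}dx\,dv$ with $V_r$ the $dx\,dv$-measure of $Y_r\times\mathbf{S}^1$. (The normalization condition on $m$ therefore does not depend on $r$: it says that the average of $m$ over $\mathbf{S}^1$ is $1$.) For $t\ge0$, $$\Phi^m_r(t)=\iint_{Y_r\times\mathbf{S}^1}\mathbf{1}_{\{\tau_r(x,v)>t\}}\,m(v)\,d\mu_r(x,v),$$ that is, the probability under $m\,d\mu_r$ that $\tau_r(x,v)>t$. *)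

theory Defs
  imports
    "HOL-Probability.Probability"
    "HOL-Probability.Essential_Supremum"
    "HOL-Library.Landau_Symbols"
begin

definition int_lattice :: "(real^2) set" where
  "int_lattice = {k. \<forall>i. k $ i \<in> \<int>}"

definition Zr :: "real \<Rightarrow> (real^2) set" where
  "Zr r = {x. infdist x int_lattice > r / 2}"

text \<open>The free path length takes the value \<open>\<infinity>\<close> (the infimum of the empty set in \<^typ>\<open>ereal\<close>)
  along trajectories that never meet an obstacle.\<close>

definition free_path :: "real \<Rightarrow> real^2 \<Rightarrow> real^2 \<Rightarrow> ereal" where
  "free_path r x v = Inf (ereal ` {t. t > 0 \<and> x + t *\<^sub>R v \<in> frontier (Zr r)})"

text \<open>The arc length measure \<open>dv\<close> on the unit circle, of total mass \<open>2\<pi>\<close>; its underlying space is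
  the circle itself, so measurability with respect to it ignores values off the circle.\<close>

definition circle_measure :: "(real^2) measure" where
  "circle_measure =
     distr (restrict_space lborel {0..<2*pi}) (restrict_space borel (sphere 0 1))
       (\<lambda>\<theta>. vector [cos \<theta>, sin \<theta>])"

text \<open>The punctured torus \<open>Z\<^sub>r / \<int>\<^sup>2\<close>, represented by the fundamental domain \<open>[0,1)\<^sup>2\<close>.
  The free path length is \<open>\<int>\<^sup>2\<close>-periodic (lemma \<open>free_path_periodic\<close> below), so it descends to
  the quotient and integrals over the quotient are integrals over this set.\<close>

definition Yr :: "real \<Rightarrow> (real^2) set" where
  "Yr r = {x \<in> Zr r. \<forall>i. 0 \<le> x $ i \<and> x $ i < 1}"

definition mu :: "real \<Rightarrow> ((real^2) \<times> (real^2)) measure" where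
  "mu r = uniform_measure (lborel \<Otimes>\<^sub>M circle_measure) (Yr r \<times> sphere 0 1)"

definition Phi :: "(real^2 \<Rightarrow> real) \<Rightarrow> real \<Rightarrow> real \<Rightarrow> real" where
  "Phi m r t =
     (LINT p|mu r. indicator {p. free_path r (fst p) (snd p) > ereal t} p * m (snd p))"

definition log_mean :: "(real^2 \<Rightarrow> real) \<Rightarrow> real \<Rightarrow> real \<Rightarrow> real \<Rightarrow> real" where
  "log_mean m \<epsilon>' t \<epsilon> = 1 / \<bar>ln \<epsilon>\<bar> * (LBINT r=\<epsilon>..\<epsilon>'. Phi m r (t / r) / r)"

definition Lambda_plus :: "(real^2 \<Rightarrow> real) \<Rightarrow> real \<Rightarrow> real \<Rightarrow> ereal" where
  "Lambda_plus m \<epsilon>' t = Limsup (at_right 0) (\<lambda>\<epsilon>. ereal (log_mean m \<epsilon>' t \<epsilon>))"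

definition Lambda_minus :: "(real^2 \<Rightarrow> real) \<Rightarrow> real \<Rightarrow> real \<Rightarrow> ereal" where
  "Lambda_minus m \<epsilon>' t = Liminf (at_right 0) (\<lambda>\<epsilon>. ereal (log_mean m \<epsilon>' t \<epsilon>))"

definition Linf_norm :: "(real^2 \<Rightarrow> real) \<Rightarrow> ereal" where
  "Linf_norm m = esssup circle_measure (\<lambda>v. ereal \<bar>m v\<bar>)"

lemma Zr_periodic:
  assumes "k \<in> int_lattice"
  shows "x + k \<in> Zr r \<longleftrightarrow> x \<in> Zr r"
proof -
  have sub: "(+) k ` int_lattice = int_lattice"
  proof (intro set_eqI iffI)
    fix y assume "y \<in> (+) k ` int_lattice"
    then show "y \<in> int_lattice" using assms by (auto simp: int_lattice_def)
  next
    fix y assume "y \<in> int_lattice"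
    then have "y - k \<in> int_lattice" using assms by (auto simp: int_lattice_def)
    then show "y \<in> (+) k ` int_lattice" by (force intro: image_eqI[where x = "y - k"])
  qed
  have ne: "int_lattice \<noteq> {}" using assms by auto
  have "infdist (x + k) int_lattice = (INF a\<in>(+) k ` int_lattice. dist (x + k) a)"
    using ne by (simp only: sub infdist_def if_False)
  also have "\<dots> = (INF a\<in>int_lattice. dist x a)"
    by (simp add: image_image add.commute[of k] dist_norm)
  also have "\<dots> = infdist x int_lattice" using ne by (simp add: infdist_def)
  finally show ?thesis by (simp add: Zr_def)
qed

lemma free_path_periodic:
  assumes "k \<in> int_lattice"
  shows "free_path r (x + k) v = free_path r x v"
proof -
  have "Zr r = (+) k ` Zr r"
  proof (intro set_eqI iffI)
    fix y assume "y \<in> Zr r"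
    then have "y - k \<in> Zr r" using Zr_periodic[OF assms, of "y - k" r] by simp
    then show "y \<in> (+) k ` Zr r" by (force intro: image_eqI[where x = "y - k"])
  qed (use Zr_periodic[OF assms] in \<open>auto simp: add.commute\<close>)
  then have eq: "(+) k ` frontier (Zr r) = frontier (Zr r)"
    by (simp only: frontier_translation[symmetric])
  have "k + y \<in> (+) k ` frontier (Zr r) \<longleftrightarrow> y \<in> frontier (Zr r)" for y
    by auto
  then have shift: "k + y \<in> frontier (Zr r) \<longleftrightarrow> y \<in> frontier (Zr r)" for y
    by (simp only: eq)
  have "x + k + t *\<^sub>R v = k + (x + t *\<^sub>R v)" for t
    by simp
  then show ?thesis
    by (simp only: free_path_def shift)
qed

lemma circle_param_measurable:
  "(\<lambda>\<theta>. vector [cos \<theta>, sin \<theta>] :: real^2)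
     \<in> restrict_space lborel {0..<2*pi} \<rightarrow>\<^sub>M restrict_space borel (sphere 0 1)"
proof (rule measurable_restrict_space2)
  show "(\<lambda>\<theta>. vector [cos \<theta>, sin \<theta>] :: real^2)
     \<in> space (restrict_space lborel {0..<2*pi}) \<rightarrow> sphere 0 1"
    by (auto simp: norm_vec_def L2_set_def sum_2)
  have "(\<lambda>\<theta>. vector [cos \<theta>, sin \<theta>] :: real^2) = (\<lambda>\<theta>. \<chi> i. if i = 1 then cos \<theta> else sin \<theta>)"
    by (auto simp: vec_eq_iff forall_2)
  moreover have "continuous_on UNIV (\<lambda>\<theta>::real. \<chi> i::2. if i = 1 then cos \<theta> else sin \<theta>)"
  proof (rule continuous_on_vec_lambda)
    fix i :: 2
    show "continuous_on UNIV (\<lambda>\<theta>. if i = 1 then cos \<theta> else sin \<theta> :: real)"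
      by (cases "i = 1") (auto intro: continuous_intros)
  qed
  ultimately show "(\<lambda>\<theta>. vector [cos \<theta>, sin \<theta>] :: real^2)
     \<in> restrict_space lborel {0..<2*pi} \<rightarrow>\<^sub>M borel"
    by (auto intro!: measurable_restrict_space1 borel_measurable_continuous_onI)
qed

lemma space_circle_measure [simp]: "space circle_measure = sphere 0 1"
  by (simp add: circle_measure_def space_restrict_space)

lemma emeasure_circle_measure: "emeasure circle_measure (sphere 0 1) = ennreal (2 * pi)"
proof -
  have "emeasure circle_measure (sphere 0 1) =
      emeasure (restrict_space lborel {0..<2*pi})
        ((\<lambda>\<theta>. vector [cos \<theta>, sin \<theta>] :: real^2) -` sphere 0 1 \<inter> {0..<2*pi})"
    unfolding circle_measure_def
    by (subst emeasure_distr[OF circle_param_measurable])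
       (auto simp: space_restrict_space sets_restrict_space)
  also have "(\<lambda>\<theta>. vector [cos \<theta>, sin \<theta>] :: real^2) -` sphere 0 1 \<inter> {0..<2*pi} = {0..<2*pi}"
    by (auto simp: norm_vec_def L2_set_def sum_2)
  finally show ?thesis by (simp add: emeasure_restrict_space)
qed

lemma prob_space_mu:
  assumes r: "0 < r" "r < 1/2"
  shows "prob_space (mu r)"
proof -
  interpret C: finite_measure circle_measure
    by (rule finite_measureI) (simp add: emeasure_circle_measure)
  let ?c = "(\<chi> i. 1/2) :: real^2"
  have open_Z: "open (Zr r)"
    unfolding Zr_def by (intro open_Collect_less continuous_intros)
  have meas: "Yr r \<in> sets borel"
  proof -
    have "Yr r = Zr r \<inter> {x. 0 \<le> x $ 1} \<inter> {x. 0 \<le> x $ 2} \<inter> {x. x $ 1 < 1} \<inter> {x. x $ 2 < 1}"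
      by (auto simp: Yr_def forall_2)
    also have "\<dots> \<in> sets borel"
      using open_Z
      by (intro sets.Int borel_open borel_closed closed_Collect_le open_Collect_less
           continuous_intros) auto
    finally show ?thesis .
  qed
  have lower: "infdist ?c int_lattice \<ge> 1/2"
  proof -
    have "(0::real^2) \<in> int_lattice" by (simp add: int_lattice_def)
    moreover have "1/2 \<le> dist ?c a" if "a \<in> int_lattice" for a
    proof -
      have "a $ 1 \<in> \<int>" using that by (simp add: int_lattice_def)
      then obtain n where n: "a $ 1 = of_int n" by (auto elim: Ints_cases)
      have "1/2 \<le> \<bar>1/2 - real_of_int n\<bar>"
        by (cases "n \<le> 0") auto
      also have "\<dots> = \<bar>(?c - a) $ 1\<bar>" using n by simp
      also have "\<dots> \<le> norm (?c - a)" by (rule component_le_norm_cart)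
      finally show ?thesis by (simp add: dist_norm)
    qed
    ultimately have "1/2 \<le> (INF a\<in>int_lattice. dist ?c a)"
      by (intro cINF_greatest) auto
    with \<open>0 \<in> int_lattice\<close> show ?thesis by (simp only: infdist_def) auto
  qed
  then have "?c \<in> Zr r" using r by (simp add: Zr_def)
  moreover have "?c \<in> {x. \<forall>i. 0 < x $ i \<and> x $ i < 1}" by simp
  moreover have "open {x::real^2. \<forall>i. 0 < x $ i \<and> x $ i < 1}"
  proof -
    have "{x::real^2. \<forall>i. 0 < x $ i \<and> x $ i < 1} = box 0 1"
      by (auto simp: mem_box_cart)
    then show ?thesis by (simp add: open_box)
  qed
  ultimately obtain e where e: "e > 0"
    "ball ?c e \<subseteq> Zr r \<inter> {x. \<forall>i. 0 < x $ i \<and> x $ i < 1}"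
    using open_Z by (meson IntI open_Int open_contains_ball)
  then have "ball ?c e \<subseteq> Yr r" unfolding Yr_def
    by (smt (verit, best) Int_iff mem_Collect_eq subset_iff)
  then have "emeasure lborel (ball ?c e) \<le> emeasure lborel (Yr r)"
    using meas by (intro emeasure_mono) auto
  moreover have "emeasure lborel (ball ?c e) \<noteq> 0"
  proof -
    have "\<not> negligible (ball ?c e)"
      using e(1) by (intro open_not_negligible) auto
    then show ?thesis by (auto simp: negligible_iff_null_sets null_sets_def)
  qed
  ultimately have pos: "emeasure lborel (Yr r) \<noteq> 0" by auto
  have "emeasure lborel (Yr r) \<le> emeasure lborel (cbox 0 (1::real^2))"
  proof (rule emeasure_mono)
    show "Yr r \<subseteq> cbox 0 1" unfolding Yr_def subset_iff mem_box_cart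
      by (metis (no_types, lifting) less_imp_le mem_Collect_eq one_index zero_index)
  qed simp
  then have fin: "emeasure lborel (Yr r) < \<infinity>"
    using emeasure_lborel_cbox_finite[of "0::real^2" 1] by (meson le_less_trans)
  have "emeasure (lborel \<Otimes>\<^sub>M circle_measure) (Yr r \<times> sphere 0 1) =
      emeasure lborel (Yr r) * emeasure circle_measure (sphere 0 1)"
    using meas sets.top[of circle_measure] by (intro C.emeasure_pair_measure_Times) auto
  then have "emeasure (lborel \<Otimes>\<^sub>M circle_measure) (Yr r \<times> sphere 0 1) =
      emeasure lborel (Yr r) * ennreal (2 * pi)"
    by (simp only: emeasure_circle_measure)
  moreover have "emeasure lborel (Yr r) * ennreal (2 * pi) \<noteq> 0"
    using pos by simp
  moreover have "emeasure lborel (Yr r) * ennreal (2 * pi) \<noteq> \<infinity>"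
    using fin by (metis ennreal_less_top ennreal_mult_less_top infinity_ennreal_def less_irrefl)
  ultimately show ?thesis
    unfolding mu_def by (intro prob_space_uniform_measure) simp_all
qed

end

theory Submission imports Defs begin

text \<open>
  Fix a direction of angle \<open>\<theta>\<close>, put \<open>T = t / r\<close>, and let \<open>F\<close> be the area of the set of points of the unit
  square from which the path of length \<open>T\<close> in this direction is free. For a lattice vector \<open>w\<close> let \<open>A\<close>
  and \<open>B\<close> be the absolute values of its components along and across the direction.

  Every primitive vector \<open>w\<close> arranges the lattice on parallel lines, which are the integer level lines of
  a linear form; this form is uniformly distributed modulo 1 on the unit square. A path whose
  \<open>r/2\<close>-neighbourhood fits between two neighbouring lines is free, so \<open>F \<ge> 1 - r |w| - T B\<close>
  (\<open>free_area_ge\<close>). Conversely, the swept rectangle of size \<open>T \<times> r\<close> contains no lattice point, so each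
  lattice line crosses it, if at all, in a chord shorter than \<open>w\<close>; when \<open>B \<le> r\<close> and \<open>2 A \<le> T\<close> such a chord
  cuts off a corner, and \<open>F \<le> max 0 (1 - r A - T B + 2 A B)\<close> (\<open>free_area_le\<close>). Dirichlet's approximation
  theorem supplies a vector to which the upper bound applies. Two different primitive vectors cannot both satisfy
  \<open>r |w| + T B < 1\<close>, because their determinant would be smaller than 1. Hence \<open>F\<close> is the sum of
  \<open>max 0 (1 - r |w| - T B)\<close> over the primitive vectors up to sign, plus a nonnegative error (\<open>free_area_le_strip_area\<close>)
  whose average over all directions is asymptotically at most \<open>8 / (t - 3)\<^sup>2\<close> as \<open>r\<close> tends to 0, by a crude
  count of lattice points (\<open>integral_corner_bound\<close>).

  It remains to find the limit of the sum over primitive vectors. Integrated over an interval \<open>J\<close> of directions, a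
  vector \<open>w\<close> pointing into \<open>J\<close> contributes \<open>(1 - r |w|)\<^sup>2 r / (t |w|)\<close>, and the others contribute almost
  nothing. Extended over all lattice points of the corresponding cone, this is a Riemann sum with limit
  \<open>|J| / (3 t)\<close> (\<open>cone_sum_tendsto\<close>). Sorting the lattice points by the greatest common divisor \<open>d\<close> of their
  coordinates writes this sum as \<open>\<Sum>\<^sub>d P(d r) / d\<^sup>2\<close>, where \<open>P\<close> is the sum over the primitive points, and
  because \<open>1/2\<^sup>2 + 1/3\<^sup>2 + \<dots>\<close> is less than 1, the limit of \<open>P\<close> follows upon division by
  \<open>1 + 1/2\<^sup>2 + 1/3\<^sup>2 + \<dots> = \<pi>\<^sup>2 / 6\<close> (\<open>tendsto_of_sum_over_multiples\<close>). So the sum over primitive vectors converges to the constant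
  \<open>2 / (\<pi>\<^sup>2 t)\<close> weakly on intervals; being bounded by 1, it does so against every integrable density
  (\<open>strip_limit_circle\<close>), in particular against \<open>m\<close>. The distribution \<open>\<Phi>(t / r)\<close> itself is therefore, for all small
  \<open>r\<close>, as close to \<open>2 / (\<pi>\<^sup>2 t)\<close> as claimed, up to an arbitrarily small error (\<open>Phi_error\<close>), and its
  logarithmic averages inherit the bound.
\<close>

section \<open>Paths and lattice lines\<close>

text \<open>The path of length \<open>T\<close> from \<open>z\<close> stays outside the closed discs of radius \<open>r/2\<close> around the lattice
  points. Speaking of squared distances to single lattice points avoids the infimum over the lattice.\<close>
definition clear :: "real \<Rightarrow> real \<Rightarrow> real \<Rightarrow> real \<times> real \<Rightarrow> bool" where
  "clear r T \<theta> z \<longleftrightarrow> (\<forall>s\<in>{0..T}. \<forall>a b :: int.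
     (r / 2)\<^sup>2 < (fst z + s * cos \<theta> - of_int a)\<^sup>2 + (snd z + s * sin \<theta> - of_int b)\<^sup>2)"

definition len :: "int \<times> int \<Rightarrow> real" where
  "len w = sqrt ((of_int (fst w))\<^sup>2 + (of_int (snd w))\<^sup>2)"

text \<open>The components of \<open>w\<close> across (\<open>perp\<close>) and along (\<open>par\<close>) the direction of angle \<open>\<theta>\<close>.\<close>
definition perp :: "int \<times> int \<Rightarrow> real \<Rightarrow> real" where
  "perp w \<theta> = of_int (fst w) * sin \<theta> - of_int (snd w) * cos \<theta>"

definition par :: "int \<times> int \<Rightarrow> real \<Rightarrow> real" where
  "par w \<theta> = of_int (fst w) * cos \<theta> + of_int (snd w) * sin \<theta>"

text \<open>The lattice lines parallel to a primitive vector \<open>w\<close> are the integer level lines of this form.\<close>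
definition offset :: "int \<times> int \<Rightarrow> real \<times> real \<Rightarrow> real" where
  "offset w z = of_int (fst w) * snd z - of_int (snd w) * fst z"

lemma len_sq: "(len w)\<^sup>2 = (of_int (fst w))\<^sup>2 + (of_int (snd w))\<^sup>2"
  by (simp add: len_def)

lemma len_nonneg: "0 \<le> len w"
  by (simp add: len_def)

lemma par_perp_sq: "(par w \<theta>)\<^sup>2 + (perp w \<theta>)\<^sup>2 = (len w)\<^sup>2"
proof -
  have "(par w \<theta>)\<^sup>2 + (perp w \<theta>)\<^sup>2
      = ((of_int (fst w))\<^sup>2 + (of_int (snd w))\<^sup>2) * ((cos \<theta>)\<^sup>2 + (sin \<theta>)\<^sup>2)"
    unfolding par_def perp_def by algebra
  then show ?thesis by (simp add: len_sq)
qed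

text \<open>Along the path the form \<open>offset w\<close> moves by \<open>T * perp w \<theta>\<close>. By the Cauchy-Schwarz inequality its values at
  points of distance at most \<open>r/2\<close> differ by at most \<open>r |w| / 2\<close>, and at lattice points they are integers.\<close>
lemma clear_if_between_lines:
  assumes "0 < r" "0 \<le> T"
    and no: "\<And>j::int. of_int j \<notin> {offset w z + (min 0 (T * perp w \<theta>) - r * len w / 2) ..
        offset w z + (min 0 (T * perp w \<theta>) - r * len w / 2) + (T * \<bar>perp w \<theta>\<bar> + r * len w)}"
  shows "clear r T \<theta> z"
  unfolding clear_def
proof (intro ballI allI)
  fix s and a b :: int assume s: "s \<in> {0..T}"
  define u where "u = fst z + s * cos \<theta> - of_int a"
  define v where "v = snd z + s * sin \<theta> - of_int b"
  define q p where "q = real_of_int (fst w)" and "p = real_of_int (snd w)"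
  show "(r / 2)\<^sup>2 < (fst z + s * cos \<theta> - of_int a)\<^sup>2 + (snd z + s * sin \<theta> - of_int b)\<^sup>2"
  proof (rule ccontr)
    assume "\<not> ?thesis"
    then have le: "u\<^sup>2 + v\<^sup>2 \<le> (r / 2)\<^sup>2" by (simp add: u_def v_def)
    have "(q * v - p * u)\<^sup>2 + (q * u + p * v)\<^sup>2 = (q\<^sup>2 + p\<^sup>2) * (u\<^sup>2 + v\<^sup>2)"
      by algebra
    then have "(q * v - p * u)\<^sup>2 \<le> (q\<^sup>2 + p\<^sup>2) * (u\<^sup>2 + v\<^sup>2)"
      by (smt (verit) zero_le_power2)
    also have "\<dots> \<le> (q\<^sup>2 + p\<^sup>2) * (r / 2)\<^sup>2"
      using le by (intro mult_left_mono) auto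
    also have "\<dots> = (len w * (r / 2))\<^sup>2"
      by (simp only: power_mult_distrib len_sq q_def p_def)
    finally have "\<bar>q * v - p * u\<bar> \<le> len w * (r / 2)"
      using assms(1) len_nonneg[of w] by (intro power2_le_imp_le[of "\<bar>q * v - p * u\<bar>"]) auto
    moreover have "q * v - p * u = offset w z + s * perp w \<theta> - of_int (fst w * b - snd w * a)"
      by (simp add: u_def v_def q_def p_def offset_def perp_def algebra_simps)
    ultimately have d: "\<bar>offset w z + s * perp w \<theta> - of_int (fst w * b - snd w * a)\<bar> \<le> r * len w / 2"
      by (simp add: mult.commute)
    have "min 0 (T * perp w \<theta>) \<le> s * perp w \<theta> \<and>
        s * perp w \<theta> \<le> min 0 (T * perp w \<theta>) + T * \<bar>perp w \<theta>\<bar>"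
    proof (cases "perp w \<theta> \<ge> 0")
      case True
      then have "0 \<le> s * perp w \<theta>" "s * perp w \<theta> \<le> T * perp w \<theta>"
        using s by (auto intro: mult_right_mono)
      then show ?thesis using True by auto
    next
      case False
      then have "s * perp w \<theta> \<le> 0" "T * perp w \<theta> \<le> s * perp w \<theta>"
        using s by (auto intro: mult_right_mono_neg simp: mult_nonneg_nonpos)
      moreover have "T * \<bar>perp w \<theta>\<bar> = - (T * perp w \<theta>)" using False by simp
      ultimately show ?thesis by linarith
    qed
    with d have "of_int (fst w * b - snd w * a) \<in> {offset w z + (min 0 (T * perp w \<theta>) - r * len w / 2) ..
        offset w z + (min 0 (T * perp w \<theta>) - r * len w / 2) + (T * \<bar>perp w \<theta>\<bar> + r * len w)}"
      unfolding atLeastAtMost_iff by linarith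
    then show False using no by blast
  qed
qed

text \<open>For a primitive vector no integer level line is empty: each carries a whole progression of lattice points with
  step \<open>w\<close>.\<close>
lemma lattice_point_on_line:
  assumes "coprime (fst w) (snd w :: int)"
  obtains a b :: int where "fst w * b - snd w * a = j"
proof -
  obtain x y where "x * fst w + y * snd w = gcd (fst w) (snd w)"
    using bezout_int by blast
  then have "x * fst w + y * snd w = 1" using assms by simp
  then have "fst w * (x * j) - snd w * (- y * j) = j"
    by (metis (no_types, opaque_lifting) diff_minus_eq_add mult.assoc mult.commute mult.left_commute mult.right_neutral distrib_right minus_mult_left minus_mult_right mult_minus_right mult_1)
  then show ?thesis using that by blast
qed

text \<open>Here \<open>S\<close> and \<open>U\<close> are the coordinates of a lattice point along and across the path, and its neighbours on the lattice
  line differ from it by \<open>(A, -\<sigma>)\<close>. The bounds on \<open>\<delta>\<close> say that the line crosses the rectangle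
  \<open>[0, T] \<times> [-r/2, r/2]\<close> in a chord which extends over at least \<open>A\<close> in the first coordinate and
  thus contains a point of the progression; only lines that cut off a small corner are excluded.\<close>
lemma progression_meets_rectangle:
  fixes A \<sigma> \<delta> S U T r :: real
  assumes "0 < A" "A \<le> T" "0 \<le> \<sigma>" "\<sigma> \<le> r"
    and line: "S * \<sigma> + U * A = \<delta>"
    and lo: "\<sigma> * A - r * A / 2 \<le> \<delta>" and hi: "\<delta> \<le> r * A / 2 + (T - A) * \<sigma>"
  obtains n :: int where "0 \<le> S + n * A" "S + n * A \<le> T" "\<bar>U - n * \<sigma>\<bar> \<le> r / 2"
proof -
  \<comment> \<open>The left end of a piece of the chord that extends over \<open>A\<close>.\<close>
  obtain S1 where S1: "0 \<le> S1" "S1 \<le> T - A" "\<delta> - r * A / 2 \<le> S1 * \<sigma>" "S1 * \<sigma> \<le> \<delta> + r * A / 2 - \<sigma> * A"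
  proof (cases "\<delta> - r * A / 2 \<le> 0")
    case True
    then show ?thesis using that[of 0] assms by auto
  next
    case False
    then have "\<sigma> > 0" using hi assms(3) by (cases "\<sigma> = 0") auto
    then have "(\<delta> - r * A / 2) / \<sigma> \<le> T - A" using hi by (simp add: field_simps)
    moreover have "\<sigma> * A \<le> r * A" using assms by (intro mult_right_mono) auto
    moreover have "0 \<le> (\<delta> - r * A / 2) / \<sigma>" using False \<open>\<sigma> > 0\<close> by simp
    moreover have "(\<delta> - r * A / 2) / \<sigma> * \<sigma> = \<delta> - r * A / 2" using \<open>\<sigma> > 0\<close> by simp
    ultimately show ?thesis using that[of "(\<delta> - r * A / 2) / \<sigma>"] by linarith
  qed
  define n where "n = \<lceil>(S1 - S) / A\<rceil>"
  have "(S1 - S) / A \<le> n" "n < (S1 - S) / A + 1" unfolding n_def by linarith+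
  then have n: "S1 \<le> S + n * A" "S + n * A \<le> S1 + A" using assms(1) by (auto simp: field_simps)
  have "(U - n * \<sigma>) * A = \<delta> - (S + n * A) * \<sigma>" using line by (simp add: algebra_simps)
  moreover have "S1 * \<sigma> \<le> (S + n * A) * \<sigma>" "(S + n * A) * \<sigma> \<le> (S1 + A) * \<sigma>"
    using n assms(3) by (auto intro: mult_right_mono)
  ultimately have "(U - n * \<sigma>) * A \<le> (r / 2) * A" "(- (r / 2)) * A \<le> (U - n * \<sigma>) * A"
    using S1 by (auto simp: algebra_simps)
  then have "U - n * \<sigma> \<le> r / 2" "- (r / 2) \<le> U - n * \<sigma>"
    using assms(1) by (meson mult_le_cancel_right_pos)+
  then have "\<bar>U - n * \<sigma>\<bar> \<le> r / 2" by linarith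
  moreover have "0 \<le> S + n * A" "S + n * A \<le> T" using n S1 by linarith+
  ultimately show ?thesis using that[of n] by blast
qed

text \<open>The length of the interval of lines that are certain to hit does not depend on the signs of \<open>A\<close> and \<open>\<sigma>\<close>, but its
  position does.\<close>
lemma progression_meets_rectangle_abs:
  fixes A \<sigma> T r :: real
  assumes A: "A \<noteq> 0" "\<bar>A\<bar> \<le> T" "\<bar>\<sigma>\<bar> \<le> r"
  shows "\<exists>lo. \<forall>\<delta> S U. S * \<sigma> + U * A = \<delta> \<longrightarrow> lo \<le> \<delta> \<longrightarrow>
      \<delta> \<le> lo + (r * \<bar>A\<bar> + T * \<bar>\<sigma>\<bar> - 2 * \<bar>A\<bar> * \<bar>\<sigma>\<bar>) \<longrightarrow>
      (\<exists>n::int. 0 \<le> S + n * A \<and> S + n * A \<le> T \<and> \<bar>U - n * \<sigma>\<bar> \<le> r / 2)"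
proof -
  \<comment> \<open>Reflecting the axes by the signs \<open>s\<close> and \<open>a\<close> reduces all cases to nonnegative \<open>A\<close> and \<open>\<sigma>\<close>.\<close>
  define a :: int where "a = (if 0 \<le> A then 1 else -1)"
  define s :: int where "s = (if 0 \<le> \<sigma> then 1 else -1)"
  have a: "a * A = \<bar>A\<bar>" and s: "s * \<sigma> = \<bar>\<sigma>\<bar>" and as: "real_of_int a * a = 1" "\<bar>real_of_int (s * a)\<bar> = 1"
    by (auto simp: a_def s_def)
  define lo where "lo = (if 0 \<le> \<sigma> then \<bar>\<sigma>\<bar> * \<bar>A\<bar> - r * \<bar>A\<bar> / 2 else - (r * \<bar>A\<bar> / 2 + (T - \<bar>A\<bar>) * \<bar>\<sigma>\<bar>))"
  show ?thesis
  proof (rule exI[of _ lo], intro allI impI)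
    fix \<delta> S U assume h: "S * \<sigma> + U * A = \<delta>" "lo \<le> \<delta>"
      "\<delta> \<le> lo + (r * \<bar>A\<bar> + T * \<bar>\<sigma>\<bar> - 2 * \<bar>A\<bar> * \<bar>\<sigma>\<bar>)"
    have "S * \<bar>\<sigma>\<bar> + (s * a * U) * \<bar>A\<bar> = s * \<delta> * (real_of_int a * a) + S * (s * \<sigma>) * (1 - real_of_int a * a)"
      unfolding h(1)[symmetric] a[symmetric] s[symmetric] by (simp add: algebra_simps)
    then have line: "S * \<bar>\<sigma>\<bar> + (s * a * U) * \<bar>A\<bar> = s * \<delta>" by (simp only: as) simp
    have lo': "\<bar>\<sigma>\<bar> * \<bar>A\<bar> - r * \<bar>A\<bar> / 2 \<le> s * \<delta>" and hi': "s * \<delta> \<le> r * \<bar>A\<bar> / 2 + (T - \<bar>A\<bar>) * \<bar>\<sigma>\<bar>"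
      using h(2,3) unfolding lo_def s_def by (cases "0 \<le> \<sigma>"; simp add: algebra_simps)+
    have "0 < \<bar>A\<bar>" using A by simp
    from progression_meets_rectangle[OF this A(2) abs_ge_zero A(3) line lo' hi']
    obtain n :: int where n: "0 \<le> S + n * \<bar>A\<bar>" "S + n * \<bar>A\<bar> \<le> T" "\<bar>s * a * U - n * \<bar>\<sigma>\<bar>\<bar> \<le> r / 2" by blast
    have "s * a * U - n * \<bar>\<sigma>\<bar> = real_of_int (s * a) * (U - of_int (a * n) * \<sigma>) + n * \<bar>\<sigma>\<bar> * (real_of_int a * a - 1)"
      unfolding s[symmetric] by (simp add: algebra_simps)
    then have e: "s * a * U - n * \<bar>\<sigma>\<bar> = real_of_int (s * a) * (U - of_int (a * n) * \<sigma>)"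
      by (simp only: as(1)) simp
    have "\<bar>s * a * U - n * \<bar>\<sigma>\<bar>\<bar> = \<bar>U - of_int (a * n) * \<sigma>\<bar>" unfolding e abs_mult as(2) by simp
    moreover have "of_int (a * n) * A = n * \<bar>A\<bar>" unfolding a[symmetric] by simp
    ultimately show "\<exists>n::int. 0 \<le> S + n * A \<and> S + n * A \<le> T \<and> \<bar>U - n * \<sigma>\<bar> \<le> r / 2"
      using n by (intro exI[of _ "a * n"] conjI) (simp_all only:)
  qed
qed

text \<open>A free path sweeps a rectangle without lattice points, so no lattice line hits it in a long chord. Compared with the
  sufficient condition above, the interval that has to avoid the integers is shorter by \<open>2 |par w| |perp w|\<close>, which accounts for the
  two corners, and has \<open>|par w|\<close> in place of \<open>|w|\<close>.\<close>
lemma clear_imp_between_lines: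
  assumes cop: "coprime (fst w) (snd w)"
    and "par w \<theta> \<noteq> 0" "\<bar>par w \<theta>\<bar> \<le> T" "\<bar>perp w \<theta>\<bar> \<le> r"
  shows "\<exists>lo. \<forall>z. clear r T \<theta> z \<longrightarrow> (\<forall>j::int. of_int j \<notin> {offset w z + lo ..
        offset w z + lo + (r * \<bar>par w \<theta>\<bar> + T * \<bar>perp w \<theta>\<bar> - 2 * \<bar>par w \<theta>\<bar> * \<bar>perp w \<theta>\<bar>)})"
proof -
  obtain lo where lo: "\<And>\<delta> S U. S * perp w \<theta> + U * par w \<theta> = \<delta> \<Longrightarrow> lo \<le> \<delta> \<Longrightarrow>
      \<delta> \<le> lo + (r * \<bar>par w \<theta>\<bar> + T * \<bar>perp w \<theta>\<bar> - 2 * \<bar>par w \<theta>\<bar> * \<bar>perp w \<theta>\<bar>) \<Longrightarrow>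
      (\<exists>n::int. 0 \<le> S + n * par w \<theta> \<and> S + n * par w \<theta> \<le> T \<and> \<bar>U - n * perp w \<theta>\<bar> \<le> r / 2)"
    using progression_meets_rectangle_abs[OF assms(2-4)] by blast
  show ?thesis
  proof (rule exI[of _ lo], intro allI impI notI)
    fix z and j :: int
    assume cl: "clear r T \<theta> z" and j: "of_int j \<in> {offset w z + lo ..
        offset w z + lo + (r * \<bar>par w \<theta>\<bar> + T * \<bar>perp w \<theta>\<bar> - 2 * \<bar>par w \<theta>\<bar> * \<bar>perp w \<theta>\<bar>)}"
    obtain a b where ab: "fst w * b - snd w * a = j"
      using lattice_point_on_line[OF cop] by blast
    define x y c s where "x = real_of_int a - fst z" and "y = real_of_int b - snd z"
      and "c = cos \<theta>" and "s = sin \<theta>"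
    have cs: "c\<^sup>2 + s\<^sup>2 = 1" by (simp add: c_def s_def)
    define S U where "S = x * c + y * s" and "U = y * c - x * s"
    have "S * perp w \<theta> + U * par w \<theta> = (of_int (fst w) * y - of_int (snd w) * x) * (c\<^sup>2 + s\<^sup>2)"
      unfolding S_def U_def perp_def par_def c_def[symmetric] s_def[symmetric] by algebra
    also have "\<dots> = of_int j - offset w z"
      using ab by (auto simp: cs x_def y_def offset_def algebra_simps simp flip: ab)
    finally obtain n :: int where n: "0 \<le> S + n * par w \<theta>" "S + n * par w \<theta> \<le> T"
      "\<bar>U - n * perp w \<theta>\<bar> \<le> r / 2"
      using lo[of S U] j by fastforce
    define S' U' where "S' = S + n * par w \<theta>" and "U' = U - n * perp w \<theta>"
    define x' y' where "x' = x + n * of_int (fst w)" and "y' = y + n * of_int (snd w)"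
    have "S' = x' * c + y' * s" "U' = y' * c - x' * s"
      by (simp_all add: S'_def U'_def S_def U_def x'_def y'_def par_def perp_def c_def s_def algebra_simps)
    then have "(S' * c - x')\<^sup>2 + (S' * s - y')\<^sup>2 = U'\<^sup>2" using cs by algebra
    moreover have "U'\<^sup>2 \<le> (r / 2)\<^sup>2"
      using n(3) unfolding U'_def by (metis abs_ge_zero power2_abs power_mono)
    ultimately have "(fst z + S' * cos \<theta> - of_int (a + n * fst w))\<^sup>2
        + (snd z + S' * sin \<theta> - of_int (b + n * snd w))\<^sup>2 \<le> (r / 2)\<^sup>2"
      by (simp add: x'_def y'_def x_def y_def c_def s_def algebra_simps)
    moreover have "S' \<in> {0..T}" using n by (simp add: S'_def)
    ultimately show False using cl unfolding clear_def by (meson not_less)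
  qed
qed

section \<open>Linear forms modulo 1 on the unit square\<close>

lemma emeasure_lborel_translate:
  fixes S :: "real set"
  assumes "S \<in> sets borel"
  shows "emeasure lborel ((\<lambda>x. c + x) -` S) = emeasure lborel S"
proof -
  have "emeasure lborel S = (\<integral>\<^sup>+x. indicator S x \<partial>lborel)" using assms by simp
  also have "\<dots> = (\<integral>\<^sup>+x. indicator S (c + 1 * x) \<partial>lborel)"
    using nn_integral_real_affine[of "indicator S" 1 c] assms by simp
  also have "\<dots> = (\<integral>\<^sup>+x. indicator ((\<lambda>x. c + x) -` S) x \<partial>lborel)"
    by (intro nn_integral_cong) (auto simp: indicator_def)
  also have "\<dots> = emeasure lborel ((\<lambda>x. c + x) -` S)"
    by (intro nn_integral_indicator) (simp add: measurable_sets_borel[OF _ assms])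
  finally show ?thesis by simp
qed

text \<open>For \<open>0 \<le> L < 1\<close> these are the reals whose fractional part lies strictly between 0 and \<open>1 - L\<close>.\<close>
definition gap :: "real \<Rightarrow> real set" where
  "gap L = {y. \<forall>j::int. of_int j \<notin> {y .. y + L}}"

lemma gap_borel: "gap L \<in> sets borel"
proof -
  have "gap L = (\<Inter>j::int. - {of_int j - L .. of_int j})"
    by (auto simp: gap_def)
  also have "\<dots> \<in> sets borel" by (intro sets.countable_INT) auto
  finally show ?thesis .
qed

lemma gap_add_int: "of_int k + y \<in> gap L \<longleftrightarrow> y \<in> gap L"
proof -
  have "of_int k + y \<in> gap L" if "y \<in> gap L" for k y
  proof -
    have "of_int j \<notin> {of_int k + y .. of_int k + y + L}" for j
      using that by (auto simp: gap_def dest: spec[of _ "j - k"])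
    then show ?thesis by (simp add: gap_def)
  qed
  from this[of y k] this[of "of_int k + y" "-k"] show ?thesis by auto
qed

lemma gap_unit: "0 \<le> L \<Longrightarrow> gap L \<inter> {0..<1} = {0<..<1 - L}"
proof (intro set_eqI iffI)
  fix y assume "0 \<le> L" "y \<in> {0<..<1 - L}"
  moreover have "of_int j \<notin> {y..y + L}" for j :: int
    using calculation by (cases "j \<le> 0") auto
  ultimately show "y \<in> gap L \<inter> {0..<1}" by (auto simp: gap_def)
next
  fix y assume "0 \<le> L" "y \<in> gap L \<inter> {0..<1}"
  then have "real_of_int 0 \<notin> {y..y + L}" "real_of_int 1 \<notin> {y..y + L}" "0 \<le> y" "y < 1" "0 \<le> L"
    unfolding gap_def by (blast, blast, auto)
  then show "y \<in> {0<..<1 - L}" by auto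
qed

text \<open>The set is invariant under integer translations, so a window of length one may be cut at an integer and
  reassembled to the unit interval.\<close>
lemma emeasure_gap_period:
  assumes "0 \<le> L"
  shows "emeasure lborel (gap L \<inter> {\<beta>..<\<beta> + 1}) = ennreal (max 0 (1 - L))"
proof -
  define n :: int where "n = \<lfloor>\<beta>\<rfloor>"
  define b where "b = \<beta> - n"
  have b: "0 \<le> b" "b < 1" unfolding b_def n_def by linarith+
  let ?G = "gap L"
  have "emeasure lborel (?G \<inter> {\<beta>..<\<beta> + 1}) = emeasure lborel ((\<lambda>x. of_int n + x) -` (?G \<inter> {\<beta>..<\<beta> + 1}))"
    by (rule emeasure_lborel_translate[symmetric]) (use gap_borel in auto)
  also have "(\<lambda>x. of_int n + x) -` (?G \<inter> {\<beta>..<\<beta> + 1}) = ?G \<inter> {b..<b + 1}"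
    by (auto simp: gap_add_int b_def)
  also have "?G \<inter> {b..<b + 1} = (?G \<inter> {b..<1}) \<union> (?G \<inter> {1..<b + 1})" using b by auto
  also have "emeasure lborel \<dots> = emeasure lborel (?G \<inter> {b..<1}) + emeasure lborel (?G \<inter> {1..<b + 1})"
    by (intro plus_emeasure[symmetric]) (use gap_borel in auto)
  also have "emeasure lborel (?G \<inter> {1..<b + 1}) = emeasure lborel ((\<lambda>x. of_int 1 + x) -` (?G \<inter> {1..<b + 1}))"
    by (rule emeasure_lborel_translate[symmetric]) (use gap_borel in auto)
  also have "(\<lambda>x. of_int 1 + x) -` (?G \<inter> {1..<b + 1}) = ?G \<inter> {0..<b}"
    using gap_add_int[of 1 _ L] by auto
  also have "emeasure lborel (?G \<inter> {b..<1}) + emeasure lborel (?G \<inter> {0..<b})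
      = emeasure lborel ((?G \<inter> {b..<1}) \<union> (?G \<inter> {0..<b}))"
    by (intro plus_emeasure) (use gap_borel in auto)
  also have "(?G \<inter> {b..<1}) \<union> (?G \<inter> {0..<b}) = ?G \<inter> {0..<1}" using b by auto
  also have "emeasure lborel \<dots> = ennreal (max 0 (1 - L))"
    using assms by (simp add: gap_unit max_def)
  finally show ?thesis .
qed

lemma emeasure_gap_periods:
  assumes "0 \<le> L"
  shows "emeasure lborel (gap L \<inter> {\<beta>..<\<beta> + real n}) = ennreal (real n * max 0 (1 - L))"
proof (induction n)
  case (Suc n)
  have "gap L \<inter> {\<beta>..<\<beta> + real (Suc n)} = (gap L \<inter> {\<beta>..<\<beta> + real n}) \<union> (gap L \<inter> {\<beta> + real n..<\<beta> + real n + 1})"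
    by auto
  also have "emeasure lborel \<dots> = emeasure lborel (gap L \<inter> {\<beta>..<\<beta> + real n})
      + emeasure lborel (gap L \<inter> {\<beta> + real n..<\<beta> + real n + 1})"
    by (intro plus_emeasure[symmetric]) (use gap_borel in auto)
  also have "\<dots> = ennreal (real (Suc n) * max 0 (1 - L))"
    unfolding Suc.IH emeasure_gap_period[OF assms]
    by (subst ennreal_plus[symmetric]) (auto simp: algebra_simps)
  finally show ?case .
qed simp

text \<open>The affine map stretches the unit interval over \<open>q\<close> periods.\<close>
lemma emeasure_gap_affine:
  fixes q :: int
  assumes "0 \<le> L" "0 < q"
  shows "emeasure lborel {y\<in>{0..<1}. of_int q * y + \<beta> \<in> gap L} = ennreal (max 0 (1 - L))"
proof -
  let ?S = "gap L \<inter> {\<beta>..<\<beta> + real (nat q)}"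
  have S: "?S \<in> sets borel" using gap_borel by auto
  have eq: "{y\<in>{0..<1}. of_int q * y + \<beta> \<in> gap L} = (\<lambda>y. \<beta> + of_int q * y) -` ?S"
    using assms(2) by (auto simp: add.commute zero_le_mult_iff mult_less_cancel_left_pos)
  have "ennreal (of_int q * max 0 (1 - L)) = emeasure lborel ?S"
    using emeasure_gap_periods[OF assms(1), of \<beta> "nat q"] assms(2) by simp
  also have "\<dots> = (\<integral>\<^sup>+x. indicator ?S x \<partial>lborel)" using S by simp
  also have "\<dots> = ennreal (of_int q) * (\<integral>\<^sup>+x. indicator ?S (\<beta> + of_int q * x) \<partial>lborel)"
    using nn_integral_real_affine[of "indicator ?S" "of_int q" \<beta>] S assms(2) by simp
  also have "(\<integral>\<^sup>+x. indicator ?S (\<beta> + of_int q * x) \<partial>lborel)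
      = (\<integral>\<^sup>+x. indicator ((\<lambda>y. \<beta> + of_int q * y) -` ?S) x \<partial>lborel)"
    by (intro nn_integral_cong) (auto simp: indicator_def)
  also have "\<dots> = emeasure lborel ((\<lambda>y. \<beta> + of_int q * y) -` ?S)"
    by (intro nn_integral_indicator, unfold sets_lborel, rule measurable_sets_borel[OF _ S]) simp
  finally have "ennreal (of_int q) * ennreal (max 0 (1 - L)) = ennreal (of_int q) * emeasure lborel ((\<lambda>y. \<beta> + of_int q * y) -` ?S)"
    by (subst (asm) ennreal_mult') (use assms(2) in simp)
  then show ?thesis unfolding eq using assms(2)
    by (metis ennreal_mult_cancel_left ennreal_neq_top ennreal_eq_0_iff not_le of_int_0_less_iff)
qed

text \<open>One vector of each pair \<open>\<plusminus>w\<close> of primitive vectors. The sign of the vertical one is chosen such that its form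
  \<open>offset\<close> is the first coordinate.\<close>
definition prim :: "(int \<times> int) set" where
  "prim = {w. coprime (fst w) (snd w) \<and> (0 < fst w \<or> w = (0, -1))}"

text \<open>In one of the two coordinates the form has a positive integer coefficient; for every value of the other
  coordinate, the one-dimensional statement applies.\<close>
lemma emeasure_offset_gap:
  assumes "w \<in> prim" "0 \<le> L"
  shows "emeasure lborel {z \<in> {0..<1} \<times> {0..<1}. offset w z + lo \<in> gap L} = ennreal (max 0 (1 - L))"
proof -
  let ?X = "{z \<in> {0..<1} \<times> {0..<1}. offset w z + lo \<in> gap L} :: (real \<times> real) set"
  have "(\<lambda>z. offset w z + lo) \<in> borel_measurable borel"
    unfolding offset_def by (intro borel_measurable_continuous_onI continuous_intros)
  then have "(\<lambda>z. offset w z + lo) -` gap L \<in> sets borel"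
    using measurable_sets_borel[OF _ gap_borel] by blast
  then have "({0..<1} \<times> {0..<1}) \<inter> (\<lambda>z. offset w z + lo) -` gap L \<in> sets borel"
    by (intro sets.Int borel_Times) auto
  moreover have "({0..<1} \<times> {0..<1}) \<inter> (\<lambda>z. offset w z + lo) -` gap L = ?X" by auto
  ultimately have "?X \<in> sets borel" by simp
  then have X: "?X \<in> sets (lborel \<Otimes>\<^sub>M lborel)" by (simp only: lborel_prod sets_lborel)
  show ?thesis
  proof (cases "0 < fst w")
    case True
    have "emeasure lborel ?X = emeasure (lborel \<Otimes>\<^sub>M lborel) ?X" by (simp only: lborel_prod)
    also have "\<dots> = (\<integral>\<^sup>+x. emeasure lborel (Pair x -` ?X) \<partial>lborel)"
      by (rule lborel.emeasure_pair_measure_alt[OF X])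
    also have "\<dots> = (\<integral>\<^sup>+x. ennreal (max 0 (1 - L)) * indicator {0..<1::real} x \<partial>lborel)"
    proof (intro nn_integral_cong)
      fix x :: real
      have "Pair x -` ?X = (if x \<in> {0..<1} then
          {y\<in>{0..<1}. of_int (fst w) * y + (lo - of_int (snd w) * x) \<in> gap L} else {})"
        by (auto simp: offset_def algebra_simps)
      then show "emeasure lborel (Pair x -` ?X) = ennreal (max 0 (1 - L)) * indicator {0..<1} x"
        using emeasure_gap_affine[OF assms(2) True] by (simp add: indicator_def)
    qed
    also have "\<dots> = ennreal (max 0 (1 - L))"
      by (subst nn_integral_cmult_indicator) auto
    finally show ?thesis .
  next
    case False
    then have w: "w = (0, -1)" using assms by (auto simp: prim_def)
    have "emeasure lborel ?X = emeasure (lborel \<Otimes>\<^sub>M lborel) ?X" by (simp only: lborel_prod)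
    also have "\<dots> = (\<integral>\<^sup>+y. emeasure lborel ((\<lambda>x. (x, y)) -` ?X) \<partial>lborel)"
      by (rule lborel_pair.emeasure_pair_measure_alt2[OF X])
    also have "\<dots> = (\<integral>\<^sup>+y. ennreal (max 0 (1 - L)) * indicator {0..<1::real} y \<partial>lborel)"
    proof (intro nn_integral_cong)
      fix y :: real
      have "(\<lambda>x. (x, y)) -` ?X = (if y \<in> {0..<1} then
          {x\<in>{0..<1}. of_int 1 * x + lo \<in> gap L} else {})"
        by (auto simp: offset_def w)
      then show "emeasure lborel ((\<lambda>x. (x, y)) -` ?X) = ennreal (max 0 (1 - L)) * indicator {0..<1} y"
        using emeasure_gap_affine[OF assms(2), of 1 lo] by (simp add: indicator_def)
    qed
    also have "\<dots> = ennreal (max 0 (1 - L))"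
      by (subst nn_integral_cmult_indicator) auto
    finally show ?thesis .
  qed
qed

section \<open>The area of free starting points\<close>

text \<open>Each lattice point excludes the projection, along the compact interval of times, of a closed set. Times are rescaled to
  \<open>[0, 1]\<close> so that \<open>T\<close> can be one of the parameters.\<close>
lemma borel_clear:
  "{p :: real \<times> real \<times> real \<times> real \<times> real. 0 \<le> fst (snd p) \<and> clear (fst p) (fst (snd p)) (fst (snd (snd p))) (snd (snd (snd p)))}
    \<in> sets borel" (is "?S \<in> _")
proof -
  define hit where "hit a b = {p. \<exists>u. u \<in> {0..1} \<and> (u, p) \<in> {(u, r, T, \<theta>, x, y).
      (x + u * T * cos \<theta> - of_int a)\<^sup>2 + (y + u * T * sin \<theta> - of_int b)\<^sup>2 \<le> (r / 2 :: real)\<^sup>2}}" for a b :: int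
  have hit: "closed (hit a b)" for a b
    unfolding hit_def case_prod_unfold
    by (intro closed_compact_projection compact_Icc closed_Collect_le continuous_intros) simp_all
  have "clear r T \<theta> (x, y) \<longleftrightarrow> (\<forall>a b. (r, T, \<theta>, x, y) \<notin> hit a b)" if "0 \<le> T" for r T \<theta> x y
  proof -
    define Q where "Q a b u = (x + u * T * cos \<theta> - of_int a)\<^sup>2 + (y + u * T * sin \<theta> - of_int b)\<^sup>2"
      for a b :: int and u
    have "{0..T} = (\<lambda>u. u * T) ` {0..1}" using that by (simp add: image_mult_atLeastAtMost_if')
    then have "\<And>P. (\<forall>s\<in>{0..T}. P s) \<longleftrightarrow> (\<forall>u\<in>{0..1}. P (u * T))" by auto
    then have "clear r T \<theta> (x, y) \<longleftrightarrow> (\<forall>u\<in>{0..1}. \<forall>a b. (r / 2)\<^sup>2 < Q a b u)"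
      by (simp only: clear_def Q_def fst_conv snd_conv)
    moreover have "(r, T, \<theta>, x, y) \<notin> hit a b \<longleftrightarrow> (\<forall>u\<in>{0..1}. (r / 2)\<^sup>2 < Q a b u)" for a b
      by (simp add: hit_def Q_def Ball_def not_le imp_conv_disj)
    ultimately show ?thesis by blast
  qed
  then have "?S = {p. 0 \<le> fst (snd p)} - (\<Union>a b. hit a b)" by (auto simp: split_paired_all)
  moreover have "(\<Union>b. hit a b) \<in> sets borel" for a
    using hit by (intro sets.countable_UN) (auto intro: borel_closed)
  then have "(\<Union>a b. hit a b) \<in> sets borel" by (intro sets.countable_UN) auto
  moreover have "{p :: real \<times> real \<times> real \<times> real \<times> real. 0 \<le> fst (snd p)} \<in> sets borel"
    by (intro borel_closed closed_Collect_le continuous_intros)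
  ultimately show ?thesis by auto
qed

lemma clear_measurable:
  assumes [measurable]: "fr \<in> borel_measurable M" "fT \<in> borel_measurable M"
      "f\<theta> \<in> borel_measurable M" "fx \<in> borel_measurable M" "fy \<in> borel_measurable M"
    and T: "\<And>p. 0 \<le> fT p"
  shows "Measurable.pred M (\<lambda>p. clear (fr p) (fT p) (f\<theta> p) (fx p, fy p))"
proof -
  have "(\<lambda>p. (fr p, fT p, f\<theta> p, fx p, fy p)) \<in> borel_measurable M" by measurable
  from measurable_sets[OF this borel_clear] show ?thesis
    using T by (simp add: pred_def vimage_def Int_def conj_commute)
qed

definition free_set :: "real \<Rightarrow> real \<Rightarrow> real \<Rightarrow> (real \<times> real) set" where
  "free_set r T \<theta> = {z \<in> {0..<1} \<times> {0..<1}. clear r T \<theta> z}"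

definition free_area :: "real \<Rightarrow> real \<Rightarrow> real \<Rightarrow> real" where
  "free_area r T \<theta> = measure lborel (free_set r T \<theta>)"

lemma free_set_borel: 
  assumes "0 \<le> T"
  shows "free_set r T \<theta> \<in> sets borel"
proof -
  have "Measurable.pred borel (\<lambda>z. clear r T \<theta> (fst z, snd z))"
    by (rule clear_measurable) (use assms in \<open>auto simp flip: borel_prod\<close>)
  then have "{z. clear r T \<theta> z} \<in> sets borel"
    by (simp add: pred_def)
  then have "({0..<1} \<times> {0..<1}) \<inter> {z. clear r T \<theta> z} \<in> sets borel"
    by (intro sets.Int borel_Times) auto
  moreover have "({0..<1} \<times> {0..<1}) \<inter> {z. clear r T \<theta> z} = free_set r T \<theta>" by (auto simp: free_set_def)
  ultimately show ?thesis by simp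
qed

lemma emeasure_unit_square: "emeasure lborel ({0..<1} \<times> {0..<1} :: (real \<times> real) set) = 1"
  by (subst lborel_prod[symmetric], subst lborel.emeasure_pair_measure_Times) auto

lemma emeasure_free_set: 
  assumes "0 \<le> T"
  shows "emeasure lborel (free_set r T \<theta>) = ennreal (free_area r T \<theta>)"
proof -
  have "emeasure lborel (free_set r T \<theta>) \<le> emeasure lborel ({0..<1} \<times> {0..<1} :: (real \<times> real) set)"
    by (intro emeasure_mono) (auto simp: free_set_def borel_Times)
  then have "emeasure lborel (free_set r T \<theta>) < \<infinity>"
    unfolding emeasure_unit_square by (auto simp: order.strict_trans1)
  then show ?thesis unfolding free_area_def
    by (simp add: emeasure_eq_ennreal_measure less_top[symmetric])
qed

lemma free_area_nonneg: "0 \<le> free_area r T \<theta>"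
  by (simp add: free_area_def)

text \<open>Starting points between two neighbouring lattice lines parallel to \<open>w\<close>.\<close>
lemma free_area_ge:
  assumes "0 < r" "0 \<le> T" "w \<in> prim"
  shows "max 0 (1 - (T * \<bar>perp w \<theta>\<bar> + r * len w)) \<le> free_area r T \<theta>"
proof -
  let ?L = "T * \<bar>perp w \<theta>\<bar> + r * len w"
  let ?lo = "min 0 (T * perp w \<theta>) - r * len w / 2"
  have "{z \<in> {0..<1} \<times> {0..<1}. offset w z + ?lo \<in> gap ?L} \<subseteq> free_set r T \<theta>"
  proof (rule subsetI)
    fix z assume z: "z \<in> {z \<in> {0..<1} \<times> {0..<1}. offset w z + ?lo \<in> gap ?L}"
    have "clear r T \<theta> z"
      by (rule clear_if_between_lines[OF assms(1,2), of w z]) (use z in \<open>simp add: gap_def\<close>)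
    then show "z \<in> free_set r T \<theta>" using z by (simp add: free_set_def)
  qed
  then have "emeasure lborel {z \<in> {0..<1} \<times> {0..<1}. offset w z + ?lo \<in> gap ?L} \<le> emeasure lborel (free_set r T \<theta>)"
    using free_set_borel[OF assms(2)] by (intro emeasure_mono) auto
  then have "ennreal (max 0 (1 - ?L)) \<le> ennreal (free_area r T \<theta>)"
    using assms len_nonneg[of w] by (subst (asm) emeasure_offset_gap) (auto simp: emeasure_free_set)
  then show ?thesis by (simp add: free_area_nonneg)
qed

lemma len_ge_1:
  assumes "w \<in> prim"
  shows "1 \<le> len w"
proof -
  have "0 < (fst w)\<^sup>2 + (snd w)\<^sup>2"
    using assms by (auto simp: prim_def sum_power2_gt_zero_iff)
  then have "1 \<le> (fst w)\<^sup>2 + (snd w)\<^sup>2" by simp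
  then have "real_of_int 1 \<le> real_of_int ((fst w)\<^sup>2 + (snd w)\<^sup>2)" by (rule of_int_le_iff[THEN iffD2])
  then show ?thesis by (simp add: len_def)
qed

text \<open>The condition \<open>2 |par w| \<le> T\<close> makes the forbidden interval nonempty, and \<open>|perp w| \<le> r < 1 \<le> |w|\<close> keeps
  \<open>par w\<close> away from 0.\<close>
lemma free_area_le:
  assumes "0 < r" "r < 1" "w \<in> prim" "\<bar>perp w \<theta>\<bar> \<le> r" "2 * \<bar>par w \<theta>\<bar> \<le> T"
  shows "free_area r T \<theta> \<le> max 0 (1 - (r * \<bar>par w \<theta>\<bar> + T * \<bar>perp w \<theta>\<bar> - 2 * \<bar>par w \<theta>\<bar> * \<bar>perp w \<theta>\<bar>))"
proof -
  let ?L = "r * \<bar>par w \<theta>\<bar> + T * \<bar>perp w \<theta>\<bar> - 2 * \<bar>par w \<theta>\<bar> * \<bar>perp w \<theta>\<bar>"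
  have "par w \<theta> \<noteq> 0"
  proof
    assume "par w \<theta> = 0"
    then have "(len w)\<^sup>2 = (perp w \<theta>)\<^sup>2" using par_perp_sq[of w \<theta>] by simp
    then have "len w = \<bar>perp w \<theta>\<bar>" using len_nonneg[of w] by (metis abs_of_nonneg real_sqrt_abs)
    then show False using len_ge_1[OF assms(3)] assms by simp
  qed
  moreover have "coprime (fst w) (snd w)" using assms(3) by (auto simp: prim_def)
  moreover have "\<bar>par w \<theta>\<bar> \<le> T" using assms(5) by linarith
  ultimately obtain lo where "\<forall>z. clear r T \<theta> z \<longrightarrow> (\<forall>j::int. of_int j \<notin> {offset w z + lo .. offset w z + lo + ?L})"
    using clear_imp_between_lines[of w \<theta> T r] assms(4) by blast
  then have lo: "offset w z + lo \<in> gap ?L" if "clear r T \<theta> z" for z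
    using that unfolding gap_def by blast
  have L: "0 \<le> ?L"
  proof -
    have "(2 * \<bar>par w \<theta>\<bar>) * \<bar>perp w \<theta>\<bar> \<le> T * \<bar>perp w \<theta>\<bar>" using assms by (intro mult_right_mono) auto
    moreover have "0 \<le> r * \<bar>par w \<theta>\<bar>" using assms by auto
    ultimately show ?thesis by linarith
  qed
  have T: "0 \<le> T" using assms(5) by linarith
  have em: "emeasure lborel {z \<in> {0..<1} \<times> {0..<1}. offset w z + lo \<in> gap ?L} = ennreal (max 0 (1 - ?L))"
    by (rule emeasure_offset_gap[OF assms(3) L])
  have "emeasure lborel (free_set r T \<theta>) \<le> emeasure lborel {z \<in> {0..<1} \<times> {0..<1}. offset w z + lo \<in> gap ?L}"
  proof (rule emeasure_mono)
    show "free_set r T \<theta> \<subseteq> {z \<in> {0..<1} \<times> {0..<1}. offset w z + lo \<in> gap ?L}"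
      using lo by (auto simp: free_set_def)
    have "(\<lambda>z. offset w z + lo) \<in> borel_measurable borel"
      unfolding offset_def by (intro borel_measurable_continuous_onI continuous_intros)
    then have "(\<lambda>z. offset w z + lo) -` gap ?L \<in> sets borel"
      using measurable_sets_borel[OF _ gap_borel] by blast
    then have "({0..<1} \<times> {0..<1}) \<inter> (\<lambda>z. offset w z + lo) -` gap ?L \<in> sets borel"
      by (intro sets.Int borel_Times) auto
    moreover have "({0..<1} \<times> {0..<1}) \<inter> (\<lambda>z. offset w z + lo) -` gap ?L
      = {z \<in> {0..<1} \<times> {0..<1}. offset w z + lo \<in> gap ?L}" by auto
    ultimately show "{z \<in> {0..<1} \<times> {0..<1}. offset w z + lo \<in> gap ?L} \<in> sets lborel" by simp
  qed
  then have "ennreal (free_area r T \<theta>) \<le> ennreal (max 0 (1 - ?L))"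
    by (simp add: em emeasure_free_set[OF T])
  then show ?thesis by (subst (asm) ennreal_le_iff) auto
qed

section \<open>Strips of short lattice vectors\<close>

text \<open>The share of starting points in the strips of \<open>w\<close> for paths of length \<open>t / r\<close>.\<close>
definition kern :: "real \<Rightarrow> real \<Rightarrow> int \<times> int \<Rightarrow> real \<Rightarrow> real" where
  "kern r t w \<theta> = max 0 (1 - (r * len w + t / r * \<bar>perp w \<theta>\<bar>))"

text \<open>At most one summand is nonzero, so that this is also the area of the largest strip.\<close>
definition strip_area :: "real \<Rightarrow> real \<Rightarrow> real \<Rightarrow> real" where
  "strip_area r t \<theta> = (\<Sum>w | w \<in> prim \<and> r * len w < 1. kern r t w \<theta>)"

lemma abs_fst_le_len: "\<bar>of_int (fst w)\<bar> \<le> len w" and abs_snd_le_len: "\<bar>of_int (snd w)\<bar> \<le> len w"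
  unfolding len_def by (simp_all add: real_le_rsqrt)

lemma short_vectors_subset:
  "{w. len w \<le> R} \<subseteq> {-\<lfloor>R\<rfloor>..\<lfloor>R\<rfloor>} \<times> {-\<lfloor>R\<rfloor>..\<lfloor>R\<rfloor>}"
proof
  fix w assume "w \<in> {w. len w \<le> R}"
  then have "\<bar>of_int (fst w)\<bar> \<le> R" "\<bar>of_int (snd w)\<bar> \<le> R"
    using abs_fst_le_len[of w] abs_snd_le_len[of w] by auto
  then have "\<bar>fst w\<bar> \<le> \<lfloor>R\<rfloor>" "\<bar>snd w\<bar> \<le> \<lfloor>R\<rfloor>" by linarith+
  then have "fst w \<in> {-\<lfloor>R\<rfloor>..\<lfloor>R\<rfloor>}" "snd w \<in> {-\<lfloor>R\<rfloor>..\<lfloor>R\<rfloor>}" by auto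
  then show "w \<in> {-\<lfloor>R\<rfloor>..\<lfloor>R\<rfloor>} \<times> {-\<lfloor>R\<rfloor>..\<lfloor>R\<rfloor>}" by (simp add: mem_Times_iff)
qed

lemma finite_short_vectors: "finite {w. len w \<le> R}"
  by (rule finite_subset[OF short_vectors_subset]) auto

lemma finite_prim_short: "0 < r \<Longrightarrow> finite {w. w \<in> prim \<and> r * len w < 1}"
  by (rule finite_subset[OF _ finite_short_vectors[of "1 / r"]]) (auto simp: field_simps)

lemma kern_nonneg: "0 \<le> kern r t w \<theta>"
  by (simp add: kern_def)

lemma kern_eq_0: "0 < r \<Longrightarrow> 0 < t \<Longrightarrow> 1 \<le> r * len w \<Longrightarrow> kern r t w \<theta> = 0"
  unfolding kern_def by (smt (verit) divide_pos_pos mult_nonneg_nonneg abs_ge_zero)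

lemma prim_eq_if_parallel:
  assumes "w \<in> prim" "w' \<in> prim" "fst w * snd w' = snd w * fst w'"
  shows "w = w'"
proof (cases "fst w = 0")
  case True
  then have "w = (0, -1)" using assms by (auto simp: prim_def)
  then have "fst w' = 0" using assms by auto
  then have "w' = (0, -1)" using assms by (auto simp: prim_def)
  with \<open>w = (0, -1)\<close> show ?thesis by simp
next
  case False
  then have pos: "0 < fst w" using assms(1) by (auto simp: prim_def)
  have "fst w' \<noteq> 0"
  proof
    assume "fst w' = 0"
    then have "w' = (0, -1)" using assms(2) by (auto simp: prim_def)
    then show False using assms(3) False by simp
  qed
  then have pos': "0 < fst w'" using assms(2) by (auto simp: prim_def)
  have c: "coprime (fst w) (snd w)" "coprime (fst w') (snd w')" using assms by (auto simp: prim_def)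
  have "fst w dvd snd w * fst w'" using assms(3) by (metis dvd_triv_left)
  then have 1: "fst w dvd fst w'" using c(1) by (simp add: coprime_dvd_mult_right_iff)
  have "fst w' dvd fst w * snd w'" using assms(3) by simp
  then have 2: "fst w' dvd fst w" using c(2) by (simp add: coprime_dvd_mult_left_iff)
  have "fst w = fst w'" using zdvd_antisym_nonneg[OF _ _ 1 2] pos pos' by simp
  then show ?thesis using assms(3) pos by (simp add: prod_eq_iff)
qed

lemma abs_par_le_len: "\<bar>par w \<theta>\<bar> \<le> len w"
proof -
  have "\<bar>par w \<theta>\<bar>\<^sup>2 \<le> (len w)\<^sup>2" using par_perp_sq[of w \<theta>] by (simp flip: par_perp_sq[of w \<theta>])
  then show ?thesis by (rule power2_le_imp_le) (rule len_nonneg)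
qed

lemma len_le_par_perp: "len w \<le> \<bar>par w \<theta>\<bar> + \<bar>perp w \<theta>\<bar>"
proof -
  have "len w = sqrt ((par w \<theta>)\<^sup>2 + (perp w \<theta>)\<^sup>2)" using len_nonneg by (simp add: par_perp_sq)
  then show ?thesis using sqrt_sum_squares_le_sum_abs by metis
qed

text \<open>With \<open>X = r |w|\<close> and \<open>Y = (t / r) |perp w|\<close>, the determinant of \<open>w\<close> and \<open>w'\<close> is at most
  \<open>(X Y' + X' Y) / t\<close> in absolute value. This is less than 1 if \<open>X + Y < 1\<close> and \<open>X' + Y' < 1\<close>; being an integer,
  the determinant vanishes.\<close>
lemma kern_pos_unique:
  assumes "0 < r" "1 \<le> t" "w \<in> prim" "w' \<in> prim" "kern r t w \<theta> > 0" "kern r t w' \<theta> > 0"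
  shows "w = w'"
proof -
  define X Y X' Y' where "X = r * len w" and "Y = t / r * \<bar>perp w \<theta>\<bar>"
    and "X' = r * len w'" and "Y' = t / r * \<bar>perp w' \<theta>\<bar>"
  have b: "X + Y < 1" "X' + Y' < 1" using assms by (auto simp: kern_def X_def Y_def X'_def Y'_def)
  have n: "0 < X" "0 < X'" "0 \<le> Y" "0 \<le> Y'"
    using assms len_ge_1[of w] len_ge_1[of w'] by (auto simp: X_def Y_def X'_def Y'_def)
  define c where "c = fst w * snd w' - snd w * fst w'"
  have "of_int c = (of_int (fst w) * of_int (snd w') - of_int (snd w) * of_int (fst w')) * ((cos \<theta>)\<^sup>2 + (sin \<theta>)\<^sup>2)"
    by (simp add: c_def)
  also have "\<dots> = perp w \<theta> * par w' \<theta> - par w \<theta> * perp w' \<theta>"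
    unfolding par_def perp_def by algebra
  finally have "\<bar>of_int c\<bar> \<le> \<bar>perp w \<theta> * par w' \<theta>\<bar> + \<bar>par w \<theta> * perp w' \<theta>\<bar>" by linarith
  also have "\<dots> \<le> \<bar>perp w \<theta>\<bar> * len w' + len w * \<bar>perp w' \<theta>\<bar>"
    unfolding abs_mult using abs_par_le_len len_nonneg by (intro add_mono mult_mono) auto
  finally have "t * \<bar>of_int c\<bar> \<le> t * (\<bar>perp w \<theta>\<bar> * len w' + len w * \<bar>perp w' \<theta>\<bar>)"
    using assms(2) by (intro mult_left_mono) auto
  also have "\<dots> = Y * X' + X * Y'"
    using assms(1) by (simp add: X_def Y_def X'_def Y'_def field_simps)
  also have "\<dots> < (1 - X) * X' + X * (1 - X')"
    using b n by (intro add_strict_mono mult_strict_right_mono mult_strict_left_mono) auto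
  also have "\<dots> = 1 - ((1 - X) * (1 - X') + X * X')" by (simp add: algebra_simps)
  also have "\<dots> \<le> 1"
    using b n by (smt (verit) mult_nonneg_nonneg)
  finally have "t * \<bar>of_int c\<bar> < 1" .
  moreover have "1 * \<bar>real_of_int c\<bar> \<le> t * \<bar>of_int c\<bar>" using assms(2) by (intro mult_right_mono) auto
  ultimately have "\<bar>real_of_int c\<bar> < 1" by linarith
  then have "c = 0" by linarith
  then show ?thesis using prim_eq_if_parallel[OF assms(3,4)] by (simp add: c_def)
qed

lemma kern_le_strip_area:
  assumes "0 < r" "0 < t" "w \<in> prim"
  shows "kern r t w \<theta> \<le> strip_area r t \<theta>"
proof (cases "r * len w < 1")
  case True
  then show ?thesis unfolding strip_area_def
    using assms finite_prim_short by (intro member_le_sum) (auto simp: kern_nonneg)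
next
  case False
  then have "kern r t w \<theta> = 0" using assms by (intro kern_eq_0) auto
  then show ?thesis unfolding strip_area_def by (simp add: sum_nonneg kern_nonneg)
qed

lemma strip_area_nonneg: "0 \<le> strip_area r t \<theta>"
  unfolding strip_area_def by (simp add: sum_nonneg kern_nonneg)

lemma strip_area_cases:
  assumes "0 < r" "1 \<le> t"
  obtains "strip_area r t \<theta> = 0" | w where "w \<in> prim" "strip_area r t \<theta> = kern r t w \<theta>"
proof (cases "\<exists>w\<in>{w. w \<in> prim \<and> r * len w < 1}. kern r t w \<theta> > 0")
  case True
  then obtain w where w: "w \<in> prim" "r * len w < 1" "kern r t w \<theta> > 0" by auto
  have "strip_area r t \<theta> = (\<Sum>w\<in>{w}. kern r t w \<theta>)"
    unfolding strip_area_def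
  proof (rule sum.mono_neutral_right)
    show "\<forall>i\<in>{w. w \<in> prim \<and> r * len w < 1} - {w}. kern r t i \<theta> = 0"
      using kern_pos_unique[OF assms _ w(1) _ w(3)] kern_nonneg[of r t _ \<theta>] by (metis (no_types, lifting) DiffE insertI1 less_eq_real_def mem_Collect_eq)
  qed (use w finite_prim_short assms in auto)
  then show ?thesis using that(2)[OF w(1)] by simp
next
  case False
  then have "strip_area r t \<theta> = 0" unfolding strip_area_def
    using kern_nonneg by (intro sum.neutral) (meson less_eq_real_def not_less)
  then show ?thesis using that(1) by blast
qed

lemma strip_area_le_1:
  assumes "0 < r" "1 \<le> t"
  shows "strip_area r t \<theta> \<le> 1"
proof (rule strip_area_cases[OF assms, of \<theta>])
  fix w assume eq: "strip_area r t \<theta> = kern r t w \<theta>"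
  have "0 \<le> r * len w" "0 \<le> t / r * \<bar>perp w \<theta>\<bar>" using assms by (auto simp: len_nonneg)
  then show ?thesis unfolding eq kern_def by linarith
qed simp

lemma strip_area_le_free_area:
  assumes "0 < r" "1 \<le> t"
  shows "strip_area r t \<theta> \<le> free_area r (t / r) \<theta>"
proof (rule strip_area_cases[OF assms, of \<theta>])
  fix w assume "w \<in> prim" and eq: "strip_area r t \<theta> = kern r t w \<theta>"
  then show ?thesis using free_area_ge[of r "t / r" w \<theta>] assms by (simp add: kern_def add.commute)
qed (simp add: free_area_nonneg)

lemma prim_representative:
  assumes "coprime (fst w) (snd w :: int)"
  obtains w' where "w' \<in> prim" "\<And>\<theta>. \<bar>perp w' \<theta>\<bar> = \<bar>perp w \<theta>\<bar>" "\<And>\<theta>. \<bar>par w' \<theta>\<bar> = \<bar>par w \<theta>\<bar>"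
proof (cases "w \<in> prim")
  case True
  then show ?thesis using that[of w] by simp
next
  case False
  have "(- fst w, - snd w) \<in> prim"
    using assms False by (cases w) (auto simp: prim_def)
  moreover have "perp (- fst w, - snd w) \<theta> = - perp w \<theta>" "par (- fst w, - snd w) \<theta> = - par w \<theta>" for \<theta>
    by (simp_all add: perp_def par_def)
  ultimately show ?thesis using that[of "(- fst w, - snd w)"] by simp
qed

text \<open>Dirichlet's theorem for the slope \<open>s / c\<close> with denominators up to \<open>|c| / r\<close>. Rounding this bound up to an integer
  is what costs the additive constant.\<close>
lemma dirichlet_direction_aux:
  fixes c s r :: real
  assumes "0 < r" "r < 1/2" "c\<^sup>2 + s\<^sup>2 = 1" "\<bar>s\<bar> \<le> \<bar>c\<bar>"
  obtains q p :: int where "coprime q p" "\<bar>q * s - p * c\<bar> \<le> r" "\<bar>q * c + p * s\<bar> \<le> 1 / r + 3"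
proof -
  have "1 \<le> 2 * c\<^sup>2" using assms(3,4) abs_le_square_iff[of s c] by linarith
  then have "1 \<le> 4 * c\<^sup>2" "c \<noteq> 0" by auto
  have "(1/2)\<^sup>2 \<le> \<bar>c\<bar>\<^sup>2" using \<open>1 \<le> 4 * c\<^sup>2\<close> by (simp add: power_divide)
  then have c: "1/2 \<le> \<bar>c\<bar>" by (rule power2_le_imp_le) simp
  have "c\<^sup>2 \<le> 1" "s\<^sup>2 \<le> 1" using assms(3) zero_le_power2[of c] zero_le_power2[of s] by linarith+
  then have c1: "\<bar>c\<bar> \<le> 1" "\<bar>s\<bar> \<le> 1" using abs_le_square_iff[of _ 1] by fastforce+
  define N where "N = nat \<lceil>\<bar>c\<bar> / r\<rceil>"
  have "0 < \<bar>c\<bar> / r" using c assms(1) by simp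
  then have N: "0 < N" "\<bar>c\<bar> / r \<le> N" "N < \<bar>c\<bar> / r + 1" unfolding N_def by linarith+
  obtain h k where hk: "coprime h k" "0 < k" "k \<le> int N" "\<bar>of_int k * (s / c) - of_int h\<bar> < 1 / N"
    using Dirichlet_approx_coprime[OF N(1), of "s / c"] by blast
  define e where "e = of_int k * (s / c) - of_int h"
  have e: "\<bar>e\<bar> \<le> 1 / N" using hk by (simp add: e_def)
  have h: "of_int h = k * (s / c) - e" by (simp add: e_def)
  have "k * s - h * c = c * e" using \<open>c \<noteq> 0\<close> by (simp add: e_def field_simps)
  then have "\<bar>k * s - h * c\<bar> = \<bar>c\<bar> * \<bar>e\<bar>" by (simp only: abs_mult)
  also have "\<dots> \<le> \<bar>c\<bar> * (1 / N)" using e by (intro mult_left_mono) auto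
  also have "\<dots> \<le> r" using N assms(1) by (simp add: field_simps)
  finally have 1: "\<bar>k * s - h * c\<bar> \<le> r" .
  have "k * c + h * s = k * ((c\<^sup>2 + s\<^sup>2) / c) - e * s"
    using \<open>c \<noteq> 0\<close> unfolding h by (simp add: field_simps power2_eq_square)
  then have "\<bar>k * c + h * s\<bar> \<le> \<bar>k / c\<bar> + \<bar>e * s\<bar>"
    unfolding assms(3) using abs_triangle_ineq4[of "k / c" "e * s"] by simp
  also have "\<bar>k / c\<bar> \<le> (\<bar>c\<bar> / r + 1) / \<bar>c\<bar>"
    unfolding abs_divide using hk N by (intro divide_right_mono) auto
  also have "\<dots> = 1 / r + 1 / \<bar>c\<bar>" using \<open>c \<noteq> 0\<close> by (simp add: add_divide_distrib)
  also have "1 / \<bar>c\<bar> \<le> 2" using c by (simp add: field_simps)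
  also have "\<bar>e * s\<bar> \<le> 1 * 1" unfolding abs_mult
    using e c1 N(1) by (intro mult_mono) (auto intro: order_trans)
  finally have 2: "\<bar>k * c + h * s\<bar> \<le> 1 / r + 3" by simp
  show ?thesis using that[of k h] 1 2 hk(1) by (simp add: coprime_commute)
qed

text \<open>For steep directions the two coordinates are exchanged.\<close>
lemma dirichlet_direction:
  fixes \<theta> r :: real
  assumes "0 < r" "r < 1/2"
  obtains w where "w \<in> prim" "\<bar>perp w \<theta>\<bar> \<le> r" "\<bar>par w \<theta>\<bar> \<le> 1 / r + 3"
proof -
  obtain q p :: int where "coprime q p" "\<bar>q * sin \<theta> - p * cos \<theta>\<bar> \<le> r" "\<bar>q * cos \<theta> + p * sin \<theta>\<bar> \<le> 1 / r + 3"
  proof (cases "\<bar>sin \<theta>\<bar> \<le> \<bar>cos \<theta>\<bar>")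
    case True
    obtain q p :: int where "coprime q p" "\<bar>q * sin \<theta> - p * cos \<theta>\<bar> \<le> r" "\<bar>q * cos \<theta> + p * sin \<theta>\<bar> \<le> 1 / r + 3"
      by (rule dirichlet_direction_aux[OF assms, of "cos \<theta>" "sin \<theta>"]) (use True in auto)
    then show ?thesis by (rule that)
  next
    case False
    obtain q p :: int where "coprime q p" "\<bar>q * cos \<theta> - p * sin \<theta>\<bar> \<le> r" "\<bar>q * sin \<theta> + p * cos \<theta>\<bar> \<le> 1 / r + 3"
      by (rule dirichlet_direction_aux[OF assms, of "sin \<theta>" "cos \<theta>"]) (use False in auto)
    then show ?thesis by (intro that[of p q]) (auto simp: coprime_commute abs_minus_commute add.commute)
  qed
  then show ?thesis
    using prim_representative[of "(q, p)"] that by (metis fst_conv snd_conv par_def perp_def)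
qed

text \<open>A majorant of the corner term \<open>2 |par w| |perp w|\<close> of the upper bound: it is only needed for vectors \<open>w\<close> that are
  nearly parallel to the direction, and the sum over all of them dominates the one that occurs.\<close>
definition corner_bound :: "real \<Rightarrow> real \<Rightarrow> real \<Rightarrow> real" where
  "corner_bound r \<beta> \<theta> = (\<Sum>w | w \<in> prim \<and> len w \<le> 1 / r + 4.
     2 * len w * \<beta> * indicator {\<theta>. \<bar>perp w \<theta>\<bar> \<le> \<beta>} \<theta>)"

text \<open>The upper bound is applied to the vector \<open>w\<close> of Dirichlet's theorem. Since \<open>2 |par w| \<le> 3 / r\<close> for
  \<open>r < 1/6\<close>, it can only be positive if \<open>|perp w| \<le> r / (t - 3)\<close>. The strip of \<open>w\<close> is contained in \<open>strip_area\<close>, and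
  replacing \<open>|par w|\<close> by \<open>|w|\<close> costs at most \<open>r |perp w| \<le> r\<^sup>2\<close>.\<close>
lemma free_area_le_strip_area:
  assumes "3 < t" "0 < r" "r < 1/6"
  shows "free_area r (t / r) \<theta> \<le> strip_area r t \<theta> + r\<^sup>2 + corner_bound r (r / (t - 3)) \<theta>"
proof -
  obtain w where w: "w \<in> prim" "\<bar>perp w \<theta>\<bar> \<le> r" "\<bar>par w \<theta>\<bar> \<le> 1 / r + 3"
    using dirichlet_direction[of r \<theta>] assms by auto
  define A B where "A = \<bar>par w \<theta>\<bar>" and "B = \<bar>perp w \<theta>\<bar>"
  have AB: "0 \<le> A" "0 \<le> B" "B \<le> r" "A \<le> 1 / r + 3" using w by (auto simp: A_def B_def)
  have "r * A \<le> r * (1 / r + 3)" using AB assms by (intro mult_left_mono) auto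
  then have rA: "2 * (r * A) \<le> 3" using assms by (simp add: distrib_left)
  then have "2 * A \<le> 3 / r" using assms by (simp add: field_simps)
  also have "\<dots> \<le> t / r" using assms by (intro divide_right_mono) auto
  finally have TA: "2 * A \<le> t / r" .
  define y where "y = 1 - (r * A + t / r * B - 2 * A * B)"
  have le: "free_area r (t / r) \<theta> \<le> max 0 y"
    using free_area_le[of r w \<theta> "t / r"] w assms TA by (simp add: y_def A_def B_def)
  have nn: "0 \<le> strip_area r t \<theta> + r\<^sup>2 + corner_bound r (r / (t - 3)) \<theta>"
    using assms by (auto simp: corner_bound_def len_nonneg strip_area_nonneg intro!: add_nonneg_nonneg sum_nonneg mult_nonneg_nonneg)
  show ?thesis
  proof (cases "y \<le> 0")
    case True
    then show ?thesis using le nn by linarith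
  next
    case False
    have "2 * (r * A) * B \<le> 3 * B" using rA AB by (intro mult_right_mono) auto
    moreover have "0 \<le> r * A" using AB assms by simp
    moreover have "r * y = r - (r * (r * A) + t * B - 2 * (r * A) * B)"
      using assms by (simp add: y_def field_simps)
    moreover have "0 < r * y" using False assms by simp
    moreover have "0 \<le> r * (r * A)" using AB assms by simp
    ultimately have "(t - 3) * B \<le> r" by (simp add: algebra_simps)
    then have B: "B \<le> r / (t - 3)" using assms by (simp add: field_simps)
    have lenw: "len w \<le> A + B" using len_le_par_perp[of w \<theta>] by (simp add: A_def B_def)
    have "2 * A * B \<le> 2 * len w * (r / (t - 3)) * indicator {\<theta>. \<bar>perp w \<theta>\<bar> \<le> r / (t - 3)} \<theta>"
    proof -
      have "2 * A * B \<le> 2 * len w * (r / (t - 3))"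
        using B AB abs_par_le_len[of w \<theta>] len_nonneg[of w] by (intro mult_mono) (auto simp: A_def)
      then show ?thesis using B by (simp add: B_def)
    qed
    also have "\<dots> \<le> corner_bound r (r / (t - 3)) \<theta>"
      unfolding corner_bound_def
    proof (rule member_le_sum)
      show "w \<in> {w. w \<in> prim \<and> len w \<le> 1 / r + 4}" using lenw AB w assms by auto
      show "finite {w. w \<in> prim \<and> len w \<le> 1 / r + 4}"
        by (rule finite_subset[OF _ finite_short_vectors]) auto
    qed (use assms in \<open>auto simp: len_nonneg\<close>)
    finally have 1: "2 * A * B \<le> corner_bound r (r / (t - 3)) \<theta>" .
    have "1 - (r * len w + t / r * B) \<le> kern r t w \<theta>" by (simp add: kern_def B_def)
    also have "\<dots> \<le> strip_area r t \<theta>" using assms w by (intro kern_le_strip_area) auto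
    finally have 2: "1 - (r * len w + t / r * B) \<le> strip_area r t \<theta>" .
    have "r * len w \<le> r * (A + B)" using lenw assms by (intro mult_left_mono) auto
    moreover have "r * B \<le> r * r" using AB assms by (intro mult_left_mono) auto
    ultimately have 3: "r * len w \<le> r * A + r\<^sup>2" by (simp add: distrib_left power2_eq_square)
    have "y \<le> strip_area r t \<theta> + r\<^sup>2 + corner_bound r (r / (t - 3)) \<theta>"
      unfolding y_def using 1 2 3 by linarith
    then show ?thesis using le nn by linarith
  qed
qed

section \<open>The corner term on average over directions\<close>

lemma sin_ge_chord:
  fixes u :: real
  assumes "0 \<le> u" "u \<le> pi / 2"
  shows "2 / pi * u \<le> sin u"
proof -
  have "convex_on {0..pi/2} (\<lambda>x. - sin x :: real)"
  proof (rule f''_ge0_imp_convex[where f' = "\<lambda>x. - cos x" and f'' = sin])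
    show "convex {0..pi/2}" by simp
    fix x :: real
    show "((\<lambda>x. - sin x) has_real_derivative - cos x) (at x)" by (auto intro!: derivative_eq_intros)
    show "((\<lambda>x. - cos x) has_real_derivative sin x) (at x)" by (auto intro!: derivative_eq_intros)
    show "x \<in> {0..pi/2} \<Longrightarrow> 0 \<le> sin x" by (auto intro!: sin_ge_zero)
  qed
  then have "- sin ((1 - 2 / pi * u) *\<^sub>R 0 + (2 / pi * u) *\<^sub>R (pi / 2)) \<le> (1 - 2 / pi * u) * (- sin 0) + (2 / pi * u) * (- sin (pi / 2))"
    using assms by (intro convex_onD) (auto simp: field_simps)
  then show ?thesis by simp
qed

text \<open>The nearest multiple of \<open>\<pi>\<close> is at distance at most \<open>\<pi>/2\<close>, where the sine lies above its chord.\<close>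
lemma near_multiple_of_pi:
  fixes \<phi> :: real
  assumes "\<bar>sin \<phi>\<bar> \<le> x" "-pi \<le> \<phi>" "\<phi> < 2 * pi"
  obtains k :: int where "k \<in> {-1..2}" "\<bar>\<phi> - k * pi\<bar> \<le> pi / 2 * x"
proof -
  define k where "k = round (\<phi> / pi)"
  have "\<bar>\<phi> / pi - k\<bar> \<le> 1/2" unfolding k_def using of_int_round_abs_le[of "\<phi> / pi"] by (simp add: abs_minus_commute)
  then have "pi * \<bar>\<phi> / pi - k\<bar> \<le> pi * (1/2)" by (intro mult_left_mono) auto
  moreover have "pi * \<bar>\<phi> / pi - k\<bar> = \<bar>\<phi> - k * pi\<bar>"
  proof -
    have "\<phi> - k * pi = pi * (\<phi> / pi - k)" by (simp add: field_simps)
    then show ?thesis by (simp only: abs_mult) simp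
  qed
  ultimately have k: "\<bar>\<phi> - k * pi\<bar> \<le> pi / 2" by simp
  have "\<bar>sin (\<phi> - k * pi)\<bar> = \<bar>sin \<phi>\<bar>"
    by (simp add: sin_diff abs_mult sin_npi_int[of k, unfolded mult.commute[of pi]] cos_npi_int[of k, unfolded mult.commute[of pi]])
  moreover have "\<bar>sin (\<phi> - k * pi)\<bar> = sin \<bar>\<phi> - k * pi\<bar>"
  proof -
    have "\<bar>sin d\<bar> = sin \<bar>d\<bar>" if "\<bar>d\<bar> \<le> pi / 2" for d :: real
      using sin_ge_zero[of "\<bar>d\<bar>"] that by (cases "d \<ge> 0") auto
    then show ?thesis using k by blast
  qed
  ultimately have "2 / pi * \<bar>\<phi> - k * pi\<bar> \<le> x"
    using sin_ge_chord[of "\<bar>\<phi> - k * pi\<bar>"] k assms(1) by simp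
  then have "\<bar>\<phi> - k * pi\<bar> \<le> pi / 2 * x" by (simp add: field_simps)
  moreover have "k \<in> {-1..2}"
  proof -
    have "-1 \<le> \<phi> / pi" "\<phi> / pi \<le> 2" using assms by (auto simp: field_simps)
    then have "real_of_int (-1) \<le> \<phi> / pi" "\<phi> / pi \<le> real_of_int 2" by simp_all
    then have "round (real_of_int (-1)) \<le> k" "k \<le> round (real_of_int 2)"
      unfolding k_def by (blast intro: round_mono)+
    then show ?thesis unfolding round_of_int by simp
  qed
  ultimately show ?thesis using that by blast
qed

lemma perp_polar:
  assumes "len w > 0"
  obtains \<psi> where "0 \<le> \<psi>" "\<psi> \<le> pi" "\<And>\<theta>. \<bar>perp w \<theta>\<bar> = len w * \<bar>sin (\<theta> - \<psi>)\<bar>"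
proof -
  \<comment> \<open>Passing to \<open>-w\<close> if necessary keeps the angle in \<open>[0, \<pi>]\<close>.\<close>
  define e :: real where "e = (if snd w \<ge> 0 then 1 else -1)"
  have e: "e * e = 1" "\<bar>e\<bar> = 1" by (auto simp: e_def)
  have "(e * of_int (fst w) / len w)\<^sup>2 + (e * of_int (snd w) / len w)\<^sup>2 = (e * e) * ((of_int (fst w))\<^sup>2 + (of_int (snd w))\<^sup>2) / (len w)\<^sup>2"
    by (simp add: power2_eq_square add_divide_distrib algebra_simps)
  also have "\<dots> = 1" using assms by (simp add: e len_sq[symmetric])
  finally obtain \<psi> where \<psi>: "0 \<le> \<psi>" "\<psi> \<le> pi" "e * of_int (fst w) / len w = cos \<psi>" "e * of_int (snd w) / len w = sin \<psi>"
    using sincos_total_pi[of "e * of_int (snd w) / len w" "e * of_int (fst w) / len w"] assms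
    by (auto simp: e_def)
  have "perp w \<theta> = e * (len w * sin (\<theta> - \<psi>))" for \<theta>
  proof -
    have "of_int (fst w) = e * len w * cos \<psi>" "of_int (snd w) = e * len w * sin \<psi>"
      unfolding \<psi>(3)[symmetric] \<psi>(4)[symmetric] using assms e by simp_all
    then show ?thesis unfolding perp_def sin_diff by (simp add: algebra_simps)
  qed
  then have "\<bar>perp w \<theta>\<bar> = len w * \<bar>sin (\<theta> - \<psi>)\<bar>" for \<theta>
    using assms by (simp add: abs_mult e)
  then show ?thesis using that \<psi> by blast
qed

lemma perp_measurable [measurable]: "perp w \<in> borel_measurable borel"
  unfolding perp_def by (intro borel_measurable_continuous_onI continuous_intros)

text \<open>Such directions lie within \<open>\<pi> \<beta> / (2 |w|)\<close> of the line spanned by \<open>w\<close>, whose angles meet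
  \<open>[0, 2\<pi>)\<close> and its neighbourhood in at most four points.\<close>
lemma emeasure_near_direction:
  assumes "len w > 0" "0 \<le> \<beta>"
  shows "emeasure lborel {\<theta>\<in>{0..<2*pi}. \<bar>perp w \<theta>\<bar> \<le> \<beta>} \<le> ennreal (4 * pi * \<beta> / len w)"
proof -
  obtain \<psi> where \<psi>: "0 \<le> \<psi>" "\<psi> \<le> pi" "\<And>\<theta>. \<bar>perp w \<theta>\<bar> = len w * \<bar>sin (\<theta> - \<psi>)\<bar>"
    using perp_polar[OF assms(1)] by blast
  define h where "h = pi / 2 * (\<beta> / len w)"
  have h: "0 \<le> h" using assms by (simp add: h_def)
  let ?I = "\<lambda>k::int. {\<psi> + k * pi - h .. \<psi> + k * pi + h}"
  have "{\<theta>\<in>{0..<2*pi}. \<bar>perp w \<theta>\<bar> \<le> \<beta>} \<subseteq> (\<Union>k\<in>{-1..2}. ?I k)"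
  proof
    fix \<theta> assume \<theta>: "\<theta> \<in> {\<theta>\<in>{0..<2*pi}. \<bar>perp w \<theta>\<bar> \<le> \<beta>}"
    then have "\<bar>sin (\<theta> - \<psi>)\<bar> \<le> \<beta> / len w" using assms(1) by (simp add: \<psi>(3) field_simps)
    then obtain k :: int where "k \<in> {-1..2}" "\<bar>\<theta> - \<psi> - k * pi\<bar> \<le> h"
      unfolding h_def using near_multiple_of_pi[of "\<theta> - \<psi>" "\<beta> / len w"] \<theta> \<psi> by auto
    then show "\<theta> \<in> (\<Union>k\<in>{-1..2}. ?I k)" by (intro UN_I[of k]) (auto simp: abs_le_iff)
  qed
  then have "emeasure lborel {\<theta>\<in>{0..<2*pi}. \<bar>perp w \<theta>\<bar> \<le> \<beta>} \<le> emeasure lborel (\<Union>k\<in>{-1..2}. ?I k)"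
    by (intro emeasure_mono) auto
  also have "\<dots> \<le> (\<Sum>k\<in>{-1..2}. emeasure lborel (?I k))"
    by (intro emeasure_subadditive_finite) auto
  also have "\<dots> = (\<Sum>k::int\<in>{-1..2}. ennreal (2 * h))"
    by (intro sum.cong refl) (simp add: h)
  also have "\<dots> = ennreal (4 * pi * \<beta> / len w)"
    using h by (subst sum_ennreal) (simp_all add: h_def)
  finally show ?thesis .
qed

lemma card_prim_short:
  assumes "0 \<le> R"
  shows "real (card {w. w \<in> prim \<and> len w \<le> R}) \<le> (R + 1) * (2 * R + 1)"
proof -
  have "{w. w \<in> prim \<and> len w \<le> R} \<subseteq> {0..\<lfloor>R\<rfloor>} \<times> {-\<lfloor>R\<rfloor>..\<lfloor>R\<rfloor>}"
    using short_vectors_subset[of R] by (auto simp: prim_def)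
  then have "card {w. w \<in> prim \<and> len w \<le> R} \<le> card ({0..\<lfloor>R\<rfloor>} \<times> {-\<lfloor>R\<rfloor>..\<lfloor>R\<rfloor>})"
    by (intro card_mono) auto
  also have "\<dots> = nat (\<lfloor>R\<rfloor> + 1) * nat (2 * \<lfloor>R\<rfloor> + 1)" by (simp add: card_cartesian_product)
  finally have "real (card {w. w \<in> prim \<and> len w \<le> R}) \<le> real (nat (\<lfloor>R\<rfloor> + 1)) * real (nat (2 * \<lfloor>R\<rfloor> + 1))"
    by (metis of_nat_le_iff of_nat_mult)
  also have "\<dots> \<le> (R + 1) * (2 * R + 1)"
    using assms by (intro mult_mono) linarith+
  finally show ?thesis .
qed

text \<open>The summand of \<open>w\<close> is \<open>2 |w| r b\<close> on a set of measure at most \<open>4 \<pi> r b / |w|\<close>, so that the length of \<open>w\<close>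
  cancels; the number of summands is about \<open>2 / r\<^sup>2\<close>.\<close>
lemma integral_corner_bound:
  assumes "0 < r" "0 \<le> b"
  shows "set_integrable lborel {0..<2*pi} (corner_bound r (r * b))"
    and "(LINT \<theta>:{0..<2*pi}|lborel. corner_bound r (r * b) \<theta>)
      \<le> 2 * pi * (4 * b\<^sup>2 * (1 + 5 * r) * (2 + 9 * r))"
proof -
  let ?W = "{w. w \<in> prim \<and> len w \<le> 1 / r + 4}"
  define S where "S w = {\<theta>\<in>{0..<2*pi}. \<bar>perp w \<theta>\<bar> \<le> r * b}" for w
  have fin: "finite ?W" by (rule finite_subset[OF _ finite_short_vectors]) auto
  have S[measurable]: "S w \<in> sets borel" for w unfolding S_def by measurable
  have em: "emeasure lborel (S w) \<le> ennreal (4 * pi * (r * b) / len w)" if "w \<in> prim" for w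
    unfolding S_def using len_ge_1[OF that] assms by (intro emeasure_near_direction) auto
  have fm: "emeasure lborel (S w) < \<infinity>" if "w \<in> prim" for w
    using em[OF that] by (auto simp: order.strict_trans1)
  have eq: "indicator {0..<2*pi} \<theta> *\<^sub>R corner_bound r (r * b) \<theta>
      = (\<Sum>w\<in>?W. 2 * len w * (r * b) * indicator (S w) \<theta>)" for \<theta>
    unfolding corner_bound_def by (auto simp: S_def sum_distrib_left indicator_def intro!: sum.cong)
  have int: "integrable lborel (\<lambda>\<theta>. 2 * len w * (r * b) * indicator (S w) \<theta> :: real)" if "w \<in> prim" for w
    using fm[OF that] by (intro integrable_mult_right integrable_real_indicator) auto
  show "set_integrable lborel {0..<2*pi} (corner_bound r (r * b))"
    unfolding set_integrable_def eq by (intro Bochner_Integration.integrable_sum int) auto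
  have "(LINT \<theta>:{0..<2*pi}|lborel. corner_bound r (r * b) \<theta>)
      = (\<Sum>w\<in>?W. (LINT \<theta>|lborel. 2 * len w * (r * b) * indicator (S w) \<theta>))"
    unfolding set_lebesgue_integral_def eq by (intro Bochner_Integration.integral_sum int) auto
  also have "\<dots> \<le> (\<Sum>w\<in>?W. 8 * pi * (r * b)\<^sup>2)"
  proof (rule sum_mono)
    fix w assume w: "w \<in> ?W"
    then have lw: "1 \<le> len w" using len_ge_1 by auto
    have "(LINT \<theta>|lborel. 2 * len w * (r * b) * indicator (S w) \<theta>) = 2 * len w * (r * b) * measure lborel (S w)"
      by simp
    also have "\<dots> \<le> 2 * len w * (r * b) * (4 * pi * (r * b) / len w)"
    proof (rule mult_left_mono)
      have "ennreal (measure lborel (S w)) \<le> ennreal (4 * pi * (r * b) / len w)"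
        using em[of w] fm[of w] w by (auto simp: emeasure_eq_ennreal_measure)
      then show "measure lborel (S w) \<le> 4 * pi * (r * b) / len w"
        using assms lw by (subst (asm) ennreal_le_iff) auto
    qed (use assms lw in auto)
    also have "\<dots> = 8 * pi * (r * b)\<^sup>2" using lw by (simp add: power2_eq_square)
    finally show "(LINT \<theta>|lborel. 2 * len w * (r * b) * indicator (S w) \<theta>) \<le> 8 * pi * (r * b)\<^sup>2" .
  qed
  also have "\<dots> = real (card ?W) * (8 * pi * (r * b)\<^sup>2)" by simp
  also have "\<dots> \<le> ((1 / r + 4) + 1) * (2 * (1 / r + 4) + 1) * (8 * pi * (r * b)\<^sup>2)"
    using assms by (intro mult_right_mono card_prim_short) auto
  also have "\<dots> = 2 * pi * (4 * b\<^sup>2 * (1 + 5 * r) * (2 + 9 * r))"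
    using assms by (simp add: field_simps power2_eq_square)
  finally show "(LINT \<theta>:{0..<2*pi}|lborel. corner_bound r (r * b) \<theta>)
      \<le> 2 * pi * (4 * b\<^sup>2 * (1 + 5 * r) * (2 + 9 * r))" .
qed

section \<open>Lattice points in a cone\<close>

lemma integral_floor_step:
  fixes h :: "int \<Rightarrow> real"
  assumes "0 < \<delta>" "finite A" "\<And>j. j \<notin> A \<Longrightarrow> h j = 0"
  shows "integrable lborel (\<lambda>s. h \<lfloor>s / \<delta>\<rfloor>)" and "(LINT s|lborel. h \<lfloor>s / \<delta>\<rfloor>) = \<delta> * sum h A"
proof -
  let ?I = "\<lambda>j::int. {\<delta> * j..<\<delta> * (j + 1)}"
  have eq: "h \<lfloor>s / \<delta>\<rfloor> = (\<Sum>j\<in>A. h j * indicator (?I j) s)" for s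
  proof -
    have ind: "indicator (?I j) s = (if \<lfloor>s / \<delta>\<rfloor> = j then 1 else 0 :: real)" for j
      using assms(1) by (auto simp: indicator_def floor_eq_iff field_simps)
    show ?thesis unfolding ind using assms(2,3) by (simp add: if_distrib[of "\<lambda>x. _ * x"] sum.delta cong: if_cong)
  qed
  have int: "integrable lborel (\<lambda>s. h j * indicator (?I j) s)" for j
    using assms(1) by (intro integrable_mult_right integrable_real_indicator) (auto simp: algebra_simps)
  show "integrable lborel (\<lambda>s. h \<lfloor>s / \<delta>\<rfloor>)"
    unfolding eq by (intro Bochner_Integration.integrable_sum int)
  have "(LINT s|lborel. h \<lfloor>s / \<delta>\<rfloor>) = (\<Sum>j\<in>A. LINT s|lborel. h j * indicator (?I j) s)"
    unfolding eq by (intro Bochner_Integration.integral_sum int)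
  also have "\<dots> = (\<Sum>j\<in>A. \<delta> * h j)"
    using assms(1) by (intro sum.cong refl) (simp add: algebra_simps)
  finally show "(LINT s|lborel. h \<lfloor>s / \<delta>\<rfloor>) = \<delta> * sum h A" by (simp add: sum_distrib_left)
qed

text \<open>For a vector of length \<open>l\<close> this is \<open>t\<close> times the integral of its strip over all directions, if \<open>r = \<epsilon>\<close> and the
  sine of the angle between the vector and the direction is replaced by the angle itself.\<close>
definition weight :: "real \<Rightarrow> real \<Rightarrow> real" where
  "weight \<epsilon> l = (max 0 (1 - \<epsilon> * l))\<^sup>2 * \<epsilon> / l"

text \<open>The lattice points to the right of the origin with slope between \<open>a\<close> and \<open>b\<close>.\<close>
definition cone :: "real \<Rightarrow> real \<Rightarrow> (int \<times> int) set" where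
  "cone a b = {w. 0 < fst w \<and> a * of_int (fst w) \<le> of_int (snd w) \<and> of_int (snd w) \<le> b * of_int (fst w)}"

definition cone_sum :: "real \<Rightarrow> real \<Rightarrow> real \<Rightarrow> real" where
  "cone_sum a b \<epsilon> = (\<Sum>w | w \<in> cone a b \<and> \<epsilon> * len w < 1. weight \<epsilon> (len w))"

text \<open>For \<open>w = (q, p)\<close>, \<open>x = \<epsilon> q\<close> and \<open>s = p / q\<close> the weight of \<open>w\<close> is \<open>\<epsilon> / q\<close> times this density, because
  \<open>|w| = q sqrt (1 + s\<^sup>2)\<close>. As \<open>\<epsilon> / q\<close> is the area of a cell of the grid of the points \<open>(x, s)\<close>, the sum over a
  cone is a Riemann sum.\<close>
definition sector_density :: "real \<Rightarrow> real \<Rightarrow> real \<Rightarrow> real \<Rightarrow> real" where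
  "sector_density a b x s = indicator {a..b} s * ((max 0 (1 - x * sqrt (1 + s\<^sup>2)))\<^sup>2 / sqrt (1 + s\<^sup>2))"

lemma sqrt_ge_1: "1 \<le> sqrt (1 + s\<^sup>2)" by simp

lemma sector_density_bounds:
  assumes "0 \<le> x"
  shows "0 \<le> sector_density a b x s" "sector_density a b x s \<le> indicator {a..b} s"
proof -
  let ?c = "sqrt (1 + s\<^sup>2)"
  have "0 \<le> x * ?c" using assms sqrt_ge_1[of s] by (intro mult_nonneg_nonneg) auto
  then have "(max 0 (1 - x * ?c))\<^sup>2 \<le> 1" by (intro power_le_one) auto
  then have "(max 0 (1 - x * ?c))\<^sup>2 / ?c \<le> 1 / 1" using sqrt_ge_1[of s] by (intro frac_le) auto
  then show "0 \<le> sector_density a b x s" "sector_density a b x s \<le> indicator {a..b} s"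
    using sqrt_ge_1[of s] unfolding sector_density_def
    by (auto simp: indicator_def)
qed

lemma sector_density_eq_0: "1 \<le> x \<Longrightarrow> sector_density a b x s = 0"
proof -
  assume "1 \<le> x"
  then have "1 * 1 \<le> x * sqrt (1 + s\<^sup>2)" using sqrt_ge_1[of s] by (intro mult_mono) auto
  then show ?thesis by (simp add: sector_density_def max_def)
qed

lemma len_slope:
  assumes "0 < fst w"
  shows "len w = of_int (fst w) * sqrt (1 + (of_int (snd w) / of_int (fst w))\<^sup>2)"
proof -
  have "(len w)\<^sup>2 = (of_int (fst w) * sqrt (1 + (of_int (snd w) / of_int (fst w))\<^sup>2))\<^sup>2"
    unfolding len_sq power_mult_distrib using assms by (simp add: field_simps)
  then show ?thesis using len_nonneg[of w] assms by (auto simp: power2_eq_iff_nonneg)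
qed

lemma weight_eq_density:
  assumes "w \<in> cone a b"
  shows "weight \<epsilon> (len w) = \<epsilon> / of_int (fst w) * sector_density a b (\<epsilon> * of_int (fst w)) (of_int (snd w) / of_int (fst w))"
proof -
  have q: "0 < fst w" and "of_int (snd w) / of_int (fst w) \<in> {a..b}"
    using assms by (auto simp: cone_def field_simps)
  then show ?thesis
    by (simp add: sector_density_def weight_def len_slope[OF q] mult.assoc)
qed

text \<open>The sum over the points of a cone with first coordinate \<open>q\<close>, written as the integral of a step function in
  the slope.\<close>
definition column :: "real \<Rightarrow> real \<Rightarrow> real \<Rightarrow> real \<Rightarrow> real" where
  "column a b x q = (LINT s|lborel. sector_density a b x (\<lfloor>s / (1 / q)\<rfloor> / q))"

lemma column_eq_sum:
  fixes a b :: real and q :: int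
  assumes "0 < q"
  shows "column a b x q = 1 / q * (\<Sum>p\<in>{\<lceil>a * q\<rceil>..\<lfloor>b * q\<rfloor>}. sector_density a b x (p / q))"
  unfolding column_def
proof (rule integral_floor_step(2)[where h = "\<lambda>j. sector_density a b x (j / q)"])
  fix j assume j: "j \<notin> {\<lceil>a * q\<rceil>..\<lfloor>b * q\<rfloor>}"
  have "real_of_int j / q \<notin> {a..b}"
  proof
    assume "real_of_int j / q \<in> {a..b}"
    then have "a * q \<le> j" "j \<le> b * q" using assms by (auto simp: field_simps)
    then show False using j by (auto simp: ceiling_le_iff le_floor_iff)
  qed
  then show "sector_density a b x (real_of_int j / q) = 0" by (simp add: sector_density_def)
qed (use assms in auto)

lemma column_eq_0: "1 \<le> x \<Longrightarrow> column a b x q = 0"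
  by (simp add: column_def sector_density_eq_0)

lemma column_bounds:
  fixes a b :: real and q :: int
  assumes "0 < q" "0 \<le> x" "a \<le> b"
  shows "0 \<le> column a b x q" "column a b x q \<le> b - a + 1"
proof -
  show "0 \<le> column a b x q" unfolding column_def
    by (intro Bochner_Integration.integral_nonneg sector_density_bounds assms)
  let ?A = "{\<lceil>a * q\<rceil>..\<lfloor>b * q\<rfloor>}"
  have "(\<Sum>p\<in>?A. sector_density a b x (p / q)) \<le> (\<Sum>p\<in>?A. 1)"
    using sector_density_bounds(2)[OF assms(2)] by (intro sum_mono) (meson indicator_le_1 order_trans)
  also have "\<dots> \<le> (b - a) * q + 1"
  proof -
    have "real (nat (\<lfloor>b * q\<rfloor> + 1 - \<lceil>a * q\<rceil>)) \<le> (b - a) * q + 1"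
    proof (cases "\<lfloor>b * q\<rfloor> + 1 - \<lceil>a * q\<rceil> \<ge> 0")
      case True
      then have "real (nat (\<lfloor>b * q\<rfloor> + 1 - \<lceil>a * q\<rceil>)) = of_int \<lfloor>b * q\<rfloor> + 1 - of_int \<lceil>a * q\<rceil>" by simp
      also have "\<dots> \<le> b * q + 1 - a * q" by linarith
      finally show ?thesis by (simp add: algebra_simps)
    next
      case False
      then show ?thesis using assms by simp
    qed
    then show ?thesis by simp
  qed
  finally have "column a b x q \<le> 1 / q * ((b - a) * q + 1)"
    unfolding column_eq_sum[OF assms(1)] using assms by (intro mult_left_mono) auto
  also have "\<dots> = (b - a) + 1 / q" using assms(1) by (simp add: field_simps)
  also have "\<dots> \<le> b - a + 1" using assms(1) by simp
  finally show "column a b x q \<le> b - a + 1" .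
qed

text \<open>Likewise, the sum over the columns \<open>q = 1, 2, \<dots>\<close> becomes the integral of this step function, which on the interval
  from \<open>\<epsilon> (q - 1)\<close> to \<open>\<epsilon> q\<close> has the value of the column \<open>q\<close>.\<close>
definition cone_density :: "real \<Rightarrow> real \<Rightarrow> real \<Rightarrow> real \<Rightarrow> real" where
  "cone_density a b \<epsilon> x = (if 0 \<le> \<lfloor>x / \<epsilon>\<rfloor> then column a b (\<epsilon> * (\<lfloor>x / \<epsilon>\<rfloor> + 1)) (\<lfloor>x / \<epsilon>\<rfloor> + 1) else 0)"

lemma cone_sum_eq_integral:
  assumes "0 < \<epsilon>"
  shows "integrable lborel (cone_density a b \<epsilon>)" "(LINT x|lborel. cone_density a b \<epsilon> x) = cone_sum a b \<epsilon>"
proof -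
  define h where "h j = (if 0 \<le> j then column a b (\<epsilon> * (of_int j + 1)) (of_int j + 1) else 0)" for j :: int
  define N where "N = \<lceil>1 / \<epsilon>\<rceil>"
  have Np: "1 / \<epsilon> \<le> N" unfolding N_def by linarith
  have h0: "h j = 0" if "j \<notin> {0..<N}" for j
  proof (cases "j < 0")
    case False
    then have "N \<le> j" using that by auto
    then have "1 / \<epsilon> \<le> of_int j + 1" using Np by linarith
    then have "1 \<le> \<epsilon> * (of_int j + 1)" using assms by (simp add: field_simps)
    then show ?thesis unfolding h_def by (simp add: column_eq_0)
  qed (simp add: h_def)
  have cd: "cone_density a b \<epsilon> x = h \<lfloor>x / \<epsilon>\<rfloor>" for x by (simp add: cone_density_def h_def)
  note step = integral_floor_step[of \<epsilon> "{0..<N}" h, OF assms _ h0]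
  show "integrable lborel (cone_density a b \<epsilon>)" unfolding cd[abs_def] using step by simp
  let ?A = "\<lambda>q::int. {\<lceil>a * q\<rceil>..\<lfloor>b * q\<rfloor>}"
  have "(LINT x|lborel. cone_density a b \<epsilon> x) = \<epsilon> * sum h {0..<N}" unfolding cd using step by simp
  also have "sum h {0..<N} = (\<Sum>q\<in>{1..N}. column a b (\<epsilon> * q) q)"
    by (rule sum.reindex_bij_witness[of _ "\<lambda>q. q - 1" "\<lambda>j. j + 1"]) (auto simp: h_def)
  also have "\<epsilon> * \<dots> = (\<Sum>q\<in>{1..N}. \<Sum>p\<in>?A q. \<epsilon> / q * sector_density a b (\<epsilon> * q) (p / q))"
    unfolding sum_distrib_left by (intro sum.cong refl) (simp add: column_eq_sum sum_distrib_left)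
  also have "\<dots> = (\<Sum>w\<in>Sigma {1..N} ?A. \<epsilon> / of_int (fst w) * sector_density a b (\<epsilon> * of_int (fst w)) (of_int (snd w) / of_int (fst w)))"
    by (subst sum.Sigma) (auto simp: case_prod_unfold)
  also have "\<dots> = (\<Sum>w\<in>Sigma {1..N} ?A. weight \<epsilon> (len w))"
    by (intro sum.cong refl weight_eq_density[symmetric, of _ a b])
      (auto simp: cone_def ceiling_le_iff le_floor_iff)
  also have "\<dots> = cone_sum a b \<epsilon>"
    unfolding cone_sum_def
  proof (rule sum.mono_neutral_right)
    show "{w. w \<in> cone a b \<and> \<epsilon> * len w < 1} \<subseteq> Sigma {1..N} ?A"
    proof
      fix w assume w: "w \<in> {w. w \<in> cone a b \<and> \<epsilon> * len w < 1}"
      then have "len w < 1 / \<epsilon>" using assms by (simp add: field_simps)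
      then have "of_int (fst w) < 1 / \<epsilon>" using abs_fst_le_len[of w] by linarith
      then have "fst w \<le> N" using Np by linarith
      then show "w \<in> Sigma {1..N} ?A" using w by (cases w) (auto simp: cone_def ceiling_le_iff le_floor_iff)
    qed
    show "\<forall>w\<in>Sigma {1..N} ?A - {w. w \<in> cone a b \<and> \<epsilon> * len w < 1}. weight \<epsilon> (len w) = 0"
      by (auto simp: cone_def ceiling_le_iff le_floor_iff weight_def max_def)
  qed auto
  finally show "(LINT x|lborel. cone_density a b \<epsilon> x) = cone_sum a b \<epsilon>" .
qed

lemma cone_density_bound:
  assumes "0 < \<epsilon>" "a \<le> b"
  shows "norm (cone_density a b \<epsilon> x) \<le> (b - a + 1) * indicator {0..1} x"
proof (cases "0 \<le> \<lfloor>x / \<epsilon>\<rfloor>")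
  case True
  define q where "q = \<lfloor>x / \<epsilon>\<rfloor> + 1"
  have q: "0 < q" using True by (simp add: q_def)
  have "x / \<epsilon> < of_int q" unfolding q_def by linarith
  then have "x < \<epsilon> * q" using assms by (simp add: field_simps)
  moreover have "0 \<le> x / \<epsilon>" using True by simp
  then have "0 \<le> x" using assms by (simp add: zero_le_divide_iff)
  ultimately have x: "0 \<le> x" "x < \<epsilon> * q" by auto
  have eq: "cone_density a b \<epsilon> x = column a b (\<epsilon> * q) q"
    using True by (simp add: cone_density_def q_def)
  show ?thesis
  proof (cases "x \<le> 1")
    case True
    then show ?thesis using column_bounds[OF q _ assms(2), of "\<epsilon> * q"] x q assms by (simp add: eq)
  next
    case False
    then show ?thesis using column_eq_0[of "\<epsilon> * q" a b q] x by (simp add: eq)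
  qed
qed (use assms in \<open>simp add: cone_density_def\<close>)

lemma cone_sum_bound:
  assumes "0 < \<epsilon>" "a \<le> b"
  shows "cone_sum a b \<epsilon> \<le> b - a + 1"
proof -
  have "cone_sum a b \<epsilon> \<le> (LINT x|lborel. (b - a + 1) * indicator {0..1::real} x)"
    unfolding cone_sum_eq_integral(2)[OF assms(1), symmetric]
    using cone_density_bound[OF assms] cone_sum_eq_integral(1)[OF assms(1)]
    by (intro integral_mono) (auto simp: abs_le_iff intro!: integrable_mult_right integrable_real_indicator)
  then show ?thesis by simp
qed

lemma sector_density_measurable [measurable]:
  assumes [measurable]: "f \<in> borel_measurable M" "g \<in> borel_measurable M"
  shows "(\<lambda>p. sector_density a b (f p) (g p)) \<in> borel_measurable M"
  unfolding sector_density_def by measurable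

lemma column_integrable:
  fixes a b :: real and q :: int
  assumes "0 < q"
  shows "integrable lborel (\<lambda>s. sector_density a b x (\<lfloor>s / (1 / q)\<rfloor> / q))"
proof (rule integral_floor_step(1)[where h = "\<lambda>j. sector_density a b x (j / q)" and A = "{\<lceil>a * q\<rceil>..\<lfloor>b * q\<rfloor>}"])
  fix j assume j: "j \<notin> {\<lceil>a * q\<rceil>..\<lfloor>b * q\<rfloor>}"
  have "real_of_int j / q \<notin> {a..b}"
  proof
    assume "real_of_int j / q \<in> {a..b}"
    then have "a * q \<le> j" "j \<le> b * q" using assms by (auto simp: field_simps)
    then show False using j by (auto simp: ceiling_le_iff le_floor_iff)
  qed
  then show "sector_density a b x (real_of_int j / q) = 0" by (simp add: sector_density_def)
qed (use assms in auto)

text \<open>The density is continuous except at the two boundary slopes, which form a null set.\<close>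
lemma sector_density_tendsto:
  assumes "x \<longlonglongrightarrow> x0" "y \<longlonglongrightarrow> y0" "y0 \<noteq> a" "y0 \<noteq> b"
  shows "(\<lambda>i. sector_density a b (x i) (y i)) \<longlonglongrightarrow> sector_density a b x0 y0"
proof -
  have "\<forall>\<^sub>F i in sequentially. indicator {a..b} (y i) = (indicator {a..b} y0 :: real)"
  proof -
    consider "y0 < a" | "b < y0" | "a < y0" "y0 < b" using assms(3,4) by linarith
    then show ?thesis
    proof cases
      case 1
      then show ?thesis using order_tendstoD(2)[OF assms(2) 1] by (auto elim: eventually_mono)
    next
      case 2
      then show ?thesis using order_tendstoD(1)[OF assms(2) 2] by (auto elim: eventually_mono)
    next
      case 3
      show ?thesis using order_tendstoD(1)[OF assms(2) 3(1)] order_tendstoD(2)[OF assms(2) 3(2)]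
        by eventually_elim (use 3 in auto)
    qed
  qed
  then have "(\<lambda>i. indicator {a..b} (y i) :: real) \<longlonglongrightarrow> indicator {a..b} y0"
    by (rule tendsto_eventually)
  moreover have "sqrt (1 + y0\<^sup>2) \<noteq> 0" using sqrt_ge_1[of y0] by linarith
  ultimately show ?thesis unfolding sector_density_def by (intro tendsto_intros assms)
qed

text \<open>Dominated convergence in the slope, for a fixed limit of \<open>\<epsilon> q\<close>. The points \<open>p / q\<close> lie below \<open>s\<close> by at most
  \<open>1 / q\<close>, whence the larger interval in the majorant.\<close>
lemma column_tendsto:
  fixes q :: "nat \<Rightarrow> int"
  assumes "x \<longlonglongrightarrow> x0" and x: "\<And>i. 0 \<le> x i" and q: "\<And>i. 0 < q i" and lim: "filterlim (\<lambda>i. real_of_int (q i)) at_top sequentially"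
  shows "(\<lambda>i. column a b (x i) (q i)) \<longlonglongrightarrow> (LINT s|lborel. sector_density a b x0 s)"
  unfolding column_def
proof (rule integral_dominated_convergence[where w = "indicator {a..b + 1}"])
  let ?y = "\<lambda>i s. real_of_int \<lfloor>s / (1 / real_of_int (q i))\<rfloor> / real_of_int (q i)"
  have y: "?y i s \<le> s" "s - 1 / q i \<le> ?y i s" for i s
  proof -
    have "\<lfloor>s * q i\<rfloor> \<le> s * q i" "s * q i - 1 \<le> \<lfloor>s * q i\<rfloor>" by linarith+
    then have "\<lfloor>s * q i\<rfloor> / q i \<le> s * q i / q i" "(s * q i - 1) / q i \<le> \<lfloor>s * q i\<rfloor> / q i"
      using q[of i] by (intro divide_right_mono; simp)+
    then show "?y i s \<le> s" "s - 1 / q i \<le> ?y i s" using q[of i] by (auto simp: diff_divide_distrib)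
  qed
  show "AE s in lborel. (\<lambda>i. sector_density a b (x i) (?y i s)) \<longlonglongrightarrow> sector_density a b x0 s"
  proof -
    have "AE s in lborel. s \<noteq> a" "AE s in lborel. s \<noteq> b" by (rule AE_lborel_singleton)+
    then show ?thesis
    proof eventually_elim
      case (elim s)
      have "(\<lambda>i. 1 / real_of_int (q i)) \<longlonglongrightarrow> 0"
        using tendsto_inverse_0_at_top[OF lim] by (simp add: inverse_eq_divide)
      then have "(\<lambda>i. s - 1 / real_of_int (q i)) \<longlonglongrightarrow> s - 0" by (intro tendsto_intros)
      then have low: "(\<lambda>i. s - 1 / real_of_int (q i)) \<longlonglongrightarrow> s" by simp
      have "(\<lambda>i. ?y i s) \<longlonglongrightarrow> s"
      proof (rule tendsto_sandwich[OF _ _ low tendsto_const])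
        show "\<forall>\<^sub>F i in sequentially. s - 1 / real_of_int (q i) \<le> ?y i s"
          by (intro always_eventually allI y(2))
        show "\<forall>\<^sub>F i in sequentially. ?y i s \<le> s"
          by (intro always_eventually allI y(1))
      qed
      then show ?case by (intro sector_density_tendsto assms(1) elim)
    qed
  qed
  show "AE s in lborel. norm (sector_density a b (x i) (?y i s)) \<le> indicator {a..b + 1} s" for i
  proof (rule AE_I2)
    fix s :: real
    have "1 \<le> q i" using q[of i] by simp
    then have "1 / real_of_int (q i) \<le> 1" by simp
    then have "indicator {a..b} (?y i s) \<le> (indicator {a..b + 1} s :: real)"
      using y[where i = i and s = s] by (auto simp: indicator_def)
    moreover have "norm (sector_density a b (x i) (?y i s)) \<le> indicator {a..b} (?y i s)"
      using sector_density_bounds[OF x[of i]] by simp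
    ultimately show "norm (sector_density a b (x i) (?y i s)) \<le> indicator {a..b + 1} s" by linarith
  qed
  show "(\<lambda>s. sector_density a b (x i) (?y i s)) \<in> borel_measurable lborel" for i
    using column_integrable[OF q[of i]] by (rule borel_measurable_integrable)
  show "integrable lborel (indicator {a..b + 1} :: real \<Rightarrow> real)"
    using emeasure_bounded_finite[of "{a..b + 1}"] by (intro integrable_real_indicator) auto
qed measurable

lemma cone_density_tendsto:
  assumes X: "\<And>i. 0 < X i" "X \<longlonglongrightarrow> 0" and "x \<noteq> 0"
  shows "(\<lambda>i. cone_density a b (X i) x) \<longlonglongrightarrow> indicator {0..} x * (LINT s|lborel. sector_density a b x s)"
proof (cases "x < 0")
  case True
  then have "cone_density a b (X i) x = 0" for i
    using X(1)[of i] divide_neg_pos[of x "X i"] unfolding cone_density_def by (simp add: not_le)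
  then show ?thesis using True by simp
next
  case False
  then have x: "0 < x" using assms(3) by simp
  define q where "q i = \<lfloor>x / X i\<rfloor> + 1" for i
  have nn: "0 \<le> \<lfloor>x / X i\<rfloor>" for i using x X(1)[of i] by simp
  then have q: "0 < q i" for i unfolding q_def by (simp add: add.commute add_pos_nonneg zle_iff_zadd)
  have eq: "cone_density a b (X i) x = column a b (X i * q i) (q i)" for i
    using nn[of i] by (simp add: cone_density_def q_def)
  have qb: "x / X i \<le> q i" "q i \<le> x / X i + 1" for i unfolding q_def by linarith+
  have Xq: "x \<le> X i * q i" "X i * q i \<le> x + X i" for i using qb[of i] X(1)[of i] by (auto simp: field_simps)
  have "(\<lambda>i. x + X i) \<longlonglongrightarrow> x + 0" by (intro tendsto_intros X)
  then have up: "(\<lambda>i. x + X i) \<longlonglongrightarrow> x" by simp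
  have lim: "(\<lambda>i. X i * q i) \<longlonglongrightarrow> x"
    by (rule tendsto_sandwich[OF _ _ tendsto_const up]) (intro always_eventually allI Xq)+
  have "filterlim X (at_right 0) sequentially"
    using X by (intro tendsto_imp_filterlim_at_right always_eventually) auto
  then have "filterlim (\<lambda>i. inverse (X i)) at_top sequentially"
    by (rule filterlim_compose[OF filterlim_inverse_at_top_right])
  then have "filterlim (\<lambda>i. x * inverse (X i)) at_top sequentially"
    by (intro filterlim_tendsto_pos_mult_at_top[OF tendsto_const x])
  then have "filterlim (\<lambda>i. real_of_int (q i)) at_top sequentially"
    by (rule filterlim_at_top_mono) (intro always_eventually allI qb(1)[unfolded divide_inverse])
  then have "(\<lambda>i. column a b (X i * q i) (q i)) \<longlonglongrightarrow> (LINT s|lborel. sector_density a b x s)"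
    using X(1) q by (intro column_tendsto lim) (auto simp: less_imp_le)
  then show ?thesis using x by (simp add: eq)
qed

text \<open>The integral of \<open>(1 - x c)\<^sup>2 / c\<close> from 0 to \<open>1 / c\<close> is \<open>1 / (3 c\<^sup>2)\<close>. With \<open>c\<^sup>2 = 1 + s\<^sup>2\<close> this is the
  derivative of \<open>arctan s / 3\<close>, so that the limit below depends only on the angle of the cone.\<close>
lemma integral_radial_density:
  "(LINT x|lborel. indicator {0..} x * sector_density a b x s) = indicator {a..b} s / (3 * (1 + s\<^sup>2))"
proof -
  define c where "c = sqrt (1 + s\<^sup>2)"
  have c: "1 \<le> c" "c\<^sup>2 = 1 + s\<^sup>2" by (auto simp: c_def)
  have "indicator {0..} x * sector_density a b x s
      = indicator {a..b} s * ((1 - x * c)\<^sup>2 / c * indicator {0..1 / c} x)" for x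
    using c by (auto simp: sector_density_def c_def[symmetric] indicator_def max_def field_simps)
  then have "(LINT x|lborel. indicator {0..} x * sector_density a b x s)
      = indicator {a..b} s * (LINT x|lborel. (1 - x * c)\<^sup>2 / c * indicator {0..1 / c} x)"
    by simp
  also have "(LINT x|lborel. (1 - x * c)\<^sup>2 / c * indicator {0..1 / c} x)
      = - ((1 - 1 / c * c) ^ 3 / (3 * c\<^sup>2)) - (- ((1 - 0 * c) ^ 3 / (3 * c\<^sup>2)))"
  proof (rule integral_FTC_Icc_real)
    fix x assume "0 \<le> x" "x \<le> 1 / c"
    show "((\<lambda>x. - ((1 - x * c) ^ 3 / (3 * c\<^sup>2))) has_real_derivative (1 - x * c)\<^sup>2 / c) (at x)"
      using c(1) by (auto intro!: derivative_eq_intros simp: field_simps power2_eq_square)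
    show "isCont (\<lambda>x. (1 - x * c)\<^sup>2 / c) x" using c by (intro continuous_intros) auto
  qed (use c in auto)
  also have "\<dots> = 1 / (3 * (1 + s\<^sup>2))" using c by simp
  finally show ?thesis by simp
qed

lemma integral_sector_density:
  assumes "a \<le> b"
  shows "(LINT x|lborel. indicator {0..} x * (LINT s|lborel. sector_density a b x s)) = (arctan b - arctan a) / 3"
proof -
  have "integrable (lborel \<Otimes>\<^sub>M lborel) (\<lambda>(x, s). indicator {0..} x * sector_density a b x s)"
  proof (rule integrableI_bounded_set[where A = "{0..1} \<times> {a..b}" and B = 1])
    show "{0..1::real} \<times> {a..b} \<in> sets (lborel \<Otimes>\<^sub>M lborel)" by (intro pair_measureI) auto
    show "(\<lambda>(x, s). indicator {0..} x * sector_density a b x s) \<in> borel_measurable (lborel \<Otimes>\<^sub>M lborel)"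
      by measurable
    show "emeasure (lborel \<Otimes>\<^sub>M lborel) ({0..1::real} \<times> {a..b}) < \<infinity>"
      using assms by (subst lborel.emeasure_pair_measure_Times) auto
    show "AE p in lborel \<Otimes>\<^sub>M lborel. p \<in> {0..1} \<times> {a..b} \<longrightarrow>
        norm (case p of (x, s) \<Rightarrow> indicator {0..} x * sector_density a b x s) \<le> 1"
    proof (intro AE_I2 impI)
      fix p :: "real \<times> real" assume p: "p \<in> {0..1} \<times> {a..b}"
      then have "0 \<le> sector_density a b (fst p) (snd p)" "sector_density a b (fst p) (snd p) \<le> 1"
        using sector_density_bounds[of "fst p" a b "snd p"] by (auto simp: mem_Times_iff)
      then show "norm (case p of (x, s) \<Rightarrow> indicator {0..} x * sector_density a b x s) \<le> 1"
        using p by (auto simp: case_prod_unfold indicator_def)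
    qed
    show "AE p in lborel \<Otimes>\<^sub>M lborel. p \<notin> {0..1} \<times> {a..b} \<longrightarrow>
        (case p of (x, s) \<Rightarrow> indicator {0..} x * sector_density a b x s) = 0"
    proof (intro AE_I2 impI)
      fix p :: "real \<times> real" assume p: "p \<notin> {0..1} \<times> {a..b}"
      show "(case p of (x, s) \<Rightarrow> indicator {0..} x * sector_density a b x s) = 0"
      proof (cases "snd p \<in> {a..b}")
        case True
        then have "fst p < 0 \<or> 1 \<le> fst p" using p by (auto simp: mem_Times_iff)
        then show ?thesis using sector_density_eq_0[of "fst p" a b "snd p"] by (auto simp: case_prod_unfold)
      qed (simp add: case_prod_unfold sector_density_def)
    qed
  qed
  then have "(LINT x|lborel. LINT s|lborel. indicator {0..} x * sector_density a b x s)
      = (LINT s|lborel. LINT x|lborel. indicator {0..} x * sector_density a b x s)"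
    by (rule lborel_pair.Fubini_integral[symmetric])
  also have "\<dots> = (LINT s|lborel. 1 / (3 * (1 + s\<^sup>2)) * indicator {a..b} s)"
    unfolding integral_radial_density by (simp add: mult.commute)
  also have "\<dots> = arctan b / 3 - arctan a / 3"
  proof (rule integral_FTC_Icc_real[OF assms])
    fix x :: real
    have "1 + x\<^sup>2 \<noteq> 0" using zero_le_power2[of x] by linarith
    then show "((\<lambda>x. arctan x / 3) has_real_derivative 1 / (3 * (1 + x\<^sup>2))) (at x)"
      by (auto intro!: derivative_eq_intros simp: field_simps)
    show "isCont (\<lambda>x. 1 / (3 * (1 + x\<^sup>2))) x"
      using \<open>1 + x\<^sup>2 \<noteq> 0\<close> by (intro continuous_intros) auto
  qed
  finally show ?thesis by (simp add: diff_divide_distrib)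
qed

text \<open>Dominated convergence in \<open>x\<close>, after the convergence of the single columns.\<close>
lemma cone_sum_tendsto:
  assumes "a \<le> b"
  shows "(cone_sum a b \<longlongrightarrow> (arctan b - arctan a) / 3) (at_right 0)"
  unfolding tendsto_at_iff_sequentially
proof (intro allI impI)
  fix X :: "nat \<Rightarrow> real" assume X: "\<forall>i. X i \<in> {0<..} - {0}" "X \<longlonglongrightarrow> 0"
  then have pos: "0 < X i" for i by auto
  have "(\<lambda>i. LINT x|lborel. cone_density a b (X i) x)
      \<longlonglongrightarrow> (LINT x|lborel. indicator {0..} x * (LINT s|lborel. sector_density a b x s))"
  proof (rule integral_dominated_convergence[where w = "\<lambda>x. (b - a + 1) * indicator {0..1} x"])
    show "AE x in lborel. (\<lambda>i. cone_density a b (X i) x)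
        \<longlonglongrightarrow> indicator {0..} x * (LINT s|lborel. sector_density a b x s)"
      using AE_lborel_singleton[of 0] by eventually_elim (rule cone_density_tendsto[OF pos X(2)])
    show "AE x in lborel. norm (cone_density a b (X i) x) \<le> (b - a + 1) * indicator {0..1} x" for i
      by (rule AE_I2) (rule cone_density_bound[OF pos assms])
    show "cone_density a b (X i) \<in> borel_measurable lborel" for i
      by (rule borel_measurable_integrable[OF cone_sum_eq_integral(1)[OF pos]])
    show "integrable lborel (\<lambda>x::real. (b - a + 1) * indicator {0..1} x)"
      by (intro integrable_mult_right integrable_real_indicator) auto
    have "(\<lambda>x. LINT s|lborel. sector_density a b x s) \<in> borel_measurable lborel"
      by (rule lborel.borel_measurable_lebesgue_integral) measurable
    then show "(\<lambda>x. indicator {0..} x * (LINT s|lborel. sector_density a b x s)) \<in> borel_measurable lborel"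
      by (intro borel_measurable_times) auto
  qed
  then show "(cone_sum a b \<circ> X) \<longlonglongrightarrow> (arctan b - arctan a) / 3"
    unfolding integral_sector_density[OF assms] comp_def cone_sum_eq_integral(2)[OF pos] .
qed

section \<open>Primitive lattice points in a cone\<close>

definition prim_cone_sum :: "real \<Rightarrow> real \<Rightarrow> real \<Rightarrow> real" where
  "prim_cone_sum a b \<epsilon> = (\<Sum>w | w \<in> cone a b \<and> coprime (fst w) (snd w) \<and> \<epsilon> * len w < 1. weight \<epsilon> (len w))"

lemma finite_cone_short: "0 < \<epsilon> \<Longrightarrow> finite {w. P w \<and> \<epsilon> * len w < 1}"
  by (rule finite_subset[OF _ finite_short_vectors[of "1 / \<epsilon>"]]) (auto simp: field_simps)

lemma weight_nonneg: "0 < \<epsilon> \<Longrightarrow> 0 \<le> weight \<epsilon> (len w)"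
  by (simp add: weight_def len_nonneg)

lemma prim_cone_sum_bounds:
  assumes "0 < \<epsilon>" "a \<le> b"
  shows "\<bar>prim_cone_sum a b \<epsilon>\<bar> \<le> b - a + 1"
proof -
  have "0 \<le> prim_cone_sum a b \<epsilon>"
    unfolding prim_cone_sum_def by (intro sum_nonneg weight_nonneg assms)
  moreover have "prim_cone_sum a b \<epsilon> \<le> cone_sum a b \<epsilon>"
    unfolding prim_cone_sum_def cone_sum_def
    by (intro sum_mono2 finite_cone_short weight_nonneg assms) auto
  ultimately show ?thesis using cone_sum_bound[OF assms] by linarith
qed

lemma len_scale: "len (d * fst w, d * snd w) = \<bar>of_int d\<bar> * len w"
proof -
  have "(of_int (d * fst w))\<^sup>2 + (of_int (d * snd w))\<^sup>2 = (of_int d)\<^sup>2 * ((of_int (fst w))\<^sup>2 + (of_int (snd w) :: real)\<^sup>2)"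
    by (simp add: power_mult_distrib distrib_left)
  then show ?thesis unfolding len_def fst_conv snd_conv by (simp add: real_sqrt_mult)
qed

lemma weight_scale:
  assumes "0 < d"
  shows "weight \<epsilon> (d * l) = weight (d * \<epsilon>) l / d\<^sup>2"
  using assms by (simp add: weight_def mult.assoc mult.left_commute power2_eq_square)

lemma cone_scale:
  assumes "0 < d"
  shows "(d * fst w, d * snd w) \<in> cone a b \<longleftrightarrow> w \<in> cone a b"
proof -
  have "a * of_int (d * fst w) \<le> of_int (d * snd w) \<longleftrightarrow> of_int d * (a * of_int (fst w)) \<le> of_int d * of_int (snd w)"
    by (simp add: mult.left_commute)
  moreover have "of_int (d * snd w) \<le> b * of_int (d * fst w) \<longleftrightarrow> of_int d * of_int (snd w) \<le> of_int d * (b * of_int (fst w))"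
    by (simp add: mult.left_commute)
  ultimately show ?thesis using assms by (simp add: cone_def zero_less_mult_iff)
qed

text \<open>A lattice point of the cone is \<open>d\<close> times a primitive point of the cone, where \<open>d\<close> is the greatest common divisor of
  its coordinates, and the weight is homogeneous: scaling the vector by \<open>d\<close> amounts to scaling \<open>\<epsilon>\<close> by \<open>d\<close> and dividing
  by \<open>d\<^sup>2\<close>.\<close>
lemma cone_sum_eq_prim:
  assumes "0 < \<epsilon>" "1 / \<epsilon> \<le> of_int N"
  shows "cone_sum a b \<epsilon> = (\<Sum>d\<in>{1..N}. prim_cone_sum a b (of_int d * \<epsilon>) / (of_int d)\<^sup>2)"
proof -
  let ?C = "\<lambda>d::int. {w. w \<in> cone a b \<and> coprime (fst w) (snd w) \<and> of_int d * \<epsilon> * len w < 1}"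
  have "cone_sum a b \<epsilon> = (\<Sum>x\<in>Sigma {1..N} ?C. weight (of_int (fst x) * \<epsilon>) (len (snd x)) / (of_int (fst x))\<^sup>2)"
    unfolding cone_sum_def
  proof (rule sum.reindex_bij_witness[where
        i = "\<lambda>x. (fst x * fst (snd x), fst x * snd (snd x))" and
        j = "\<lambda>w. (gcd (fst w) (snd w), (fst w div gcd (fst w) (snd w), snd w div gcd (fst w) (snd w)))"])
    fix w assume w: "w \<in> {w. w \<in> cone a b \<and> \<epsilon> * len w < 1}"
    define g where "g = gcd (fst w) (snd w)"
    define u where "u = (fst w div g, snd w div g)"
    have q: "0 < fst w" using w by (simp add: cone_def)
    then have g: "0 < g" by (simp add: g_def)
    have gu: "(g * fst u, g * snd u) = w" by (simp add: u_def g_def)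
    then show "(fst (g, u) * fst (snd (g, u)), fst (g, u) * snd (snd (g, u))) = w" by simp
    have lw: "len w = of_int g * len u" using len_scale[of g u] g unfolding gu by simp
    have "coprime (fst u) (snd u)"
      unfolding u_def g_def fst_conv snd_conv using q by (intro div_gcd_coprime) auto
    moreover have "u \<in> cone a b" using cone_scale[OF g, of u a b] w unfolding gu by simp
    moreover have "of_int g * \<epsilon> * len u < 1" using w by (simp add: lw mult.left_commute mult.assoc)
    moreover have "g \<le> N"
    proof -
      have "g \<le> fst w" unfolding g_def using q by (intro zdvd_imp_le) auto
      then have "of_int g \<le> len w" using abs_fst_le_len[of w] by linarith
      also have "len w < 1 / \<epsilon>" using w assms(1) by (simp add: field_simps)
      finally have "real_of_int g < of_int N" using assms(2) by linarith
      then show ?thesis by simp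
    qed
    ultimately show "(g, u) \<in> Sigma {1..N} ?C" using g by simp
    show "weight (of_int (fst (g, u)) * \<epsilon>) (len (snd (g, u))) / (of_int (fst (g, u)))\<^sup>2 = weight \<epsilon> (len w)"
      using weight_scale[of "of_int g" \<epsilon> "len u"] g by (simp add: lw)
  next
    fix x assume x: "x \<in> Sigma {1..N} ?C"
    define d u where "d = fst x" and "u = snd x"
    have d: "0 < d" and u: "u \<in> cone a b" "coprime (fst u) (snd u)" "of_int d * \<epsilon> * len u < 1"
      using x by (auto simp: d_def u_def)
    have "gcd (d * fst u) (d * snd u) = d"
      using d u(2) by (simp add: gcd_mult_left)
    then show "(gcd (fst (fst x * fst (snd x), fst x * snd (snd x))) (snd (fst x * fst (snd x), fst x * snd (snd x))),
        fst (fst x * fst (snd x), fst x * snd (snd x)) div gcd (fst (fst x * fst (snd x), fst x * snd (snd x))) (snd (fst x * fst (snd x), fst x * snd (snd x))),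
        snd (fst x * fst (snd x), fst x * snd (snd x)) div gcd (fst (fst x * fst (snd x), fst x * snd (snd x))) (snd (fst x * fst (snd x), fst x * snd (snd x)))) = x"
      using d by (simp add: d_def u_def)
    have "(d * fst u, d * snd u) \<in> cone a b" using cone_scale[OF d] u by blast
    moreover have "\<epsilon> * len (d * fst u, d * snd u) < 1"
      using u d by (simp add: len_scale mult.left_commute mult.assoc)
    ultimately show "(fst x * fst (snd x), fst x * snd (snd x)) \<in> {w. w \<in> cone a b \<and> \<epsilon> * len w < 1}"
      by (simp add: d_def u_def)
  qed
  also have "\<dots> = (\<Sum>d\<in>{1..N}. \<Sum>w\<in>?C d. weight (of_int d * \<epsilon>) (len w) / (of_int d)\<^sup>2)"
    using assms(1) by (subst sum.Sigma) (auto intro!: finite_cone_short[of "of_int _ * \<epsilon>" "\<lambda>w. w \<in> cone a b \<and> coprime (fst w) (snd w)", simplified conj_assoc] simp: case_prod_unfold)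
  also have "\<dots> = (\<Sum>d\<in>{1..N}. prim_cone_sum a b (of_int d * \<epsilon>) / (of_int d)\<^sup>2)"
    unfolding prim_cone_sum_def by (simp add: sum_divide_distrib)
  finally show ?thesis .
qed

lemma prim_cone_sum_eq_0:
  assumes "1 \<le> \<epsilon>"
  shows "prim_cone_sum a b \<epsilon> = 0"
proof -
  have "\<not> \<epsilon> * len w < 1" if "w \<in> cone a b" for w
  proof -
    have "0 < fst w" using that by (simp add: cone_def)
    then have "1 \<le> len w" using abs_fst_le_len[of w] by linarith
    then have "1 * 1 \<le> \<epsilon> * len w" using assms by (intro mult_mono) auto
    then show ?thesis by simp
  qed
  then show ?thesis unfolding prim_cone_sum_def by (intro sum.neutral) auto
qed

lemma cone_sum_sums_prim:
  assumes "0 < \<epsilon>"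
  shows "(\<lambda>n. prim_cone_sum a b (real (Suc n) * \<epsilon>) / (real (Suc n))\<^sup>2) sums cone_sum a b \<epsilon>"
proof -
  define N where "N = nat \<lceil>1 / \<epsilon>\<rceil>"
  have N: "1 / \<epsilon> \<le> real N" unfolding N_def by linarith
  have "(\<lambda>n. prim_cone_sum a b (real (Suc n) * \<epsilon>) / (real (Suc n))\<^sup>2) sums
      (\<Sum>n\<in>{..<N}. prim_cone_sum a b (real (Suc n) * \<epsilon>) / (real (Suc n))\<^sup>2)"
  proof (rule sums_finite)
    fix n assume "n \<notin> {..<N}"
    then have "1 / \<epsilon> \<le> real (Suc n)" using N by auto
    then have "1 \<le> real (Suc n) * \<epsilon>" using assms by (simp add: field_simps)
    then show "prim_cone_sum a b (real (Suc n) * \<epsilon>) / (real (Suc n))\<^sup>2 = 0"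
      by (simp only: prim_cone_sum_eq_0 div_0)
  qed simp
  also have "(\<Sum>n\<in>{..<N}. prim_cone_sum a b (real (Suc n) * \<epsilon>) / (real (Suc n))\<^sup>2)
      = (\<Sum>d\<in>{1..int N}. prim_cone_sum a b (of_int d * \<epsilon>) / (of_int d)\<^sup>2)"
    by (rule sum.reindex_bij_witness[of _ "\<lambda>d. nat (d - 1)" "\<lambda>n. int (Suc n)"]) (auto simp del: of_nat_Suc)
  also have "\<dots> = cone_sum a b \<epsilon>"
    using N by (intro cone_sum_eq_prim[symmetric] assms) simp
  finally show ?thesis .
qed

text \<open>Telescoping, because \<open>1 / (N + 2)\<^sup>2 \<le> 1 / (N + 3/2) - 1 / (N + 5/2)\<close>.\<close>
lemma sum_inverse_squares_from_2: "(\<Sum>n<N. 1 / (real n + 2)\<^sup>2) \<le> 2 / 3"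
proof -
  have "(\<Sum>n<N. 1 / (real n + 2)\<^sup>2) \<le> 2 / 3 - 1 / (real N + 3 / 2)"
  proof (induction N)
    case (Suc N)
    have "1 / (real N + 2)\<^sup>2 \<le> 1 / (real N + 3 / 2) - 1 / (real N + 5 / 2)"
    proof -
      have "1 / (real N + 3 / 2) - 1 / (real N + 5 / 2) = 1 / ((real N + 3 / 2) * (real N + 5 / 2))"
        by (simp add: field_simps)
      moreover have "(real N + 3 / 2) * (real N + 5 / 2) \<le> (real N + 2)\<^sup>2"
        by (simp add: power2_eq_square algebra_simps)
      ultimately show ?thesis by (simp add: frac_le)
    qed
    then have "(\<Sum>n<Suc N. 1 / (real n + 2)\<^sup>2) \<le> 2 / 3 - 1 / (real N + 5 / 2)" using Suc by simp
    moreover have "real (Suc N) + 3 / 2 = real N + 5 / 2" by simp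
    ultimately show ?case by metis
  qed simp
  also have "\<dots> \<le> 2 / 3" by simp
  finally show ?thesis .
qed

text \<open>The relation between \<open>A\<close> and \<open>P\<close> is inverted in the limit. Let \<open>L\<close> be the claimed limit and \<open>D = P - L\<close>. As \<open>L\<close> is
  chosen such that \<open>L \<pi>\<^sup>2 / 6 = I\<close>, the value \<open>D \<epsilon>\<close> is \<open>A \<epsilon> - I\<close> minus the sum of \<open>D (d \<epsilon>) / d\<^sup>2\<close> over
  \<open>d \<ge> 2\<close>. The coefficients \<open>1 / d\<^sup>2\<close> in this sum add up to at most \<open>2/3\<close>, so an eventual bound \<open>c\<close> for \<open>|D|\<close> improves to
  \<open>7/8 c\<close>: the remaining \<open>A \<epsilon> - I\<close> and the tail of the series are each made smaller than \<open>c / 16\<close>.\<close>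
lemma tendsto_of_sum_over_multiples:
  fixes P A :: "real \<Rightarrow> real"
  assumes sums: "\<And>\<epsilon>. 0 < \<epsilon> \<Longrightarrow> (\<lambda>n. P (real (Suc n) * \<epsilon>) / (real (Suc n))\<^sup>2) sums A \<epsilon>"
    and bound: "\<And>\<epsilon>. 0 < \<epsilon> \<Longrightarrow> \<bar>P \<epsilon>\<bar> \<le> M"
    and lim: "(A \<longlongrightarrow> I) (at_right 0)"
  shows "(P \<longlongrightarrow> 6 / pi\<^sup>2 * I) (at_right 0)"
proof -
  define L where "L = 6 / pi\<^sup>2 * I"
  define D where "D \<epsilon> = P \<epsilon> - L" for \<epsilon>
  define K where "K = M + \<bar>L\<bar> + 1"
  have DK: "\<bar>D \<epsilon>\<bar> \<le> K" if "0 < \<epsilon>" for \<epsilon> using bound[OF that] by (simp add: D_def K_def)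
  have K: "0 < K" using bound[OF zero_less_one] unfolding K_def by linarith
  define z where "z n = 1 / (real n + 2)\<^sup>2" for n
  have "(\<lambda>n. 1 / (real (Suc n))\<^sup>2) sums (pi\<^sup>2 / 6)" using inverse_squares_sums by (simp add: add.commute)
  then have "(\<lambda>n. L * (1 / (real (Suc n))\<^sup>2)) sums (L * (pi\<^sup>2 / 6))" by (rule sums_mult)
  moreover have "L * (pi\<^sup>2 / 6) = I" by (simp add: L_def)
  ultimately have zeta: "(\<lambda>n. L * (1 / (real (Suc n))\<^sup>2)) sums I" by simp
  have z0: "0 \<le> z n" for n by (simp add: z_def)
  have "summable (\<lambda>n. 1 / (real (Suc n))\<^sup>2)" using \<open>(\<lambda>n. 1 / (real (Suc n))\<^sup>2) sums (pi\<^sup>2 / 6)\<close> by (rule sums_summable)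
  then have "summable (\<lambda>n. 1 / (real (Suc (n + 1)))\<^sup>2)" by (rule summable_ignore_initial_segment)
  then have sz: "summable z" by (simp add: z_def[abs_def] add.commute)
  have Dsums: "(\<lambda>n. D (real (Suc n) * \<epsilon>) / (real (Suc n))\<^sup>2) sums (A \<epsilon> - I)" if "0 < \<epsilon>" for \<epsilon>
    using sums_diff[OF sums[OF that] zeta] by (simp add: D_def diff_divide_distrib)
  have step: "\<forall>\<^sub>F \<epsilon> in at_right 0. \<bar>D \<epsilon>\<bar> \<le> 7 / 8 * c"
    if c: "0 < c" and ev: "\<forall>\<^sub>F \<epsilon> in at_right 0. \<bar>D \<epsilon>\<bar> \<le> c" for c
  proof -
    obtain \<delta> where \<delta>: "0 < \<delta>" "\<And>\<epsilon>. 0 < \<epsilon> \<Longrightarrow> \<epsilon> < \<delta> \<Longrightarrow> \<bar>D \<epsilon>\<bar> \<le> c"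
      using ev unfolding eventually_at_right_field by auto
    have "(\<lambda>N. suminf (\<lambda>n. z (n + N))) \<longlonglongrightarrow> 0" by (rule suminf_exist_split2[OF sz])
    then have "\<forall>\<^sub>F N in sequentially. suminf (\<lambda>n. z (n + N)) < c / (16 * K)"
      using c K by (intro order_tendstoD(2)) auto
    then obtain N where N: "suminf (\<lambda>n. z (n + N)) < c / (16 * K)"
      by (auto simp: eventually_sequentially)
    have "\<forall>\<^sub>F \<epsilon> in at_right 0. \<bar>A \<epsilon> - I\<bar> < c / 16"
      using tendstoD[OF lim, of "c / 16"] c by (simp add: dist_real_def)
    moreover have "\<forall>\<^sub>F \<epsilon> in at_right 0. \<epsilon> < \<delta> / (real N + 2)"
      using \<delta>(1) by (intro eventually_at_rightI[of 0 "\<delta> / (real N + 2)"]) auto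
    moreover have "\<forall>\<^sub>F \<epsilon> :: real in at_right 0. 0 < \<epsilon>" by (simp add: eventually_at_right_less)
    ultimately show ?thesis
    proof eventually_elim
      case (elim \<epsilon>)
      define f where "f n = D (real (Suc n) * \<epsilon>) / (real (Suc n))\<^sup>2" for n
      have fs: "f sums (A \<epsilon> - I)" unfolding f_def[abs_def] by (rule Dsums) (use elim in simp)
      have fz: "\<bar>f (Suc n)\<bar> = z n * \<bar>D (real (Suc (Suc n)) * \<epsilon>)\<bar>" for n
        by (simp add: f_def z_def abs_mult add.commute)
      have fK: "\<bar>f (Suc n)\<bar> \<le> z n * K" for n
        unfolding fz using elim by (intro mult_left_mono DK z0) auto
      have szK: "summable (\<lambda>n. z n * K)" by (intro summable_mult2 sz)
      have fabs: "summable (\<lambda>n. \<bar>f (Suc n)\<bar>)"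
        using fK by (intro summable_comparison_test[OF _ szK]) auto
      have "f 0 + suminf (\<lambda>n. f (Suc n)) = A \<epsilon> - I"
        using suminf_split_head[OF sums_summable[OF fs]] sums_unique[OF fs] by simp
      then have "D \<epsilon> = (A \<epsilon> - I) - suminf (\<lambda>n. f (Suc n))" by (simp add: f_def)
      moreover have "\<bar>suminf (\<lambda>n. f (Suc n))\<bar> \<le> suminf (\<lambda>n. \<bar>f (Suc n)\<bar>)"
        by (rule summable_rabs[OF fabs])
      ultimately have "\<bar>D \<epsilon>\<bar> \<le> c / 16 + suminf (\<lambda>n. \<bar>f (Suc n)\<bar>)" using elim by linarith
      also have "suminf (\<lambda>n. \<bar>f (Suc n)\<bar>) = suminf (\<lambda>n. \<bar>f (Suc (n + N))\<bar>) + (\<Sum>n<N. \<bar>f (Suc n)\<bar>)"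
        by (rule suminf_split_initial_segment[OF fabs])
      also have "suminf (\<lambda>n. \<bar>f (Suc (n + N))\<bar>) \<le> suminf (\<lambda>n. z (n + N) * K)"
        by (intro suminf_le fK summable_ignore_initial_segment[OF fabs] summable_ignore_initial_segment[OF szK])
      also have "\<dots> = suminf (\<lambda>n. z (n + N)) * K"
        by (intro suminf_mult2[symmetric] summable_ignore_initial_segment sz)
      also have "\<dots> \<le> c / 16" using N K by (simp add: field_simps)
      also have "(\<Sum>n<N. \<bar>f (Suc n)\<bar>) \<le> (\<Sum>n<N. z n * c)"
      proof (rule sum_mono)
        fix n assume "n \<in> {..<N}"
        then have "real (Suc (Suc n)) * \<epsilon> \<le> (real N + 2) * \<epsilon>" using elim by (intro mult_right_mono) auto
        also have "\<dots> < \<delta>" using elim by (simp add: field_simps)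
        finally show "\<bar>f (Suc n)\<bar> \<le> z n * c"
          unfolding fz using elim by (intro mult_left_mono \<delta>(2) z0) auto
      qed
      also have "\<dots> = (\<Sum>n<N. z n) * c" by (simp add: sum_distrib_right)
      also have "\<dots> \<le> 2 / 3 * c"
        unfolding z_def using c by (intro mult_right_mono sum_inverse_squares_from_2) auto
      finally show ?case using c by simp
    qed
  qed
  have iter: "\<forall>\<^sub>F \<epsilon> in at_right 0. \<bar>D \<epsilon>\<bar> \<le> (7 / 8) ^ k * K" for k
  proof (induction k)
    case 0
    show ?case using DK by (auto intro!: eventually_at_rightI[of 0 1])
  next
    case (Suc k)
    have "0 < (7 / 8 :: real) ^ k * K" using K by simp
    from step[OF this Suc.IH] show ?case by (simp add: mult.assoc)
  qed
  have "(D \<longlongrightarrow> 0) (at_right 0)"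
  proof (rule tendstoI)
    fix e :: real assume e: "0 < e"
    have "(\<lambda>k. (7 / 8 :: real) ^ k * K) \<longlonglongrightarrow> 0 * K"
      by (intro tendsto_intros LIMSEQ_power_zero) auto
    then have "\<forall>\<^sub>F k in sequentially. (7 / 8 :: real) ^ k * K < e" using e by (intro order_tendstoD(2)) auto
    then obtain k where k: "(7 / 8 :: real) ^ k * K < e" by (auto simp: eventually_sequentially)
    show "\<forall>\<^sub>F \<epsilon> in at_right 0. dist (D \<epsilon>) 0 < e"
      using iter[of k] by eventually_elim (use k in simp)
  qed
  then have "((\<lambda>\<epsilon>. D \<epsilon> + L) \<longlongrightarrow> 0 + L) (at_right 0)" by (intro tendsto_intros)
  then show ?thesis by (simp add: D_def L_def)
qed

lemma prim_cone_sum_tendsto: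
  assumes "a \<le> b"
  shows "(prim_cone_sum a b \<longlongrightarrow> 2 / pi\<^sup>2 * (arctan b - arctan a)) (at_right 0)"
proof -
  have "(prim_cone_sum a b \<longlongrightarrow> 6 / pi\<^sup>2 * ((arctan b - arctan a) / 3)) (at_right 0)"
    by (rule tendsto_of_sum_over_multiples[OF cone_sum_sums_prim prim_cone_sum_bounds[OF _ assms] cone_sum_tendsto[OF assms]])
  moreover have "6 / pi\<^sup>2 * ((arctan b - arctan a) / 3) = 2 / pi\<^sup>2 * (arctan b - arctan a)"
    by (simp add: field_simps)
  ultimately show ?thesis by (simp only:)
qed

section \<open>Strips over an interval of directions\<close>

definition tent :: "real \<Rightarrow> real \<Rightarrow> real \<Rightarrow> real" where
  "tent c d \<phi> = max 0 (c - d * \<bar>\<phi>\<bar>)"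

lemma has_integral_tent:
  assumes "0 < d"
  shows "has_bochner_integral lborel (tent c d) ((max 0 c)\<^sup>2 / d)"
proof (cases "c \<le> 0")
  case True
  then have "tent c d \<phi> = 0" for \<phi>
    using mult_nonneg_nonneg[of d "\<bar>\<phi>\<bar>"] assms unfolding tent_def by linarith
  then have "tent c d = (\<lambda>_. 0)" by auto
  then show ?thesis using True by (simp add: has_bochner_integral_iff)
next
  case False
  define x where "x = c / d"
  have x: "0 < x" "d * x = c" using False assms by (auto simp: x_def)
  have r: "has_bochner_integral lborel (\<lambda>\<phi>. (c - d * \<phi>) * indicator {0..x} \<phi>) ((c * x - d * x\<^sup>2 / 2) - (c * 0 - d * 0\<^sup>2 / 2))"
    using x by (intro has_bochner_integral_FTC_Icc_real) (auto intro!: derivative_eq_intros)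
  have l: "has_bochner_integral lborel (\<lambda>\<phi>. (c + d * \<phi>) * indicator {-x..0} \<phi>) ((c * 0 + d * 0\<^sup>2 / 2) - (c * (-x) + d * (-x)\<^sup>2 / 2))"
    using x by (intro has_bochner_integral_FTC_Icc_real) (auto intro!: derivative_eq_intros)
  \<comment> \<open>Both pieces contain the point 0.\<close>
  have AE: "AE \<phi> in lborel. (c - d * \<phi>) * indicator {0..x} \<phi> + (c + d * \<phi>) * indicator {-x..0} \<phi> = tent c d \<phi>"
    using AE_lborel_singleton[of 0]
  proof eventually_elim
    case (elim \<phi>)
    have *: "d * y \<le> c \<longleftrightarrow> y \<le> x" for y using assms x(2) by (metis mult_le_cancel_left_pos)
    show ?case using elim *[of \<phi>] *[of "-\<phi>"] by (cases "\<phi> > 0") (auto simp: tent_def indicator_def max_def)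
  qed
  have "has_bochner_integral lborel (tent c d)
      (((c * x - d * x\<^sup>2 / 2) - (c * 0 - d * 0\<^sup>2 / 2)) + ((c * 0 + d * 0\<^sup>2 / 2) - (c * (-x) + d * (-x)\<^sup>2 / 2)))"
  proof (rule has_bochner_integralI_AE[OF has_bochner_integral_add[OF r l] _ AE])
    show "tent c d \<in> borel_measurable lborel" unfolding tent_def by measurable
  qed
  also have "((c * x - d * x\<^sup>2 / 2) - (c * 0 - d * 0\<^sup>2 / 2)) + ((c * 0 + d * 0\<^sup>2 / 2) - (c * (-x) + d * (-x)\<^sup>2 / 2)) = (max 0 c)\<^sup>2 / d"
    using False assms by (simp add: x_def power2_eq_square field_simps)
  finally show ?thesis .
qed

text \<open>The area \<open>c\<^sup>2 / d\<close> of the tent with \<open>c = 1 - r l\<close> and \<open>d = t l / r\<close>.\<close>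
lemma has_integral_tent_weight:
  assumes "0 < r" "0 < t" "0 < l"
  shows "has_bochner_integral lborel (\<lambda>\<theta>. tent (1 - r * l) (t / r * l) (\<theta> - \<psi>)) (weight r l / t)"
proof -
  have h: "has_bochner_integral lborel (tent (1 - r * l) (t / r * l)) ((max 0 (1 - r * l))\<^sup>2 / (t / r * l))"
    using assms by (intro has_integral_tent) auto
  have "has_bochner_integral lborel (\<lambda>\<theta>. tent (1 - r * l) (t / r * l) (- \<psi> + 1 * \<theta>)) (((max 0 (1 - r * l))\<^sup>2 / (t / r * l)) /\<^sub>R \<bar>1\<bar>)"
    using lborel_has_bochner_integral_real_affine_iff[of 1 "tent (1 - r * l) (t / r * l)" _ "- \<psi>"] h by simp
  moreover have "(max 0 (1 - r * l))\<^sup>2 / (t / r * l) = weight r l / t" by (simp add: weight_def)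
  ultimately show ?thesis by (simp add: add.commute)
qed

lemma perp_slope:
  assumes "0 < fst w"
  shows "perp w \<theta> = len w * sin (\<theta> - arctan (of_int (snd w) / of_int (fst w)))"
proof -
  define s where "s = real_of_int (snd w) / of_int (fst w)"
  define c where "c = sqrt (1 + s\<^sup>2)"
  have c: "1 \<le> c" using sqrt_ge_1 by (simp add: c_def)
  have l: "len w = of_int (fst w) * c" unfolding c_def s_def by (rule len_slope[OF assms])
  have "snd w = of_int (fst w) * s" using assms by (simp add: s_def)
  then show ?thesis
    using c unfolding l s_def[symmetric] perp_def
    by (simp add: sin_diff sin_arctan cos_arctan c_def[symmetric] field_simps)
qed

lemma cone_tan_iff:
  assumes "-(pi / 2) < \<alpha>" "\<alpha> < pi / 2" "-(pi / 2) < \<beta>" "\<beta> < pi / 2" "0 < fst w"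
  shows "w \<in> cone (tan \<alpha>) (tan \<beta>) \<longleftrightarrow> arctan (of_int (snd w) / of_int (fst w)) \<in> {\<alpha>..\<beta>}"
proof -
  define s where "s = real_of_int (snd w) / of_int (fst w)"
  have "w \<in> cone (tan \<alpha>) (tan \<beta>) \<longleftrightarrow> tan \<alpha> \<le> s \<and> s \<le> tan \<beta>"
    using assms(5) by (auto simp: cone_def s_def field_simps)
  also have "\<dots> \<longleftrightarrow> arctan (tan \<alpha>) \<le> arctan s \<and> arctan s \<le> arctan (tan \<beta>)"
    by (simp only: arctan_le_iff)
  also have "\<dots> \<longleftrightarrow> arctan s \<in> {\<alpha>..\<beta>}" using assms by (simp add: arctan_tan)
  finally show ?thesis by (simp only: s_def)
qed

lemma kern_measurable [measurable]: "kern r t w \<in> borel_measurable borel"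
  unfolding kern_def by measurable

lemma integrable_kern: "integrable lborel (\<lambda>\<theta>. indicator {\<alpha>..\<beta>} \<theta> * kern r t w \<theta>)"
  if "0 < r" "0 < t" for r t \<alpha> \<beta>
proof (rule integrableI_bounded_set[where A = "{\<alpha>..\<beta>}" and B = 1])
  show "emeasure lborel {\<alpha>..\<beta>} < \<infinity>" using emeasure_bounded_finite[of "{\<alpha>..\<beta>}"] by simp
  have "kern r t w \<theta> \<le> 1" for \<theta>
  proof -
    have "0 \<le> r * len w + t / r * \<bar>perp w \<theta>\<bar>" using that by (simp add: len_nonneg)
    then show ?thesis unfolding kern_def by linarith
  qed
  then show "AE \<theta> in lborel. \<theta> \<in> {\<alpha>..\<beta>} \<longrightarrow> norm (indicator {\<alpha>..\<beta>} \<theta> * kern r t w \<theta>) \<le> 1"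
    by (intro AE_I2) (simp add: kern_nonneg)
qed auto

lemma integral_strip_area_eq:
  assumes "0 < r" "0 < t"
  shows "(LINT \<theta>|lborel. indicator {\<alpha>..\<beta>} \<theta> * strip_area r t \<theta>)
    = (\<Sum>w | w \<in> prim \<and> r * len w < 1. LINT \<theta>|lborel. indicator {\<alpha>..\<beta>} \<theta> * kern r t w \<theta>)"
  unfolding strip_area_def sum_distrib_left
  by (intro Bochner_Integration.integral_sum integrable_kern assms)

text \<open>A vector whose angle lies in the interval at distance at least \<open>\<eta>\<close> from its ends has its whole strip, of angular
  half-width at most \<open>r / t\<close>, in the interval; and replacing the sine by its argument makes the strip smaller.\<close>
lemma strip_integral_ge:
  assumes "0 < r" "1 \<le> t" "r \<le> \<eta>" "-(pi / 2) < \<alpha>" "\<beta> < pi / 2" "0 < \<eta>" "\<alpha> + \<eta> \<le> \<beta> - \<eta>"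
  shows "prim_cone_sum (tan (\<alpha> + \<eta>)) (tan (\<beta> - \<eta>)) r / t \<le> (LINT \<theta>|lborel. indicator {\<alpha>..\<beta>} \<theta> * strip_area r t \<theta>)"
proof -
  let ?C = "{w. w \<in> cone (tan (\<alpha> + \<eta>)) (tan (\<beta> - \<eta>)) \<and> coprime (fst w) (snd w) \<and> r * len w < 1}"
  have "prim_cone_sum (tan (\<alpha> + \<eta>)) (tan (\<beta> - \<eta>)) r / t = (\<Sum>w\<in>?C. weight r (len w) / t)"
    by (simp add: prim_cone_sum_def sum_divide_distrib)
  also have "\<dots> \<le> (\<Sum>w\<in>?C. LINT \<theta>|lborel. indicator {\<alpha>..\<beta>} \<theta> * kern r t w \<theta>)"
  proof (rule sum_mono)
    fix w assume w: "w \<in> ?C"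
    then have q: "0 < fst w" by (simp add: cone_def)
    define \<psi> where "\<psi> = arctan (real_of_int (snd w) / of_int (fst w))"
    have \<psi>: "\<alpha> + \<eta> \<le> \<psi>" "\<psi> \<le> \<beta> - \<eta>"
      using cone_tan_iff[of "\<alpha> + \<eta>" "\<beta> - \<eta>" w] q w assms by (auto simp: \<psi>_def)
    have l: "1 \<le> len w" using abs_fst_le_len[of w] q by linarith
    have "(LINT \<theta>|lborel. tent (1 - r * len w) (t / r * len w) (\<theta> - \<psi>)) \<le> (LINT \<theta>|lborel. indicator {\<alpha>..\<beta>} \<theta> * kern r t w \<theta>)"
    proof (rule integral_mono)
      show "integrable lborel (\<lambda>\<theta>. tent (1 - r * len w) (t / r * len w) (\<theta> - \<psi>))"
        using has_integral_tent_weight[of r t "len w" \<psi>] assms l by (auto simp: has_bochner_integral_iff)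
      show "integrable lborel (\<lambda>\<theta>. indicator {\<alpha>..\<beta>} \<theta> * kern r t w \<theta>)"
        using assms by (intro integrable_kern) auto
      fix \<theta> :: real
      have "\<bar>perp w \<theta>\<bar> \<le> len w * \<bar>\<theta> - \<psi>\<bar>"
        unfolding perp_slope[OF q] \<psi>_def[symmetric] abs_mult using l abs_sin_x_le_abs_x by (auto intro!: mult_mono)
      then have "t / r * \<bar>perp w \<theta>\<bar> \<le> t / r * (len w * \<bar>\<theta> - \<psi>\<bar>)" using assms by (intro mult_left_mono) auto
      then have le: "tent (1 - r * len w) (t / r * len w) (\<theta> - \<psi>) \<le> kern r t w \<theta>"
        unfolding tent_def kern_def mult.assoc by (intro max.mono) auto
      show "tent (1 - r * len w) (t / r * len w) (\<theta> - \<psi>) \<le> indicator {\<alpha>..\<beta>} \<theta> * kern r t w \<theta>"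
      proof (cases "\<theta> \<in> {\<alpha>..\<beta>}")
        case True
        then show ?thesis using le by simp
      next
        case False
        then have "\<eta> < \<bar>\<theta> - \<psi>\<bar>" using \<psi> by auto
        then have "r < \<bar>\<theta> - \<psi>\<bar>" using assms by simp
        then have "1 < 1 / r * \<bar>\<theta> - \<psi>\<bar>" using assms by (simp add: field_simps)
        also have "\<dots> \<le> t / r * len w * \<bar>\<theta> - \<psi>\<bar>"
        proof (intro mult_right_mono)
          have "1 * 1 \<le> t * len w" using assms l by (intro mult_mono) auto
          then show "1 / r \<le> t / r * len w" using assms by (simp add: divide_right_mono)
        qed simp
        finally have "tent (1 - r * len w) (t / r * len w) (\<theta> - \<psi>) = 0"
          using assms l mult_nonneg_nonneg[of r "len w"] unfolding tent_def by linarith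
        then show ?thesis using kern_nonneg by simp
      qed
    qed
    then show "weight r (len w) / t \<le> (LINT \<theta>|lborel. indicator {\<alpha>..\<beta>} \<theta> * kern r t w \<theta>)"
      using has_integral_tent_weight[of r t "len w" \<psi>] assms l by (auto simp: has_bochner_integral_iff)
  qed
  also have "\<dots> \<le> (\<Sum>w | w \<in> prim \<and> r * len w < 1. LINT \<theta>|lborel. indicator {\<alpha>..\<beta>} \<theta> * kern r t w \<theta>)"
    using assms finite_prim_short
    by (intro sum_mono2 Bochner_Integration.integral_nonneg) (auto simp: prim_def cone_def kern_nonneg)
  also have "\<dots> = (LINT \<theta>|lborel. indicator {\<alpha>..\<beta>} \<theta> * strip_area r t \<theta>)"
    using assms by (intro integral_strip_area_eq[symmetric]) auto
  finally show ?thesis .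
qed

text \<open>Only vectors whose angle is within \<open>\<eta>\<close> of the interval contribute, and since \<open>\<kappa>\<close> bounds the quotient of the sine by
  its argument from below, their strips are at most those for \<open>\<kappa> t\<close> in the linearised form. The interval stays away from the
  vertical directions, so that neither the vertical vector nor the opposite of a vector of the cone is near it.\<close>
lemma strip_integral_le:
  assumes "0 < r" "1 \<le> t" "-(pi / 2) < \<alpha> - \<eta>" "\<beta> + \<eta> < pi / 2" "0 < \<eta>" "\<alpha> \<le> \<beta>" "0 < \<kappa>"
    and small: "pi / 2 * r < \<eta>"
    and sin: "\<And>\<phi>. \<bar>\<phi>\<bar> \<le> pi / 2 * r \<Longrightarrow> \<kappa> * \<bar>\<phi>\<bar> \<le> \<bar>sin \<phi>\<bar>"
  shows "(LINT \<theta>|lborel. indicator {\<alpha>..\<beta>} \<theta> * strip_area r t \<theta>) \<le> prim_cone_sum (tan (\<alpha> - \<eta>)) (tan (\<beta> + \<eta>)) r / (\<kappa> * t)"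
proof -
  let ?C = "{w. w \<in> cone (tan (\<alpha> - \<eta>)) (tan (\<beta> + \<eta>)) \<and> coprime (fst w) (snd w) \<and> r * len w < 1}"
  have near: "\<bar>\<theta> - \<psi>\<bar> \<le> pi / 2 * r"
    if hyp: "\<theta> \<in> {\<alpha>..\<beta>}" "-(pi / 2) \<le> \<psi>" "\<psi> \<le> pi / 2" "\<bar>sin (\<theta> - \<psi>)\<bar> \<le> r" for \<theta> \<psi>
  proof -
    have b: "-pi + \<eta> < \<theta> - \<psi>" "\<theta> - \<psi> < pi - \<eta>" using hyp(1-3) assms by auto
    then obtain k :: int where k: "k \<in> {-1..2}" "\<bar>\<theta> - \<psi> - k * pi\<bar> \<le> pi / 2 * r"
      using near_multiple_of_pi[OF hyp(4)] assms by auto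
    consider "k = -1" | "k = 0" | "k = 1" | "k = 2" using k(1) by fastforce
    then show ?thesis using k(2) b small assms(5) pi_gt_zero by cases (auto simp: abs_le_iff)
  qed
  have far: "kern r t w \<theta> = 0" if "r < \<bar>perp w \<theta>\<bar>" for w \<theta>
  proof -
    have "1 < \<bar>perp w \<theta>\<bar> / r" using that assms by (simp add: field_simps)
    also have "\<dots> \<le> t * \<bar>perp w \<theta>\<bar> / r" using assms by (intro divide_right_mono) (auto simp: mult_le_cancel_right1)
    finally have "1 < t / r * \<bar>perp w \<theta>\<bar>" by simp
    moreover have "0 \<le> r * len w" using assms len_nonneg[of w] by simp
    ultimately show ?thesis unfolding kern_def by linarith
  qed
  have "(LINT \<theta>|lborel. indicator {\<alpha>..\<beta>} \<theta> * strip_area r t \<theta>)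
      = (\<Sum>w | w \<in> prim \<and> r * len w < 1. LINT \<theta>|lborel. indicator {\<alpha>..\<beta>} \<theta> * kern r t w \<theta>)"
    using assms by (intro integral_strip_area_eq) auto
  also have "\<dots> = (\<Sum>w\<in>?C. LINT \<theta>|lborel. indicator {\<alpha>..\<beta>} \<theta> * kern r t w \<theta>)"
  proof (rule sum.mono_neutral_right)
    show "finite {w. w \<in> prim \<and> r * len w < 1}" by (rule finite_prim_short[OF assms(1)])
    show "?C \<subseteq> {w. w \<in> prim \<and> r * len w < 1}" by (auto simp: prim_def cone_def)
    show "\<forall>w\<in>{w. w \<in> prim \<and> r * len w < 1} - ?C. (LINT \<theta>|lborel. indicator {\<alpha>..\<beta>} \<theta> * kern r t w \<theta>) = 0"
    proof
      fix w assume w: "w \<in> {w. w \<in> prim \<and> r * len w < 1} - ?C"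
      have "indicator {\<alpha>..\<beta>} \<theta> * kern r t w \<theta> = 0" for \<theta>
      proof (cases "\<theta> \<in> {\<alpha>..\<beta>}")
        case \<theta>: True
        have "r < \<bar>perp w \<theta>\<bar>"
        proof (rule ccontr)
          assume neg: "\<not> ?thesis"
          show False
          proof (cases "0 < fst w")
            case True
            define \<psi> where "\<psi> = arctan (real_of_int (snd w) / of_int (fst w))"
            have "1 * \<bar>sin (\<theta> - \<psi>)\<bar> \<le> len w * \<bar>sin (\<theta> - \<psi>)\<bar>"
              using w len_ge_1[of w] by (intro mult_right_mono) auto
            also have "\<dots> \<le> r" using neg len_nonneg[of w] unfolding perp_slope[OF True] \<psi>_def[symmetric] by (simp add: abs_mult)
            finally have "\<bar>\<theta> - \<psi>\<bar> \<le> pi / 2 * r"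
              using arctan_bounded[of "real_of_int (snd w) / of_int (fst w)"] by (intro near \<theta>) (auto simp: \<psi>_def)
            then have "\<bar>\<theta> - \<psi>\<bar> < \<eta>" using small by linarith
            then have "\<psi> \<in> {\<alpha> - \<eta>..\<beta> + \<eta>}" using \<theta> by auto
            then have "w \<in> cone (tan (\<alpha> - \<eta>)) (tan (\<beta> + \<eta>))"
              using cone_tan_iff[of "\<alpha> - \<eta>" "\<beta> + \<eta>" w] True assms by (auto simp: \<psi>_def)
            then show False using w by (auto simp: prim_def)
          next
            case False
            then have "w = (0, -1)" using w by (auto simp: prim_def)
            then have "\<bar>sin (\<theta> - pi / 2)\<bar> \<le> r" using neg by (simp add: perp_def sin_diff)
            then have "\<bar>\<theta> - pi / 2\<bar> \<le> pi / 2 * r" by (intro near \<theta>) auto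
            then have "\<bar>\<theta> - pi / 2\<bar> < \<eta>" using small by linarith
            moreover have "\<theta> \<le> \<beta>" using \<theta> by simp
            ultimately show False using assms(4) by linarith
          qed
        qed
        then show ?thesis using far by simp
      qed simp
      then show "(LINT \<theta>|lborel. indicator {\<alpha>..\<beta>} \<theta> * kern r t w \<theta>) = 0"
        by (intro integral_eq_zero_AE AE_I2)
    qed
  qed
  also have "\<dots> \<le> (\<Sum>w\<in>?C. weight r (len w) / (\<kappa> * t))"
  proof (rule sum_mono)
    fix w assume w: "w \<in> ?C"
    then have q: "0 < fst w" by (simp add: cone_def)
    define \<psi> where "\<psi> = arctan (real_of_int (snd w) / of_int (fst w))"
    have l: "1 \<le> len w" using abs_fst_le_len[of w] q by linarith
    have h: "has_bochner_integral lborel (\<lambda>\<theta>. tent (1 - r * len w) (\<kappa> * t / r * len w) (\<theta> - \<psi>)) (weight r (len w) / (\<kappa> * t))"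
      using assms l by (intro has_integral_tent_weight) auto
    have "(LINT \<theta>|lborel. indicator {\<alpha>..\<beta>} \<theta> * kern r t w \<theta>) \<le> (LINT \<theta>|lborel. tent (1 - r * len w) (\<kappa> * t / r * len w) (\<theta> - \<psi>))"
    proof (rule integral_mono)
      show "integrable lborel (\<lambda>\<theta>. tent (1 - r * len w) (\<kappa> * t / r * len w) (\<theta> - \<psi>))"
        using h by (auto simp: has_bochner_integral_iff)
      show "integrable lborel (\<lambda>\<theta>. indicator {\<alpha>..\<beta>} \<theta> * kern r t w \<theta>)"
        using assms by (intro integrable_kern) auto
      fix \<theta> :: real
      show "indicator {\<alpha>..\<beta>} \<theta> * kern r t w \<theta> \<le> tent (1 - r * len w) (\<kappa> * t / r * len w) (\<theta> - \<psi>)"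
      proof (cases "\<theta> \<in> {\<alpha>..\<beta>} \<and> \<bar>perp w \<theta>\<bar> \<le> r")
        case True
        have "1 * \<bar>sin (\<theta> - \<psi>)\<bar> \<le> len w * \<bar>sin (\<theta> - \<psi>)\<bar>"
          using l by (intro mult_right_mono) auto
        also have "\<dots> \<le> r" using True l unfolding perp_slope[OF q] \<psi>_def[symmetric] by (simp add: abs_mult)
        finally have "\<bar>\<theta> - \<psi>\<bar> \<le> pi / 2 * r"
          using arctan_bounded[of "real_of_int (snd w) / of_int (fst w)"] True by (intro near) (auto simp: \<psi>_def)
        then have "\<kappa> * \<bar>\<theta> - \<psi>\<bar> \<le> \<bar>sin (\<theta> - \<psi>)\<bar>" by (rule sin)
        then have "t / r * (len w * (\<kappa> * \<bar>\<theta> - \<psi>\<bar>)) \<le> t / r * (len w * \<bar>sin (\<theta> - \<psi>)\<bar>)"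
          using assms l by (intro mult_left_mono) auto
        also have "len w * \<bar>sin (\<theta> - \<psi>)\<bar> = \<bar>perp w \<theta>\<bar>"
          using l unfolding perp_slope[OF q] \<psi>_def[symmetric] by (simp add: abs_mult)
        finally have "\<kappa> * t / r * len w * \<bar>\<theta> - \<psi>\<bar> \<le> t / r * \<bar>perp w \<theta>\<bar>" by (simp add: mult_ac)
        then show ?thesis using True unfolding tent_def kern_def by (simp add: max.coboundedI2)
      next
        case False
        then have "indicator {\<alpha>..\<beta>} \<theta> * kern r t w \<theta> = 0" using far[of w \<theta>] by (auto simp: indicator_def)
        then show ?thesis unfolding tent_def by linarith
      qed
    qed
    then show "(LINT \<theta>|lborel. indicator {\<alpha>..\<beta>} \<theta> * kern r t w \<theta>) \<le> weight r (len w) / (\<kappa> * t)"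
      using h by (auto simp: has_bochner_integral_iff)
  qed
  also have "\<dots> = prim_cone_sum (tan (\<alpha> - \<eta>)) (tan (\<beta> + \<eta>)) r / (\<kappa> * t)"
    by (simp add: prim_cone_sum_def sum_divide_distrib)
  finally show ?thesis .
qed

lemma sin_ge_near_0:
  assumes "0 < \<eta>"
  shows "\<forall>\<^sub>F r in at_right (0::real). \<forall>\<phi>. \<bar>\<phi>\<bar> \<le> pi / 2 * r \<longrightarrow> (1 - \<eta>) * \<bar>\<phi>\<bar> \<le> \<bar>sin \<phi>\<bar>"
proof -
  have "((\<lambda>h. (sin (0 + h) - sin 0) / h) \<longlongrightarrow> cos 0) (at (0::real))"
    using DERIV_sin[of "0::real"] by (simp add: DERIV_def)
  then have "((\<lambda>h. sin h / h) \<longlongrightarrow> 1) (at (0::real))" by simp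
  then have "\<forall>\<^sub>F h in at (0::real). 1 - \<eta> < sin h / h" using assms by (intro order_tendstoD(1)) auto
  then obtain d where d: "0 < d" "\<And>h::real. h \<noteq> 0 \<Longrightarrow> \<bar>h\<bar> < d \<Longrightarrow> 1 - \<eta> < sin h / h"
    unfolding eventually_at by (auto simp: dist_real_def)
  have main: "(1 - \<eta>) * \<bar>\<phi>\<bar> \<le> \<bar>sin \<phi>\<bar>" if "\<bar>\<phi>\<bar> < d" for \<phi> :: real
  proof (cases "\<phi> = 0")
    case False
    have "1 - \<eta> < \<bar>sin \<phi>\<bar> / \<bar>\<phi>\<bar>" using d(2)[OF False that] abs_ge_self[of "sin \<phi> / \<phi>"] unfolding abs_divide by linarith
    then show ?thesis using False by (simp add: field_simps)
  qed simp
  have "\<forall>\<^sub>F r in at_right (0::real). r < d / pi"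
    using d(1) by (intro eventually_at_rightI[of 0 "d / pi"]) auto
  then show ?thesis
  proof eventually_elim
    case (elim r)
    then have "pi / 2 * r < d" using d(1) pi_gt_zero by (simp add: field_simps)
    then show ?case using main by auto
  qed
qed

text \<open>The two bounds with a fixed \<open>\<eta>\<close>, which tends to 0 after \<open>r\<close>.\<close>
lemma strip_interval_tendsto:
  assumes t: "1 \<le> t" and ab: "-(pi / 2) < \<alpha>" "\<alpha> \<le> \<beta>" "\<beta> < pi / 2"
  shows "((\<lambda>r. LINT \<theta>|lborel. indicator {\<alpha>..\<beta>} \<theta> * strip_area r t \<theta>) \<longlongrightarrow> 2 / (pi\<^sup>2 * t) * (\<beta> - \<alpha>)) (at_right 0)"
proof (rule order_tendstoI)
  fix a assume a: "2 / (pi\<^sup>2 * t) * (\<beta> - \<alpha>) < a"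
  have "((\<lambda>\<eta>. 2 / pi\<^sup>2 * ((\<beta> + \<eta>) - (\<alpha> - \<eta>)) / ((1 - \<eta>) * t)) \<longlongrightarrow> 2 / pi\<^sup>2 * ((\<beta> + 0) - (\<alpha> - 0)) / ((1 - 0) * t)) (at_right 0)"
    using t by (intro tendsto_intros) auto
  then have "((\<lambda>\<eta>. 2 / pi\<^sup>2 * ((\<beta> + \<eta>) - (\<alpha> - \<eta>)) / ((1 - \<eta>) * t)) \<longlongrightarrow> 2 / (pi\<^sup>2 * t) * (\<beta> - \<alpha>)) (at_right 0)"
    by simp
  then have "\<forall>\<^sub>F \<eta> in at_right 0. 2 / pi\<^sup>2 * ((\<beta> + \<eta>) - (\<alpha> - \<eta>)) / ((1 - \<eta>) * t) < a"
    using a by (rule order_tendstoD)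
  moreover have "\<forall>\<^sub>F \<eta> in at_right (0::real). \<eta> < min 1 (min (\<alpha> + pi / 2) (pi / 2 - \<beta>))"
    using ab by (intro eventually_at_rightI[of 0 "min 1 (min (\<alpha> + pi / 2) (pi / 2 - \<beta>))"]) auto
  moreover have "\<forall>\<^sub>F \<eta> :: real in at_right 0. 0 < \<eta>" by (simp add: eventually_at_right_less)
  ultimately have "\<forall>\<^sub>F \<eta> in at_right 0. 0 < \<eta> \<and> \<eta> < min 1 (min (\<alpha> + pi / 2) (pi / 2 - \<beta>))
      \<and> 2 / pi\<^sup>2 * ((\<beta> + \<eta>) - (\<alpha> - \<eta>)) / ((1 - \<eta>) * t) < a" by eventually_elim auto
  from eventually_happens'[OF trivial_limit_at_right_real this]
  obtain \<eta> where h: "0 < \<eta>" "\<eta> < min 1 (min (\<alpha> + pi / 2) (pi / 2 - \<beta>))"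
      "2 / pi\<^sup>2 * ((\<beta> + \<eta>) - (\<alpha> - \<eta>)) / ((1 - \<eta>) * t) < a" by blast
  then have \<eta>: "0 < \<eta>" "\<eta> < 1" "-(pi / 2) < \<alpha> - \<eta>" "\<beta> + \<eta> < pi / 2"
      "2 / pi\<^sup>2 * ((\<beta> + \<eta>) - (\<alpha> - \<eta>)) / ((1 - \<eta>) * t) < a" by linarith+
  have le: "tan (\<alpha> - \<eta>) \<le> tan (\<beta> + \<eta>)" using \<eta> ab by (intro tan_mono_le) auto
  have "((\<lambda>r. prim_cone_sum (tan (\<alpha> - \<eta>)) (tan (\<beta> + \<eta>)) r / ((1 - \<eta>) * t)) \<longlongrightarrow>
      2 / pi\<^sup>2 * (arctan (tan (\<beta> + \<eta>)) - arctan (tan (\<alpha> - \<eta>))) / ((1 - \<eta>) * t)) (at_right 0)"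
    using t \<eta> by (intro tendsto_divide prim_cone_sum_tendsto le tendsto_const) auto
  moreover have "arctan (tan (\<beta> + \<eta>)) = \<beta> + \<eta>" "arctan (tan (\<alpha> - \<eta>)) = \<alpha> - \<eta>"
    using \<eta> ab by (intro arctan_tan; simp)+
  ultimately have "\<forall>\<^sub>F r in at_right 0. prim_cone_sum (tan (\<alpha> - \<eta>)) (tan (\<beta> + \<eta>)) r / ((1 - \<eta>) * t) < a"
    using \<eta>(5) by (intro order_tendstoD(2)) simp_all
  moreover have "\<forall>\<^sub>F r in at_right (0::real). \<forall>\<phi>. \<bar>\<phi>\<bar> \<le> pi / 2 * r \<longrightarrow> (1 - \<eta>) * \<bar>\<phi>\<bar> \<le> \<bar>sin \<phi>\<bar>"
    by (rule sin_ge_near_0[OF \<eta>(1)])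
  moreover have "\<forall>\<^sub>F r in at_right (0::real). r < 2 * \<eta> / pi"
    using \<eta> by (intro eventually_at_rightI[of 0 "2 * \<eta> / pi"]) auto
  moreover have "\<forall>\<^sub>F r :: real in at_right 0. 0 < r" by (simp add: eventually_at_right_less)
  ultimately show "\<forall>\<^sub>F r in at_right 0. (LINT \<theta>|lborel. indicator {\<alpha>..\<beta>} \<theta> * strip_area r t \<theta>) < a"
  proof eventually_elim
    case (elim r)
    have "pi / 2 * r < \<eta>" using elim pi_gt_zero by (simp add: field_simps)
    then have "(LINT \<theta>|lborel. indicator {\<alpha>..\<beta>} \<theta> * strip_area r t \<theta>) \<le> prim_cone_sum (tan (\<alpha> - \<eta>)) (tan (\<beta> + \<eta>)) r / ((1 - \<eta>) * t)"
      using elim \<eta> ab t by (intro strip_integral_le) auto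
    then show ?case using elim by linarith
  qed
next
  fix a assume a: "a < 2 / (pi\<^sup>2 * t) * (\<beta> - \<alpha>)"
  have nonneg: "0 \<le> (LINT \<theta>|lborel. indicator {\<alpha>..\<beta>} \<theta> * strip_area r t \<theta>)" for r
    by (intro Bochner_Integration.integral_nonneg) (simp add: strip_area_nonneg)
  show "\<forall>\<^sub>F r in at_right 0. a < (LINT \<theta>|lborel. indicator {\<alpha>..\<beta>} \<theta> * strip_area r t \<theta>)"
  proof (cases "\<alpha> = \<beta>")
    case True
    then have "a < 0" using a by simp
    then show ?thesis using nonneg by (intro always_eventually allI) (meson less_le_trans)
  next
    case False
    have "((\<lambda>\<eta>. 2 / pi\<^sup>2 * ((\<beta> - \<eta>) - (\<alpha> + \<eta>)) / t) \<longlongrightarrow> 2 / pi\<^sup>2 * ((\<beta> - 0) - (\<alpha> + 0)) / t) (at_right 0)"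
      using t by (intro tendsto_intros) auto
    then have "((\<lambda>\<eta>. 2 / pi\<^sup>2 * ((\<beta> - \<eta>) - (\<alpha> + \<eta>)) / t) \<longlongrightarrow> 2 / (pi\<^sup>2 * t) * (\<beta> - \<alpha>)) (at_right 0)"
      by simp
    then have "\<forall>\<^sub>F \<eta> in at_right 0. a < 2 / pi\<^sup>2 * ((\<beta> - \<eta>) - (\<alpha> + \<eta>)) / t"
      using a by (rule order_tendstoD)
    moreover have "\<forall>\<^sub>F \<eta> in at_right (0::real). \<eta> < (\<beta> - \<alpha>) / 2"
      using ab False by (intro eventually_at_rightI[of 0 "(\<beta> - \<alpha>) / 2"]) auto
    moreover have "\<forall>\<^sub>F \<eta> :: real in at_right 0. 0 < \<eta>" by (simp add: eventually_at_right_less)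
    ultimately have "\<forall>\<^sub>F \<eta> in at_right 0. 0 < \<eta> \<and> \<eta> < (\<beta> - \<alpha>) / 2
        \<and> a < 2 / pi\<^sup>2 * ((\<beta> - \<eta>) - (\<alpha> + \<eta>)) / t" by eventually_elim auto
    from eventually_happens'[OF trivial_limit_at_right_real this]
    obtain \<eta> where \<eta>: "0 < \<eta>" "\<eta> < (\<beta> - \<alpha>) / 2" "a < 2 / pi\<^sup>2 * ((\<beta> - \<eta>) - (\<alpha> + \<eta>)) / t" by blast
    have le: "tan (\<alpha> + \<eta>) \<le> tan (\<beta> - \<eta>)" using \<eta> ab by (intro tan_mono_le) auto
    have "((\<lambda>r. prim_cone_sum (tan (\<alpha> + \<eta>)) (tan (\<beta> - \<eta>)) r / t) \<longlongrightarrow>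
        2 / pi\<^sup>2 * (arctan (tan (\<beta> - \<eta>)) - arctan (tan (\<alpha> + \<eta>))) / t) (at_right 0)"
      using t \<eta> by (intro tendsto_divide prim_cone_sum_tendsto le tendsto_const) auto
    moreover have "arctan (tan (\<beta> - \<eta>)) = \<beta> - \<eta>" "arctan (tan (\<alpha> + \<eta>)) = \<alpha> + \<eta>"
      using \<eta> ab by (intro arctan_tan; simp)+
    ultimately have "\<forall>\<^sub>F r in at_right 0. a < prim_cone_sum (tan (\<alpha> + \<eta>)) (tan (\<beta> - \<eta>)) r / t"
      using \<eta>(3) by (intro order_tendstoD(1)) simp_all
    moreover have "\<forall>\<^sub>F r in at_right (0::real). r < \<eta>"
      using \<eta> by (intro eventually_at_rightI[of 0 "\<eta>"]) auto
    moreover have "\<forall>\<^sub>F r :: real in at_right 0. 0 < r" by (simp add: eventually_at_right_less)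
    ultimately show ?thesis
    proof eventually_elim
      case (elim r)
      have "prim_cone_sum (tan (\<alpha> + \<eta>)) (tan (\<beta> - \<eta>)) r / t \<le> (LINT \<theta>|lborel. indicator {\<alpha>..\<beta>} \<theta> * strip_area r t \<theta>)"
        using elim \<eta> ab t by (intro strip_integral_ge) auto
      then show ?case using elim by linarith
    qed
  qed
qed

section \<open>Strips against integrable densities\<close>

lemma strip_area_measurable [measurable]: "strip_area r t \<in> borel_measurable borel"
  unfolding strip_area_def by measurable

text \<open>The strip areas, tested against \<open>f\<close>, behave like the constant \<open>2 / (\<pi>\<^sup>2 t)\<close>.\<close>
definition strip_limit :: "real \<Rightarrow> (real \<Rightarrow> real) \<Rightarrow> bool" where
  "strip_limit t f \<longleftrightarrow> integrable lborel f \<and>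
     ((\<lambda>r. LINT \<theta>|lborel. f \<theta> * strip_area r t \<theta>) \<longlongrightarrow> 2 / (pi\<^sup>2 * t) * (LINT \<theta>|lborel. f \<theta>)) (at_right 0)"

lemma integrable_times_strip_area:
  assumes "integrable lborel f" "0 < r" "1 \<le> t"
  shows "integrable lborel (\<lambda>\<theta>. f \<theta> * strip_area r t \<theta>)"
proof (rule Bochner_Integration.integrable_bound[OF assms(1)])
  show "(\<lambda>\<theta>. f \<theta> * strip_area r t \<theta>) \<in> borel_measurable lborel"
    using assms(1) by (intro borel_measurable_times) auto
  show "AE \<theta> in lborel. norm (f \<theta> * strip_area r t \<theta>) \<le> norm (f \<theta>)"
    using assms by (intro AE_I2) (simp add: abs_mult strip_area_nonneg strip_area_le_1 mult_left_le)
qed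

lemma strip_limit_add:
  assumes "1 \<le> t" "strip_limit t f" "strip_limit t g"
  shows "strip_limit t (\<lambda>\<theta>. f \<theta> + g \<theta>)"
proof -
  have i: "integrable lborel f" "integrable lborel g" using assms by (auto simp: strip_limit_def)
  have "((\<lambda>r. (LINT \<theta>|lborel. f \<theta> * strip_area r t \<theta>) + (LINT \<theta>|lborel. g \<theta> * strip_area r t \<theta>))
      \<longlongrightarrow> 2 / (pi\<^sup>2 * t) * (LINT \<theta>|lborel. f \<theta>) + 2 / (pi\<^sup>2 * t) * (LINT \<theta>|lborel. g \<theta>)) (at_right 0)"
    using assms by (intro tendsto_add) (auto simp: strip_limit_def)
  moreover have "\<forall>\<^sub>F r :: real in at_right 0. 0 < r" by (simp add: eventually_at_right_less)
  then have "\<forall>\<^sub>F r in at_right 0. (LINT \<theta>|lborel. f \<theta> * strip_area r t \<theta>) + (LINT \<theta>|lborel. g \<theta> * strip_area r t \<theta>)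
      = (LINT \<theta>|lborel. (f \<theta> + g \<theta>) * strip_area r t \<theta>)"
    by eventually_elim (simp add: distrib_right integrable_times_strip_area i assms(1))
  ultimately have "((\<lambda>r. LINT \<theta>|lborel. (f \<theta> + g \<theta>) * strip_area r t \<theta>)
      \<longlongrightarrow> 2 / (pi\<^sup>2 * t) * (LINT \<theta>|lborel. f \<theta>) + 2 / (pi\<^sup>2 * t) * (LINT \<theta>|lborel. g \<theta>)) (at_right 0)"
    by (rule Lim_transform_eventually)
  then show ?thesis using i by (simp add: strip_limit_def distrib_left)
qed

lemma strip_limit_cmult:
  assumes "strip_limit t f"
  shows "strip_limit t (\<lambda>\<theta>. c * f \<theta>)"
proof -
  have "((\<lambda>r. c * (LINT \<theta>|lborel. f \<theta> * strip_area r t \<theta>)) \<longlongrightarrow> c * (2 / (pi\<^sup>2 * t) * (LINT \<theta>|lborel. f \<theta>))) (at_right 0)"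
    using assms by (intro tendsto_mult tendsto_const) (auto simp: strip_limit_def)
  then show ?thesis using assms by (simp add: strip_limit_def mult.assoc mult.left_commute)
qed

lemma strip_limit_0: "strip_limit t (\<lambda>\<theta>. 0)"
  by (simp add: strip_limit_def)

lemma strip_limit_sum:
  assumes "1 \<le> t" "finite A" "\<And>i. i \<in> A \<Longrightarrow> strip_limit t (f i)"
  shows "strip_limit t (\<lambda>\<theta>. \<Sum>i\<in>A. f i \<theta>)"
  using assms(2,3) by (induction A rule: finite_induct) (auto intro!: strip_limit_0 strip_limit_add assms(1))

text \<open>As \<open>0 \<le> strip_area \<le> 1\<close>, the tested values for \<open>f n\<close> and \<open>g\<close> differ, uniformly in \<open>r\<close>, by at most the distance of
  \<open>f n\<close> and \<open>g\<close> in the mean, which tends to 0 by dominated convergence.\<close>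
lemma strip_limit_dominated:
  assumes t: "1 \<le> t" and f: "\<And>n. strip_limit t (f n)"
    and lim: "AE \<theta> in lborel. (\<lambda>n. f n \<theta>) \<longlonglongrightarrow> g \<theta>"
    and bound: "\<And>n. AE \<theta> in lborel. norm (f n \<theta>) \<le> w \<theta>" and w: "integrable lborel w"
    and g: "g \<in> borel_measurable lborel"
  shows "strip_limit t g"
proof -
  have i: "integrable lborel (f n)" for n using f[of n] by (simp add: strip_limit_def)
  have fm: "f n \<in> borel_measurable lborel" for n using i[of n] by (rule borel_measurable_integrable)
  have gi: "integrable lborel g"
    by (rule integrable_dominated_convergence[OF g fm w lim bound])
  define I where "I f r = (LINT \<theta>|lborel. f \<theta> * strip_area r t \<theta>)" for f r
  define J where "J f = 2 / (pi\<^sup>2 * t) * (LINT \<theta>|lborel. f \<theta>)" for f :: "real \<Rightarrow> real"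
  define e where "e n = (LINT \<theta>|lborel. \<bar>f n \<theta> - g \<theta>\<bar>)" for n
  have ei: "integrable lborel (\<lambda>\<theta>. \<bar>f n \<theta> - g \<theta>\<bar>)" for n using i gi by auto
  have "(\<lambda>n. LINT \<theta>|lborel. \<bar>f n \<theta> - g \<theta>\<bar>) \<longlonglongrightarrow> (LINT \<theta>|(lborel :: real measure). (0 :: real))"
  proof (rule integral_dominated_convergence[where w = "\<lambda>\<theta>. w \<theta> + \<bar>g \<theta>\<bar>"])
    show "AE \<theta> in lborel. (\<lambda>n. \<bar>f n \<theta> - g \<theta>\<bar>) \<longlonglongrightarrow> 0"
      using lim
    proof eventually_elim
      case (elim \<theta>)
      then have "(\<lambda>n. f n \<theta> - g \<theta>) \<longlonglongrightarrow> 0" by (simp add: LIM_zero_iff)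
      then show ?case by (rule tendsto_rabs_zero)
    qed
    show "AE \<theta> in lborel. norm \<bar>f n \<theta> - g \<theta>\<bar> \<le> w \<theta> + \<bar>g \<theta>\<bar>" for n
      using bound[of n] by eventually_elim auto
  qed (use ei gi w in auto)
  then have e: "e \<longlonglongrightarrow> 0" unfolding e_def by simp
  have diff: "\<bar>I (f n) r - I g r\<bar> \<le> e n" if "0 < r" for n r
  proof -
    have fg: "integrable lborel (\<lambda>\<theta>. f n \<theta> - g \<theta>)" using i gi by auto
    have "I (f n) r - I g r = (LINT \<theta>|lborel. (f n \<theta> - g \<theta>) * strip_area r t \<theta>)"
      unfolding I_def left_diff_distrib
      by (intro Bochner_Integration.integral_diff[symmetric] integrable_times_strip_area i gi that t)
    also have "\<bar>\<dots>\<bar> \<le> (LINT \<theta>|lborel. \<bar>(f n \<theta> - g \<theta>) * strip_area r t \<theta>\<bar>)"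
      by (rule integral_abs_bound)
    also have "\<dots> \<le> e n" unfolding e_def
    proof (rule integral_mono[OF _ ei])
      show "integrable lborel (\<lambda>\<theta>. \<bar>(f n \<theta> - g \<theta>) * strip_area r t \<theta>\<bar>)"
        by (intro integrable_abs integrable_times_strip_area fg that t)
      show "\<bar>(f n \<theta> - g \<theta>) * strip_area r t \<theta>\<bar> \<le> \<bar>f n \<theta> - g \<theta>\<bar>" for \<theta>
        using t that by (simp add: abs_mult strip_area_nonneg strip_area_le_1 mult_left_le)
    qed
    finally show ?thesis .
  qed
  have Jlim: "(\<lambda>n. J (f n)) \<longlonglongrightarrow> J g"
    unfolding J_def by (intro tendsto_mult tendsto_const integral_dominated_convergence[OF g fm w lim bound])
  have "(I g \<longlongrightarrow> J g) (at_right 0)"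
  proof (rule tendstoI)
    fix x :: real assume x: "0 < x"
    have "\<forall>\<^sub>F n in sequentially. e n < x / 3" using e x by (intro order_tendstoD(2)) auto
    moreover have "\<forall>\<^sub>F n in sequentially. dist (J (f n)) (J g) < x / 3"
      using tendstoD[OF Jlim, of "x / 3"] x by simp
    ultimately have "\<forall>\<^sub>F n in sequentially. e n < x / 3 \<and> dist (J (f n)) (J g) < x / 3"
      by eventually_elim auto
    then obtain n where n: "e n < x / 3" "dist (J (f n)) (J g) < x / 3"
      by (auto simp: eventually_sequentially)
    have "(I (f n) \<longlongrightarrow> J (f n)) (at_right 0)"
      using f[of n] by (simp add: strip_limit_def I_def[abs_def] J_def)
    then have "\<forall>\<^sub>F r in at_right 0. dist (I (f n) r) (J (f n)) < x / 3" using x by (intro tendstoD) auto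
    moreover have "\<forall>\<^sub>F r :: real in at_right 0. 0 < r" by (simp add: eventually_at_right_less)
    ultimately show "\<forall>\<^sub>F r in at_right 0. dist (I g r) (J g) < x"
    proof eventually_elim
      case (elim r)
      have "\<bar>I (f n) r - I g r\<bar> < x / 3" using diff[OF elim(2), of n] n by linarith
      then show ?case using elim n unfolding dist_real_def by linarith
    qed
  qed
  then show ?thesis using gi by (simp add: strip_limit_def I_def[abs_def] J_def)
qed

lemma strip_limit_Icc:
  assumes "1 \<le> t" "-(pi / 2) < \<alpha>" "\<alpha> \<le> \<beta>" "\<beta> < pi / 2"
  shows "strip_limit t (indicator {\<alpha>..\<beta>})"
  using strip_interval_tendsto[OF assms] assms(3) by (simp add: strip_limit_def)

text \<open>The Borel sets with this property form a Dynkin system, and closed intervals belong to it. Intersecting with a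
  compact interval of directions keeps everything integrable and away from the vertical.\<close>
lemma strip_limit_borel_Int:
  fixes A :: "real set"
  assumes t: "1 \<le> t" and ab: "-(pi / 2) < \<alpha>" "\<alpha> \<le> \<beta>" "\<beta> < pi / 2" and A: "A \<in> sets borel"
  shows "strip_limit t (indicator (A \<inter> {\<alpha>..\<beta>}))"
proof -
  let ?J = "{\<alpha>..\<beta>}"
  let ?G = "range (\<lambda>(a, b). {a..b}) :: real set set"
  have J: "strip_limit t (indicator ?J)" by (rule strip_limit_Icc[OF t ab])
  then have Ji: "integrable lborel (indicator ?J :: real \<Rightarrow> real)" by (simp add: strip_limit_def)
  have borel: "sets borel = sigma_sets UNIV ?G"
    by (simp add: borel_eq_atLeastAtMost[where 'a = real])
  have "Int_stable ?G"
    by (auto simp: Int_stable_def)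
  moreover have "?G \<subseteq> Pow UNIV" by simp
  moreover have "A \<in> sigma_sets UNIV ?G" using A borel by simp
  ultimately show ?thesis
  proof (induction A rule: sigma_sets_induct_disjoint)
    case (basic A)
    then obtain a b where "A = {a..b}" by auto
    then have eq: "A \<inter> ?J = {max a \<alpha>..min b \<beta>}" by auto
    show ?case
    proof (cases "max a \<alpha> \<le> min b \<beta>")
      case True
      then show ?thesis unfolding eq using ab by (intro strip_limit_Icc t) auto
    next
      case False
      then have "A \<inter> ?J = {}" unfolding eq by simp
      then show ?thesis using strip_limit_0 by simp
    qed
  next
    case empty
    then show ?case using strip_limit_0 by simp
  next
    case (compl A)
    have "strip_limit t (\<lambda>\<theta>. indicator ?J \<theta> + (-1) * indicator (A \<inter> ?J) \<theta>)"
      by (intro strip_limit_add[OF t] strip_limit_cmult J compl)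
    moreover have "(\<lambda>\<theta>. indicator ?J \<theta> + (-1) * indicator (A \<inter> ?J) \<theta>) = (indicator ((UNIV - A) \<inter> ?J) :: real \<Rightarrow> real)"
      by (auto simp: indicator_def)
    ultimately show ?case by simp
  next
    case (union A)
    have Am: "A i \<in> sets borel" for i using union(2) borel by auto
    have eq: "(\<Sum>i<n. indicator (A i \<inter> ?J) \<theta>) = (indicator ((\<Union>i<n. A i) \<inter> ?J) \<theta> :: real)" for n \<theta>
    proof -
      have "disjoint_family_on (\<lambda>i. A i \<inter> ?J) {..<n}"
        using union(1) by (auto simp: disjoint_family_on_def)
      then have "(\<Sum>i<n. indicator (A i \<inter> ?J) \<theta>) = (indicator (\<Union>i<n. A i \<inter> ?J) \<theta> :: real)"
        by (subst indicator_UN_disjoint) auto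
      also have "(\<Union>i<n. A i \<inter> ?J) = (\<Union>i<n. A i) \<inter> ?J" by auto
      finally show ?thesis .
    qed
    show ?case
    proof (rule strip_limit_dominated[where f = "\<lambda>n \<theta>. \<Sum>i<n. indicator (A i \<inter> ?J) \<theta>" and w = "indicator ?J"])
      show "strip_limit t (\<lambda>\<theta>. \<Sum>i<n. indicator (A i \<inter> ?J) \<theta>)" for n
        by (intro strip_limit_sum t union) auto
      show "AE \<theta> in lborel. (\<lambda>n. \<Sum>i<n. indicator (A i \<inter> ?J) \<theta>) \<longlonglongrightarrow> (indicator (\<Union>(range A) \<inter> ?J) \<theta> :: real)"
      proof (rule AE_I2)
        fix \<theta> :: real
        have "\<forall>\<^sub>F n in sequentially. (\<Sum>i<n. indicator (A i \<inter> ?J) \<theta>) = (indicator (\<Union>(range A) \<inter> ?J) \<theta> :: real)"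
        proof (cases "\<exists>i. \<theta> \<in> A i")
          case True
          then obtain i where i: "\<theta> \<in> A i" by blast
          show ?thesis unfolding eq eventually_sequentially
            using i by (intro exI[of _ "Suc i"]) (auto simp: indicator_def Suc_le_eq)
        next
          case False
          then show ?thesis unfolding eq by (auto simp: indicator_def)
        qed
        then show "(\<lambda>n. \<Sum>i<n. indicator (A i \<inter> ?J) \<theta>) \<longlonglongrightarrow> (indicator (\<Union>(range A) \<inter> ?J) \<theta> :: real)"
          by (rule tendsto_eventually)
      qed
      show "AE \<theta> in lborel. norm (\<Sum>i<n. indicator (A i \<inter> ?J) \<theta> :: real) \<le> indicator ?J \<theta>" for n
        unfolding eq by (intro AE_I2) (auto simp: indicator_def)
      show "indicator (\<Union>(range A) \<inter> ?J) \<in> borel_measurable lborel"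
        using Am by (intro borel_measurable_indicator) auto
    qed (use t Ji in auto)
  qed
qed

lemma strip_limit_compact:
  assumes t: "1 \<le> t" and ab: "-(pi / 2) < \<alpha>" "\<alpha> \<le> \<beta>" "\<beta> < pi / 2" and f: "integrable lborel f"
  shows "strip_limit t (\<lambda>\<theta>. indicator {\<alpha>..\<beta>} \<theta> * f \<theta>)"
  using f
proof (induction rule: integrable_induct)
  case (base A c)
  have "strip_limit t (\<lambda>\<theta>. c * indicator (A \<inter> {\<alpha>..\<beta>}) \<theta>)"
    using base by (intro strip_limit_cmult strip_limit_borel_Int[OF t ab]) auto
  moreover have "(\<lambda>\<theta>. c * indicator (A \<inter> {\<alpha>..\<beta>}) \<theta>) = (\<lambda>\<theta>. indicator {\<alpha>..\<beta>} \<theta> * (indicator A \<theta> *\<^sub>R c))"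
    by (auto simp: indicator_def)
  ultimately show ?case by simp
next
  case (add f g)
  show ?case unfolding distrib_left by (intro strip_limit_add t add)
next
  case (lim f s)
  show ?case
  proof (rule strip_limit_dominated[where f = "\<lambda>n \<theta>. indicator {\<alpha>..\<beta>} \<theta> * s n \<theta>" and w = "\<lambda>\<theta>. 2 * norm (f \<theta>)"])
    show "AE \<theta> in lborel. (\<lambda>n. indicator {\<alpha>..\<beta>} \<theta> * s n \<theta>) \<longlonglongrightarrow> indicator {\<alpha>..\<beta>} \<theta> * f \<theta>"
      using lim by (intro AE_I2 tendsto_intros) auto
    show "AE \<theta> in lborel. norm (indicator {\<alpha>..\<beta>} \<theta> * s n \<theta>) \<le> 2 * norm (f \<theta>)" for n
      using lim by (intro AE_I2) (auto simp: indicator_def)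
    show "integrable lborel (\<lambda>\<theta>. 2 * norm (f \<theta>))" using lim by auto
    show "(\<lambda>\<theta>. indicator {\<alpha>..\<beta>} \<theta> * f \<theta>) \<in> borel_measurable lborel"
      using lim by (intro borel_measurable_times) auto
  qed (use t lim in auto)
qed

lemma strip_limit_half_circle:
  assumes t: "1 \<le> t" and f: "integrable lborel f"
  shows "strip_limit t (\<lambda>\<theta>. indicator {-(pi / 2)..pi / 2} \<theta> * f \<theta>)"
proof (rule strip_limit_dominated[where f = "\<lambda>n \<theta>. indicator {-(pi / 2) + 1 / real (Suc n)..pi / 2 - 1 / real (Suc n)} \<theta> * f \<theta>" and w = "\<lambda>\<theta>. norm (f \<theta>)"])
  show "strip_limit t (\<lambda>\<theta>. indicator {-(pi / 2) + 1 / real (Suc n)..pi / 2 - 1 / real (Suc n)} \<theta> * f \<theta>)" for n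
  proof (rule strip_limit_compact[OF t _ _ _ f])
    have "1 / real (Suc n) \<le> 1" by simp
    then show "-(pi / 2) + 1 / real (Suc n) \<le> pi / 2 - 1 / real (Suc n)"
      using pi_ge_two by linarith
  qed auto
  show "AE \<theta> in lborel. (\<lambda>n. indicator {-(pi / 2) + 1 / real (Suc n)..pi / 2 - 1 / real (Suc n)} \<theta> * f \<theta>)
      \<longlonglongrightarrow> indicator {-(pi / 2)..pi / 2} \<theta> * f \<theta>"
    using AE_lborel_singleton[of "-(pi / 2)"] AE_lborel_singleton[of "pi / 2"]
  proof eventually_elim
    case (elim \<theta>)
    have z: "(\<lambda>n. 1 / real (Suc n)) \<longlonglongrightarrow> 0" by (rule LIMSEQ_Suc[OF lim_1_over_n])
    have "\<forall>\<^sub>F n in sequentially. indicator {-(pi / 2) + 1 / real (Suc n)..pi / 2 - 1 / real (Suc n)} \<theta>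
        = (indicator {-(pi / 2)..pi / 2} \<theta> :: real)"
    proof (cases "\<theta> \<in> {-(pi / 2)..pi / 2}")
      case True
      then have "0 < min (\<theta> + pi / 2) (pi / 2 - \<theta>)" using elim by auto
      from order_tendstoD(2)[OF z this] show ?thesis
        by eventually_elim (use True in \<open>auto simp: indicator_def\<close>)
    next
      case False
      have "\<theta> \<notin> {-(pi / 2) + 1 / real (Suc n)..pi / 2 - 1 / real (Suc n)}" for n
      proof -
        have "0 < 1 / real (Suc n)" by simp
        then show ?thesis using False by (simp only: atLeastAtMost_iff) linarith
      qed
      then show ?thesis using False by simp
    qed
    then have "(\<lambda>n. indicator {-(pi / 2) + 1 / real (Suc n)..pi / 2 - 1 / real (Suc n)} \<theta> :: real) \<longlonglongrightarrow> indicator {-(pi / 2)..pi / 2} \<theta>"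
      by (rule tendsto_eventually)
    then show ?case by (intro tendsto_intros)
  qed
  show "AE \<theta> in lborel. norm (indicator {-(pi / 2) + 1 / real (Suc n)..pi / 2 - 1 / real (Suc n)} \<theta> * f \<theta>) \<le> norm (f \<theta>)" for n
    by (intro AE_I2) (simp add: indicator_def)
  show "(\<lambda>\<theta>. indicator {-(pi / 2)..pi / 2} \<theta> * f \<theta>) \<in> borel_measurable lborel"
    using f by (intro borel_measurable_times) auto
qed (use t f in auto)

lemma strip_area_shift_pi: "strip_area r t (\<theta> + pi) = strip_area r t \<theta>"
proof -
  have "perp w (\<theta> + pi) = - perp w \<theta>" for w by (simp add: perp_def)
  then show ?thesis by (simp add: strip_area_def kern_def)
qed

lemma strip_limit_shift:
  assumes "strip_limit t f"
  shows "strip_limit t (\<lambda>\<theta>. f (\<theta> - pi))"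
proof -
  have sh: "(LINT \<theta>|lborel. g (\<theta> - pi)) = (LINT \<theta>|lborel. g \<theta>)" for g :: "real \<Rightarrow> real"
    using lborel_integral_real_affine[of 1 g "- pi"] by simp
  have "(LINT \<theta>|lborel. f (\<theta> - pi) * strip_area r t \<theta>) = (LINT \<theta>|lborel. f \<theta> * strip_area r t \<theta>)" for r
    using sh[of "\<lambda>\<theta>. f \<theta> * strip_area r t (\<theta> + pi)"] by (simp add: strip_area_shift_pi)
  moreover have "integrable lborel (\<lambda>\<theta>. f (\<theta> - pi))"
    using assms lborel_integrable_real_affine[of f 1 "- pi"] by (simp add: strip_limit_def)
  ultimately show ?thesis using assms by (simp add: strip_limit_def sh)
qed

text \<open>A density on the full circle is cut into three pieces, each of which is moved into the half circle around 0 by a multiple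
  of the period \<open>\<pi>\<close> of the strip area.\<close>
lemma strip_limit_circle:
  assumes t: "1 \<le> t" and f: "integrable lborel f" and supp: "\<And>\<theta>. \<theta> \<notin> {0..<2*pi} \<Longrightarrow> f \<theta> = 0"
  shows "strip_limit t f"
proof -
  let ?I = "indicator {-(pi / 2)..pi / 2} :: real \<Rightarrow> real"
  have int: "integrable lborel (\<lambda>\<theta>. f (\<theta> + c))" for c
    using f lborel_integrable_real_affine[of f 1 c] by (simp add: add.commute)
  have 0: "strip_limit t (\<lambda>\<theta>. ?I \<theta> * f \<theta>)" by (rule strip_limit_half_circle[OF t f])
  have 1: "strip_limit t (\<lambda>\<theta>. ?I (\<theta> - pi) * f \<theta>)"
    using strip_limit_shift[OF strip_limit_half_circle[OF t int[of pi]]] by simp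
  have 2: "strip_limit t (\<lambda>\<theta>. ?I (\<theta> - pi - pi) * f \<theta>)"
    using strip_limit_shift[OF strip_limit_shift[OF strip_limit_half_circle[OF t int[of "2 * pi"]]]]
    by (simp add: add.commute)
  have "strip_limit t (\<lambda>\<theta>. (?I \<theta> * f \<theta> + ?I (\<theta> - pi) * f \<theta>) + ?I (\<theta> - pi - pi) * f \<theta>)" (is "strip_limit t ?g")
    by (intro strip_limit_add[OF t] 0 1 2)
  show ?thesis
  proof (rule strip_limit_dominated[where f = "\<lambda>n. ?g" and w = "\<lambda>\<theta>. norm (?g \<theta>)"])
    show "AE \<theta> in lborel. (\<lambda>n. ?g \<theta>) \<longlonglongrightarrow> f \<theta>"
      using AE_lborel_singleton[of "pi / 2"] AE_lborel_singleton[of "3 * pi / 2"]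
    proof eventually_elim
      case (elim \<theta>)
      have "?g \<theta> = f \<theta>"
      proof (cases "\<theta> \<in> {0..<2*pi}")
        case True
        consider "\<theta> < pi / 2" | "pi / 2 < \<theta>" "\<theta> < 3 * pi / 2" | "3 * pi / 2 < \<theta>" using elim by linarith
        then show ?thesis using True by cases (auto simp: indicator_def)
      qed (simp add: supp)
      then show ?case by simp
    qed
    show "integrable lborel (\<lambda>\<theta>. norm (?g \<theta>))"
      using \<open>strip_limit t ?g\<close> by (intro integrable_norm) (simp add: strip_limit_def)
  qed (use \<open>strip_limit t ?g\<close> t f in auto)
qed

section \<open>Coordinates on the punctured torus and on the circle\<close>

definition vec2 :: "real \<times> real \<Rightarrow> real^2" where
  "vec2 z = vector [fst z, snd z]"

abbreviation dir :: "real \<Rightarrow> real^2" where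
  "dir \<theta> \<equiv> vector [cos \<theta>, sin \<theta>]"

lemma vec2_nth [simp]: "vec2 z $ 1 = fst z" "vec2 z $ 2 = snd z"
  by (simp_all add: vec2_def)

lemma continuous_on_vec2: "continuous_on UNIV vec2"
proof -
  have "vec2 = (\<lambda>z. \<chi> i. if i = 1 then fst z else snd z)"
    by (auto simp: vec_eq_iff forall_2 vec2_def)
  moreover have "continuous_on UNIV (\<lambda>z::real\<times>real. \<chi> i::2. if i = 1 then fst z else snd z)"
  proof (rule continuous_on_vec_lambda)
    fix i :: 2
    show "continuous_on UNIV (\<lambda>z::real\<times>real. if i = 1 then fst z else snd z)"
      by (cases "i = 1") (auto intro: continuous_intros)
  qed
  ultimately show ?thesis by (simp only:)
qed

lemma vec2_measurable [measurable]: "vec2 \<in> borel_measurable borel"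
  by (rule borel_measurable_continuous_onI[OF continuous_on_vec2])

lemma lborel_eq_distr_vec2: "lborel = distr lborel borel vec2"
proof (rule lborel_eqI)
  fix l u :: "real^2"
  assume le: "\<And>b. b \<in> Basis \<Longrightarrow> l \<bullet> b \<le> u \<bullet> b"
  have le': "l $ i \<le> u $ i" for i
    using le[of "axis i 1"] by (simp add: inner_axis axis_in_Basis_iff)
  have "emeasure (distr lborel borel vec2) (box l u) = emeasure lborel (vec2 -` box l u)"
    by (subst emeasure_distr) auto
  also have "vec2 -` box l u = {l $ 1<..<u $ 1} \<times> {l $ 2<..<u $ 2}"
    by (auto simp: mem_box_cart forall_2 mem_Times_iff)
  also have "emeasure lborel \<dots> = ennreal (u $ 1 - l $ 1) * ennreal (u $ 2 - l $ 2)"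
    using le' by (subst lborel_prod[symmetric], subst lborel.emeasure_pair_measure_Times) auto
  also have "\<dots> = ennreal ((u $ 1 - l $ 1) * (u $ 2 - l $ 2))"
    using le' by (intro ennreal_mult[symmetric]) auto
  also have "(u $ 1 - l $ 1) * (u $ 2 - l $ 2) = prod ((\<bullet>) (u - l)) Basis"
  proof -
    have B: "(Basis :: (real^2) set) = range (\<lambda>i. axis i 1)" by (auto simp: Basis_vec_def)
    have I: "inj (\<lambda>i::2. axis i (1::real))" by (auto simp: inj_def axis_eq_axis)
    have "prod ((\<bullet>) (u - l)) Basis = prod ((\<bullet>) (u - l) \<circ> (\<lambda>i. axis i 1)) UNIV"
      unfolding B by (rule prod.reindex[OF I])
    then show ?thesis by (simp add: UNIV_2 inner_axis)
  qed
  finally show "emeasure (distr lborel borel vec2) (box l u) = ennreal (prod ((\<bullet>) (u - l)) Basis)" .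
qed simp

lemma closed_int_lattice: "closed int_lattice"
proof -
  have eq: "int_lattice = (\<Inter>i. {x::real^2. x $ i \<in> \<int>})" by (auto simp: int_lattice_def)
  have "closed {x::real^2. x $ i \<in> \<int>}" for i
  proof -
    have "closed ((\<lambda>x::real^2. x $ i) -` \<int>)"
      by (intro closed_vimage closed_Ints continuous_intros)
    then show ?thesis by (simp add: vimage_def)
  qed
  then show ?thesis unfolding eq by (intro closed_INT ballI)
qed

lemma dist_lattice_point:
  assumes "x \<in> int_lattice"
  obtains a b :: int where "x $ 1 = a" "x $ 2 = b"
proof -
  have "x $ 1 \<in> \<int>" "x $ 2 \<in> \<int>" using assms by (auto simp: int_lattice_def)
  then show ?thesis using that by (auto elim!: Ints_cases)
qed

lemma dist_vec2_sq: "(dist (x :: real^2) y)\<^sup>2 = (x $ 1 - y $ 1)\<^sup>2 + (x $ 2 - y $ 2)\<^sup>2"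
  by (simp add: dist_norm norm_vec_def L2_set_def sum_2 power2_eq_square)

lemma Zr_iff:
  assumes "0 \<le> r"
  shows "x \<in> Zr r \<longleftrightarrow> (\<forall>a b :: int. (r / 2)\<^sup>2 < (x $ 1 - of_int a)\<^sup>2 + (x $ 2 - of_int b)\<^sup>2)"
proof
  assume x: "x \<in> Zr r"
  show "\<forall>a b :: int. (r / 2)\<^sup>2 < (x $ 1 - of_int a)\<^sup>2 + (x $ 2 - of_int b)\<^sup>2"
  proof (intro allI)
    fix a b :: int
    have "vec2 (of_int a, of_int b) \<in> int_lattice"
      by (simp add: int_lattice_def forall_2)
    then have "infdist x int_lattice \<le> dist x (vec2 (of_int a, of_int b))" by (rule infdist_le)
    then have "r / 2 < dist x (vec2 (of_int a, of_int b))" using x by (simp add: Zr_def)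
    then have "(r / 2)\<^sup>2 < (dist x (vec2 (of_int a, of_int b)))\<^sup>2" using assms by (intro power_strict_mono) auto
    then show "(r / 2)\<^sup>2 < (x $ 1 - of_int a)\<^sup>2 + (x $ 2 - of_int b)\<^sup>2" by (simp add: dist_vec2_sq)
  qed
next
  assume h: "\<forall>a b :: int. (r / 2)\<^sup>2 < (x $ 1 - of_int a)\<^sup>2 + (x $ 2 - of_int b)\<^sup>2"
  have "int_lattice \<noteq> {}" by (auto simp: int_lattice_def intro: exI[of _ 0])
  then obtain k where k: "k \<in> int_lattice" "infdist x int_lattice = dist x k"
    using infdist_attains_inf[OF closed_int_lattice] by metis
  then obtain a b :: int where "k $ 1 = a" "k $ 2 = b" using dist_lattice_point by blast
  then have "(r / 2)\<^sup>2 < (dist x k)\<^sup>2" using h by (simp add: dist_vec2_sq)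
  then have "r / 2 < dist x k" by (rule power2_less_imp_less) simp
  then show "x \<in> Zr r" using k by (simp add: Zr_def)
qed

lemma open_Zr: "open (Zr r)"
  unfolding Zr_def by (intro open_Collect_less continuous_intros)

text \<open>The frontier is closed: a path that avoids it up to time \<open>T\<close> does so a little longer, and the infimum exceeds \<open>T\<close>.\<close>
lemma less_free_path_iff:
  assumes "0 < T"
  shows "ereal T < free_path r x v \<longleftrightarrow> (\<forall>s\<in>{0<..T}. x + s *\<^sub>R v \<notin> frontier (Zr r))"
proof
  assume T: "ereal T < free_path r x v"
  show "\<forall>s\<in>{0<..T}. x + s *\<^sub>R v \<notin> frontier (Zr r)"
  proof (intro ballI notI)
    fix s assume s: "s \<in> {0<..T}" "x + s *\<^sub>R v \<in> frontier (Zr r)"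
    then have "free_path r x v \<le> ereal s" unfolding free_path_def by (intro Inf_lower) auto
    then have "free_path r x v \<le> ereal T" using s by (meson ereal_less_eq(3) greaterThanAtMost_iff order_trans)
    then show False using T by simp
  qed
next
  assume h: "\<forall>s\<in>{0<..T}. x + s *\<^sub>R v \<notin> frontier (Zr r)"
  have "open ((\<lambda>s. x + s *\<^sub>R v) -` (- frontier (Zr r)))"
    by (intro open_vimage continuous_intros) auto
  moreover have "T \<in> (\<lambda>s. x + s *\<^sub>R v) -` (- frontier (Zr r))" using h assms by auto
  ultimately obtain e where e: "0 < e" "ball T e \<subseteq> (\<lambda>s. x + s *\<^sub>R v) -` (- frontier (Zr r))"
    by (meson open_contains_ball)
  have "ereal (T + e) \<le> free_path r x v"
    unfolding free_path_def
  proof (rule Inf_greatest)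
    fix z assume "z \<in> ereal ` {s. 0 < s \<and> x + s *\<^sub>R v \<in> frontier (Zr r)}"
    then obtain s where s: "z = ereal s" "0 < s" "x + s *\<^sub>R v \<in> frontier (Zr r)" by auto
    have "T < s" using h s by (meson greaterThanAtMost_iff not_less)
    moreover have "s \<notin> ball T e" using e s by auto
    ultimately have "T + e \<le> s" by (auto simp: dist_real_def)
    then show "ereal (T + e) \<le> z" using s by simp
  qed
  moreover have "ereal T < ereal (T + e)" using e by simp
  ultimately show "ereal T < free_path r x v" by (rule less_le_trans[rotated])
qed

text \<open>A path that starts in the open set \<open>Zr r\<close> leaves it through its frontier.\<close>
lemma less_free_path_iff_clear:
  assumes "0 < r" "0 < T" "z \<in> {0..<1} \<times> {0..<1}"
  shows "vec2 z \<in> Yr r \<and> ereal T < free_path r (vec2 z) (dir \<theta>) \<longleftrightarrow> z \<in> free_set r T \<theta>"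
proof -
  have Y: "vec2 z \<in> Yr r \<longleftrightarrow> vec2 z \<in> Zr r"
    using assms by (auto simp: Yr_def forall_2 mem_Times_iff)
  have cl: "z \<in> free_set r T \<theta> \<longleftrightarrow> (\<forall>s\<in>{0..T}. vec2 z + s *\<^sub>R dir \<theta> \<in> Zr r)"
    using assms Zr_iff[of r] by (simp add: free_set_def clear_def)
  have "vec2 z \<in> Zr r \<and> ereal T < free_path r (vec2 z) (dir \<theta>) \<longleftrightarrow> (\<forall>s\<in>{0..T}. vec2 z + s *\<^sub>R dir \<theta> \<in> Zr r)"
  proof
    assume h: "vec2 z \<in> Zr r \<and> ereal T < free_path r (vec2 z) (dir \<theta>)"
    show "\<forall>s\<in>{0..T}. vec2 z + s *\<^sub>R dir \<theta> \<in> Zr r"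
    proof (rule ballI, rule ccontr)
      fix s assume s: "s \<in> {0..T}" "vec2 z + s *\<^sub>R dir \<theta> \<notin> Zr r"
      let ?P = "(\<lambda>s. vec2 z + s *\<^sub>R dir \<theta>) ` {0..s}"
      have "connected ?P" by (intro connected_continuous_image continuous_intros) auto
      moreover have "vec2 z \<in> ?P" using s by (intro image_eqI[of _ _ 0]) auto
      then have "?P \<inter> Zr r \<noteq> {}" using h by blast
      moreover have "vec2 z + s *\<^sub>R dir \<theta> \<in> ?P" using s by (intro imageI) auto
      then have "?P - Zr r \<noteq> {}" using s by blast
      ultimately have "?P \<inter> frontier (Zr r) \<noteq> {}" by (rule connected_Int_frontier)
      then obtain u where u: "0 \<le> u" "u \<le> s" "vec2 z + u *\<^sub>R dir \<theta> \<in> frontier (Zr r)" by auto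
      have "frontier (Zr r) \<inter> Zr r = {}" using open_Zr frontier_disjoint_eq by blast
      then have "u \<noteq> 0" using u h by auto
      then have "u \<in> {0<..T}" using u s by auto
      then show False using h u less_free_path_iff[OF assms(2)] by blast
    qed
  next
    assume h: "\<forall>s\<in>{0..T}. vec2 z + s *\<^sub>R dir \<theta> \<in> Zr r"
    then have "vec2 z \<in> Zr r" using assms(2) by (auto dest: bspec[of _ _ 0])
    moreover have "frontier (Zr r) \<inter> Zr r = {}" using open_Zr frontier_disjoint_eq by blast
    then have "ereal T < free_path r (vec2 z) (dir \<theta>)"
      unfolding less_free_path_iff[OF assms(2)] using h by fastforce
    ultimately show "vec2 z \<in> Zr r \<and> ereal T < free_path r (vec2 z) (dir \<theta>)" by blast
  qed
  then show ?thesis using Y cl by blast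
qed

lemma closed_hits_within:
  assumes "closed F"
  shows "closed {p :: (real^2) \<times> (real^2). \<exists>s\<in>{a..b}. fst p + s *\<^sub>R snd p \<in> F}"
proof -
  have "closed {p :: (real^2) \<times> (real^2). \<exists>s. s \<in> {a..b} \<and> (s, p) \<in> (\<lambda>x. fst (snd x) + fst x *\<^sub>R snd (snd x)) -` F}"
    by (intro closed_compact_projection compact_Icc closed_vimage assms continuous_intros)
  then show ?thesis by (simp add: Bex_def)
qed

text \<open>The event has to be measurable on the whole plane, including starting points inside the obstacles, for the
  integral over the torus to be meaningful. A hit at some time \<open>0 < s \<le> T\<close> happens in one of the compact time intervals
  from \<open>1 / (n + 1)\<close> to \<open>T\<close>.\<close>
lemma borel_less_free_path:
  assumes "0 < T"
  shows "{p. ereal T < free_path r (fst p) (snd p)} \<in> sets borel"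
proof -
  let ?C = "\<lambda>n::nat. {p :: (real^2) \<times> (real^2). \<exists>s\<in>{1 / real (Suc n)..T}. fst p + s *\<^sub>R snd p \<in> frontier (Zr r)}"
  have "{p. ereal T < free_path r (fst p) (snd p)} = - (\<Union>n. ?C n)"
  proof (intro set_eqI iffI)
    fix p assume "p \<in> {p. ereal T < free_path r (fst p) (snd p)}"
    then have h: "\<forall>s\<in>{0<..T}. fst p + s *\<^sub>R snd p \<notin> frontier (Zr r)" by (simp add: less_free_path_iff[OF assms])
    have "p \<notin> ?C n" for n
    proof
      assume "p \<in> ?C n"
      then obtain s where s: "1 / real (Suc n) \<le> s" "s \<le> T" "fst p + s *\<^sub>R snd p \<in> frontier (Zr r)" by auto
      have "0 < 1 / real (Suc n)" by simp
      then have "0 < s" using s(1) by linarith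
      then show False using h s by auto
    qed
    then show "p \<in> - (\<Union>n. ?C n)" by blast
  next
    fix p assume p: "p \<in> - (\<Union>n. ?C n)"
    have "fst p + s *\<^sub>R snd p \<notin> frontier (Zr r)" if "s \<in> {0<..T}" for s
    proof
      assume f: "fst p + s *\<^sub>R snd p \<in> frontier (Zr r)"
      have "0 < s" using that by simp
      then obtain n where "inverse (real (Suc n)) < s" using reals_Archimedean by blast
      then have "s \<in> {1 / real (Suc n)..T}" using that by (simp add: inverse_eq_divide)
      then have "p \<in> ?C n" using f by blast
      then show False using p by blast
    qed
    then show "p \<in> {p. ereal T < free_path r (fst p) (snd p)}" by (simp add: less_free_path_iff[OF assms])
  qed
  moreover have "?C n \<in> sets borel" for n
    by (intro borel_closed closed_hits_within frontier_closed)
  ultimately show ?thesis by auto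
qed

lemma Yr_borel: "Yr r \<in> sets borel"
proof -
  have "Yr r = Zr r \<inter> {x. 0 \<le> x $ 1} \<inter> {x. 0 \<le> x $ 2} \<inter> {x. x $ 1 < 1} \<inter> {x. x $ 2 < 1}"
    by (auto simp: Yr_def forall_2)
  also have "\<dots> \<in> sets borel"
    using open_Zr
    by (intro sets.Int borel_open borel_closed closed_Collect_le open_Collect_less continuous_intros) auto
  finally show ?thesis .
qed

lemma vec2_vimage_Yr:
  assumes "0 < r" "0 < T"
  shows "vec2 -` {x \<in> Yr r. ereal T < free_path r x (dir \<theta>)} = free_set r T \<theta>"
proof -
  have "z \<in> {0..<1} \<times> {0..<1}" if "vec2 z \<in> Yr r" for z
    using that by (auto simp: Yr_def forall_2 mem_Times_iff)
  moreover have "z \<in> {0..<1} \<times> {0..<1}" if "z \<in> free_set r T \<theta>" for z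
    using that by (simp add: free_set_def)
  ultimately have "vec2 z \<in> Yr r \<and> ereal T < free_path r (vec2 z) (dir \<theta>) \<longleftrightarrow> z \<in> free_set r T \<theta>" for z
    using less_free_path_iff_clear[OF assms, of z \<theta>] by blast
  then show ?thesis by blast
qed

lemma vec2_vimage_Yr_0:
  assumes "0 \<le> r"
  shows "vec2 -` Yr r = free_set r 0 \<theta>"
  using assms by (auto simp: free_set_def clear_def Yr_def forall_2 Zr_iff mem_Times_iff)

lemma measure_vec2_vimage:
  assumes "A \<in> sets borel"
  shows "measure lborel A = measure lborel (vec2 -` A)"
proof -
  have "measure lborel A = measure (distr lborel borel vec2) A" by (simp only: lborel_eq_distr_vec2[symmetric])
  also have "\<dots> = measure lborel (vec2 -` A \<inter> space lborel)" by (rule measure_distr) (use assms in auto)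
  finally show ?thesis by simp
qed

lemma measure_Yr: "0 \<le> r \<Longrightarrow> measure lborel (Yr r) = free_area r 0 0"
  by (simp add: measure_vec2_vimage[OF Yr_borel] vec2_vimage_Yr_0[of r 0] free_area_def)

lemma emeasure_Yr_finite: "emeasure lborel (Yr r) < \<infinity>"
proof -
  have "Yr r \<subseteq> cbox 0 1"
    unfolding Yr_def subset_iff mem_box_cart by (metis (no_types, lifting) less_imp_le mem_Collect_eq one_index zero_index)
  then have "emeasure lborel (Yr r) \<le> emeasure lborel (cbox 0 (1::real^2))" by (intro emeasure_mono) auto
  then show ?thesis using emeasure_lborel_cbox_finite[of "0::real^2" 1] by (meson le_less_trans)
qed

lemma sets_circle_measure: "sets circle_measure = sets (restrict_space borel (sphere 0 1))"
  by (simp add: circle_measure_def)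

interpretation circle: finite_measure circle_measure
  by (rule finite_measureI) (simp add: emeasure_circle_measure)

interpretation plane_circle: pair_sigma_finite "lborel :: (real^2) measure" circle_measure ..

lemma plane_circle_borel: "(\<lambda>p. p) \<in> measurable (lborel \<Otimes>\<^sub>M circle_measure) (borel :: ((real^2) \<times> (real^2)) measure)"
proof -
  have "(\<lambda>v. v) \<in> measurable circle_measure borel"
    unfolding circle_measure_def by (simp add: measurable_restrict_space1)
  then have "snd \<in> measurable (lborel \<Otimes>\<^sub>M circle_measure) borel"
    using measurable_compose[OF measurable_snd] by blast
  moreover have "fst \<in> measurable ((lborel :: (real^2) measure) \<Otimes>\<^sub>M circle_measure) borel"
    by (rule measurable_compose[OF measurable_fst]) simp
  ultimately have "(\<lambda>p. (fst p, snd p)) \<in> measurable (lborel \<Otimes>\<^sub>M circle_measure) (borel \<Otimes>\<^sub>M (borel :: (real^2) measure))"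
    by (intro measurable_Pair) auto
  then show ?thesis by (simp add: borel_prod)
qed

lemma integral_circle_measure:
  fixes g :: "real^2 \<Rightarrow> real"
  assumes "g \<in> borel_measurable circle_measure"
  shows "(LINT v|circle_measure. g v) = (LINT \<theta>|lborel. indicator {0..<2*pi} \<theta> * g (dir \<theta>))"
proof -
  have g: "g \<in> borel_measurable (restrict_space borel (sphere 0 1))"
    using assms by (simp cong: measurable_cong_sets add: sets_circle_measure)
  have "(LINT v|circle_measure. g v) = (LINT \<theta>|restrict_space lborel {0..<2*pi}. g (dir \<theta>))"
    unfolding circle_measure_def by (rule integral_distr[OF circle_param_measurable g])
  also have "\<dots> = (LINT \<theta>|lborel. indicator {0..<2*pi} \<theta> *\<^sub>R g (dir \<theta>))"
    by (rule integral_restrict_space) simp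
  finally show ?thesis by simp
qed

lemma integrable_circle_measure:
  fixes g :: "real^2 \<Rightarrow> real"
  assumes "integrable circle_measure g"
  shows "integrable lborel (\<lambda>\<theta>. indicator {0..<2*pi} \<theta> * g (dir \<theta>))"
proof -
  have "integrable (restrict_space lborel {0..<2*pi}) (\<lambda>\<theta>. g (dir \<theta>))"
    using assms unfolding circle_measure_def by (rule integrable_distr[OF circle_param_measurable])
  then show ?thesis by (subst (asm) integrable_restrict_space) auto
qed

lemma AE_circle_measure:
  assumes "AE v in circle_measure. P v"
  shows "AE \<theta> in lborel. \<theta> \<in> {0..<2*pi} \<longrightarrow> P (dir \<theta>)"
proof -
  have "AE \<theta> in restrict_space lborel {0..<2*pi}. P (dir \<theta>)"
    using assms unfolding circle_measure_def by (rule AE_distrD[OF circle_param_measurable])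
  then show ?thesis by (subst (asm) AE_restrict_space_iff) auto
qed

lemma free_area_pos:
  assumes "0 < r" "r < 1/2"
  shows "0 < free_area r 0 0"
proof -
  have "max 0 (1 - (0 * \<bar>perp (0, -1) 0\<bar> + r * len (0, -1))) \<le> free_area r 0 0"
    by (rule free_area_ge) (use assms in \<open>auto simp: prim_def\<close>)
  then show ?thesis using assms by (simp add: len_def)
qed

text \<open>Fubini's theorem for an observable \<open>H\<close> with values in \<open>[0, 1]\<close>, in the coordinates of the unit square and of the angle.\<close>
lemma integral_mu:
  fixes m :: "real^2 \<Rightarrow> real" and H :: "(real^2) \<times> (real^2) \<Rightarrow> real"
  assumes r: "0 < r" "r < 1/2" and m: "integrable circle_measure m"
    and H: "H \<in> borel_measurable borel" "\<And>p. 0 \<le> H p" "\<And>p. H p \<le> 1"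
  shows "(LINT p|mu r. H p * m (snd p)) =
    (LINT \<theta>|lborel. indicator {0..<2*pi} \<theta> * m (dir \<theta>) * (LINT x|lborel. indicator (Yr r) x * H (x, dir \<theta>)))
      / (2 * pi * measure lborel (Yr r))"
proof -
  let ?N = "(lborel :: (real^2) measure) \<Otimes>\<^sub>M circle_measure"
  let ?A = "Yr r \<times> sphere 0 1"
  have mm[measurable]: "m \<in> borel_measurable circle_measure" using m by (rule borel_measurable_integrable)
  have S: "sphere 0 1 \<in> sets circle_measure" using sets.top[of circle_measure] by simp
  have A[measurable]: "?A \<in> sets ?N" using Yr_borel S by (intro pair_measureI) auto
  have HN[measurable]: "H \<in> borel_measurable ?N" using measurable_compose[OF plane_circle_borel H(1)] .
  have eA: "emeasure ?N ?A = emeasure lborel (Yr r) * ennreal (2 * pi)"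
    using Yr_borel S by (subst circle.emeasure_pair_measure_Times) (auto simp: emeasure_circle_measure)
  define V where "V = measure lborel (Yr r)"
  have eV: "emeasure lborel (Yr r) = ennreal V"
    using emeasure_Yr_finite[of r] by (simp add: V_def emeasure_eq_ennreal_measure)
  have eA': "emeasure ?N ?A = ennreal (2 * pi * V)"
    unfolding eA eV by (simp add: V_def ennreal_mult'' mult.commute)
  have V: "0 < V" using free_area_pos[OF r] r(1) by (simp add: V_def measure_Yr)
  define f where "f p = indicator ?A p / (2 * pi * V)" for p :: "(real^2) \<times> (real^2)"
  have fm[measurable]: "f \<in> borel_measurable ?N" unfolding f_def by measurable
  have mu: "mu r = density ?N (\<lambda>p. ennreal (f p))"
    unfolding mu_def uniform_measure_def eA'
  proof (rule arg_cong[where f = "density ?N"], rule ext)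
    fix p :: "(real^2) \<times> (real^2)"
    show "indicator ?A p / ennreal (2 * pi * V) = ennreal (f p)"
      using V by (simp add: f_def indicator_def divide_ennreal[symmetric])
  qed
  define h where "h x v = indicator (Yr r) x * H (x, v) * m v" for x v
  have hm: "(\<lambda>p. h (fst p) (snd p)) \<in> borel_measurable ?N"
  proof -
    have "(\<lambda>p. indicator (Yr r) (fst p) :: real) \<in> borel_measurable ?N"
      using Yr_borel by (intro measurable_compose[OF measurable_fst]) simp
    moreover have "(\<lambda>p. m (snd p)) \<in> borel_measurable ?N" by measurable
    ultimately show ?thesis using HN unfolding h_def prod.collapse by (intro borel_measurable_times)
  qed
  have hi: "integrable ?N (\<lambda>(x, v). h x v)"
  proof (rule plane_circle.Fubini_integrable)
    show "(\<lambda>(x, v). h x v) \<in> borel_measurable ?N" using hm by (simp add: case_prod_unfold)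
    have sec: "H \<circ> Pair x \<in> borel_measurable circle_measure" for x
      unfolding comp_def using HN by measurable
    show i2: "AE x in lborel. integrable circle_measure (\<lambda>v. case (x, v) of (x, v) \<Rightarrow> h x v)"
    proof (rule AE_I2)
      fix x :: "real^2"
      have "integrable circle_measure (\<lambda>v. h x v)"
      proof (rule Bochner_Integration.integrable_bound[OF m])
        show "h x \<in> borel_measurable circle_measure"
          unfolding h_def using sec[of x] mm unfolding comp_def by measurable
        show "AE v in circle_measure. norm (h x v) \<le> norm (m v)"
          using H by (intro AE_I2) (simp add: h_def abs_mult mult_left_le_one_le indicator_def)
      qed
      then show "integrable circle_measure (\<lambda>v. case (x, v) of (x, v) \<Rightarrow> h x v)" by simp
    qed
    show "integrable lborel (\<lambda>x. LINT v|circle_measure. norm (case (x, v) of (x, v) \<Rightarrow> h x v))"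
    proof (rule integrableI_bounded_set[where A = "Yr r" and B = "LINT v|circle_measure. norm (m v)"])
      show "(\<lambda>x. LINT v|circle_measure. norm (case (x, v) of (x, v) \<Rightarrow> h x v)) \<in> borel_measurable lborel"
        using hm by (intro circle.borel_measurable_lebesgue_integral) (simp add: case_prod_unfold)
      show "AE x in lborel. x \<in> Yr r \<longrightarrow> norm (LINT v|circle_measure. norm (case (x, v) of (x, v) \<Rightarrow> h x v)) \<le> (LINT v|circle_measure. norm (m v))"
        using i2
      proof eventually_elim
        case (elim x)
        have "norm (LINT v|circle_measure. norm (h x v)) = (LINT v|circle_measure. norm (h x v))"
          by (simp add: Bochner_Integration.integral_nonneg)
        also have "\<dots> \<le> (LINT v|circle_measure. norm (m v))"
        proof (rule integral_mono)
          show "integrable circle_measure (\<lambda>v. norm (h x v))" using elim by (intro integrable_norm) simp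
          show "integrable circle_measure (\<lambda>v. norm (m v))" using m by (intro integrable_norm)
          show "norm (h x v) \<le> norm (m v)" for v
            using H by (simp add: h_def abs_mult mult_left_le_one_le indicator_def)
        qed
        finally show ?case by simp
      qed
    qed (use Yr_borel emeasure_Yr_finite in \<open>auto simp: h_def\<close>)
  qed
  have "(LINT p|mu r. H p * m (snd p)) = (LINT p|?N. f p *\<^sub>R (H p * m (snd p)))"
    unfolding mu using V by (intro integral_density) (auto simp: f_def)
  also have "\<dots> = (LINT p|?N. (case p of (x, v) \<Rightarrow> h x v) / (2 * pi * V))"
  proof (rule Bochner_Integration.integral_cong[OF refl])
    fix p assume "p \<in> space ?N"
    then have "snd p \<in> sphere 0 1" by (auto simp: space_pair_measure)
    then show "f p *\<^sub>R (H p * m (snd p)) = (case p of (x, v) \<Rightarrow> h x v) / (2 * pi * V)"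
      by (cases p) (simp add: f_def h_def indicator_def)
  qed
  also have "\<dots> = (LINT p|?N. (case p of (x, v) \<Rightarrow> h x v)) / (2 * pi * V)" by simp
  also have "(LINT p|?N. (case p of (x, v) \<Rightarrow> h x v)) = (LINT v|circle_measure. LINT x|lborel. h x v)"
    by (rule plane_circle.integral_snd[OF hi, symmetric])
  also have "\<dots> = (LINT \<theta>|lborel. indicator {0..<2*pi} \<theta> * (LINT x|lborel. h x (dir \<theta>)))"
    using plane_circle.integrable_snd[OF hi] by (intro integral_circle_measure borel_measurable_integrable)
  also have "\<dots> = (LINT \<theta>|lborel. indicator {0..<2*pi} \<theta> * m (dir \<theta>) * (LINT x|lborel. indicator (Yr r) x * H (x, dir \<theta>)))"
    by (intro Bochner_Integration.integral_cong refl) (simp add: h_def)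
  finally show ?thesis by (simp add: V_def)
qed

lemma Phi_eq:
  assumes r: "0 < r" "r < 1/2" and T: "0 < T" and m: "integrable circle_measure m"
  shows "Phi m r T = (LINT \<theta>|lborel. indicator {0..<2*pi} \<theta> * m (dir \<theta>) * free_area r T \<theta>) / (2 * pi * free_area r 0 0)"
proof -
  let ?B = "{p. ereal T < free_path r (fst p) (snd p)}"
  have "(LINT x|lborel. indicator (Yr r) x * indicator ?B (x, dir \<theta>)) = free_area r T \<theta>" for \<theta>
  proof -
    have sec: "{x. ereal T < free_path r x (dir \<theta>)} \<in> sets borel"
    proof -
      have "(\<lambda>x. (x, dir \<theta>)) -` ?B \<in> sets borel"
        by (rule measurable_sets_borel[OF _ borel_less_free_path[OF T]])
          (intro borel_measurable_continuous_onI continuous_intros)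
      then show ?thesis by simp
    qed
    then have "Yr r \<inter> {x. ereal T < free_path r x (dir \<theta>)} \<in> sets borel" using Yr_borel by blast
    then have b: "{x \<in> Yr r. ereal T < free_path r x (dir \<theta>)} \<in> sets borel" by (simp add: Int_def)
    have "(LINT x|lborel. indicator (Yr r) x * indicator ?B (x, dir \<theta>))
        = (LINT x|lborel. indicator {x \<in> Yr r. ereal T < free_path r x (dir \<theta>)} x :: real)"
      by (intro Bochner_Integration.integral_cong refl) (simp add: indicator_def)
    also have "\<dots> = measure lborel {x \<in> Yr r. ereal T < free_path r x (dir \<theta>)}" by simp
    also have "\<dots> = free_area r T \<theta>"
      unfolding measure_vec2_vimage[OF b] vec2_vimage_Yr[OF r(1) T] free_area_def ..
    finally show ?thesis .
  qed
  moreover have "Phi m r T = (LINT p|mu r. indicator ?B p * m (snd p))"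
    by (simp add: Phi_def)
  ultimately show ?thesis
    using integral_mu[OF r m, of "indicator ?B"] borel_less_free_path[OF T] r(1)
    by (simp add: measure_Yr)
qed

lemma integral_mu_1:
  assumes r: "0 < r" "r < 1/2" and m: "integrable circle_measure m"
  shows "(LINT p|mu r. m (snd p)) = (LINT \<theta>|lborel. indicator {0..<2*pi} \<theta> * m (dir \<theta>)) / (2 * pi)"
proof -
  have "(LINT x|lborel. indicator (Yr r) x * 1 :: real) = free_area r 0 0"
    using r by (simp add: measure_Yr)
  then show ?thesis
    using integral_mu[OF r m, of "\<lambda>_. 1"] free_area_pos[OF r] r(1) by (simp add: measure_Yr)
qed

section \<open>The free path distribution for small obstacles\<close>

lemma free_area_measurable:
  assumes [measurable]: "fr \<in> borel_measurable N" "fT \<in> borel_measurable N" "f\<theta> \<in> borel_measurable N"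
    and T: "\<And>p. 0 \<le> fT p"
  shows "(\<lambda>p. free_area (fr p) (fT p) (f\<theta> p)) \<in> borel_measurable N"
proof -
  have "Measurable.pred (N \<Otimes>\<^sub>M lborel) (\<lambda>x. clear (fr (fst x)) (fT (fst x)) (f\<theta> (fst x)) (fst (snd x), snd (snd x)))"
  proof (rule clear_measurable)
    have c: "fst \<in> borel_measurable (lborel :: (real \<times> real) measure)" "snd \<in> borel_measurable (lborel :: (real \<times> real) measure)"
      unfolding measurable_lborel2 by (intro borel_measurable_continuous_onI continuous_intros)+
    show "(\<lambda>x. fst (snd x)) \<in> borel_measurable (N \<Otimes>\<^sub>M (lborel :: (real \<times> real) measure))"
      by (rule measurable_compose[OF measurable_snd c(1)])
    show "(\<lambda>x. snd (snd x)) \<in> borel_measurable (N \<Otimes>\<^sub>M (lborel :: (real \<times> real) measure))"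
      by (rule measurable_compose[OF measurable_snd c(2)])
  qed (use T in auto)
  then have [measurable]: "Measurable.pred (N \<Otimes>\<^sub>M lborel) (\<lambda>x. clear (fr (fst x)) (fT (fst x)) (f\<theta> (fst x)) (snd x))"
    by simp
  have "{0..<1} \<times> {0..<1} \<in> sets (borel :: (real \<times> real) measure)" by (intro borel_Times) auto
  then have [measurable]: "{0..<1} \<times> {0..<1} \<in> sets (lborel :: (real \<times> real) measure)" by simp
  have "(\<lambda>p. LINT z|lborel. indicator (free_set (fr p) (fT p) (f\<theta> p)) z :: real) \<in> borel_measurable N"
  proof (rule lborel.borel_measurable_lebesgue_integral)
    have "(\<lambda>x. (if snd x \<in> {0..<1} \<times> {0..<1} \<and> clear (fr (fst x)) (fT (fst x)) (f\<theta> (fst x)) (snd x) then 1 else 0) :: real)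
        \<in> borel_measurable (N \<Otimes>\<^sub>M lborel)"
      by measurable
    then show "(\<lambda>(p, z). indicator (free_set (fr p) (fT p) (f\<theta> p)) z :: real) \<in> borel_measurable (N \<Otimes>\<^sub>M lborel)"
      by (simp add: free_set_def indicator_def case_prod_unfold)
  qed
  then show ?thesis using T by (simp add: free_area_def)
qed

lemma free_area_le_Yr:
  assumes "0 \<le> T"
  shows "free_area r T \<theta> \<le> free_area r 0 0"
proof -
  have "emeasure lborel (free_set r T \<theta>) \<le> emeasure lborel (free_set r 0 0)"
    using assms free_set_borel[of 0] by (intro emeasure_mono) (auto simp: free_set_def clear_def dest: bspec[of _ _ 0])
  then have "ennreal (free_area r T \<theta>) \<le> ennreal (free_area r 0 0)"
    using assms by (simp add: emeasure_free_set)
  then show ?thesis by (simp add: free_area_nonneg)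
qed

lemma Yr_area_bounds:
  assumes "0 < r"
  shows "1 - r \<le> free_area r 0 0" "free_area r 0 0 \<le> 1"
proof -
  have "max 0 (1 - (0 * \<bar>perp (0, -1) 0\<bar> + r * len (0, -1))) \<le> free_area r 0 0"
    by (rule free_area_ge) (use assms in \<open>auto simp: prim_def\<close>)
  then show "1 - r \<le> free_area r 0 0" by (simp add: len_def)
  have "emeasure lborel (free_set r 0 0) \<le> emeasure lborel ({0..<1} \<times> {0..<1} :: (real \<times> real) set)"
    by (intro emeasure_mono) (auto simp: free_set_def borel_Times)
  then have "ennreal (free_area r 0 0) \<le> ennreal 1"
    unfolding emeasure_unit_square by (simp add: emeasure_free_set)
  then show "free_area r 0 0 \<le> 1" by simp
qed

text \<open>Integrals against a density that is bounded by \<open>M\<close> almost everywhere.\<close>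
lemma integral_bounded_weight:
  fixes n g :: "real \<Rightarrow> real"
  assumes n: "integrable lborel n" and M: "AE \<theta> in lborel. \<bar>n \<theta>\<bar> \<le> M * indicator {0..<2*pi} \<theta>"
    and g: "set_integrable lborel {0..<2*pi} g"
    and f: "f \<in> borel_measurable lborel" "\<And>\<theta>. \<bar>f \<theta>\<bar> \<le> g \<theta>" and "0 \<le> M"
  shows "integrable lborel (\<lambda>\<theta>. n \<theta> * f \<theta>)" "\<bar>LINT \<theta>|lborel. n \<theta> * f \<theta>\<bar> \<le> M * (LINT \<theta>:{0..<2*pi}|lborel. g \<theta>)"
proof -
  have gi: "integrable lborel (\<lambda>\<theta>. M * (indicator {0..<2*pi} \<theta> *\<^sub>R g \<theta>))"
    using g unfolding set_integrable_def by (intro integrable_mult_right)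
  have g0: "0 \<le> g \<theta>" for \<theta> using f(2)[of \<theta>] by linarith
  have b: "AE \<theta> in lborel. norm (n \<theta> * f \<theta>) \<le> M * (indicator {0..<2*pi} \<theta> *\<^sub>R g \<theta>)"
    using M
  proof eventually_elim
    case (elim \<theta>)
    have "\<bar>n \<theta>\<bar> * \<bar>f \<theta>\<bar> \<le> (M * indicator {0..<2*pi} \<theta>) * g \<theta>"
      using elim f(2)[of \<theta>] assms(6) by (intro mult_mono) auto
    then show ?case by (simp add: abs_mult mult.assoc)
  qed
  show int: "integrable lborel (\<lambda>\<theta>. n \<theta> * f \<theta>)"
  proof (rule Bochner_Integration.integrable_bound[OF gi])
    show "(\<lambda>\<theta>. n \<theta> * f \<theta>) \<in> borel_measurable lborel"
      by (intro borel_measurable_times borel_measurable_integrable[OF n] f(1))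
    show "AE \<theta> in lborel. norm (n \<theta> * f \<theta>) \<le> norm (M * (indicator {0..<2*pi} \<theta> *\<^sub>R g \<theta>))"
      using b by eventually_elim simp
  qed
  have "\<bar>LINT \<theta>|lborel. n \<theta> * f \<theta>\<bar> \<le> (LINT \<theta>|lborel. \<bar>n \<theta> * f \<theta>\<bar>)" by (rule integral_abs_bound)
  also have "\<dots> \<le> (LINT \<theta>|lborel. M * (indicator {0..<2*pi} \<theta> *\<^sub>R g \<theta>))"
    using int gi b by (intro integral_mono_AE) (auto elim: eventually_mono)
  also have "\<dots> = M * (LINT \<theta>:{0..<2*pi}|lborel. g \<theta>)" by (simp add: set_lebesgue_integral_def)
  finally show "\<bar>LINT \<theta>|lborel. n \<theta> * f \<theta>\<bar> \<le> M * (LINT \<theta>:{0..<2*pi}|lborel. g \<theta>)" .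
qed

text \<open>The hypotheses on \<open>m\<close> in the angle coordinate, with a real essential bound \<open>M\<close>.\<close>
locale velocity_density =
  fixes m :: "real^2 \<Rightarrow> real" and M :: real
  assumes m_integrable: "integrable circle_measure m"
    and m_bound: "AE v in circle_measure. \<bar>m v\<bar> \<le> M"
    and M_nonneg: "0 \<le> M"
    and m_mean: "(LINT \<theta>|lborel. indicator {0..<2*pi} \<theta> * m (dir \<theta>)) = 2 * pi"
begin

definition angular :: "real \<Rightarrow> real" where
  "angular \<theta> = indicator {0..<2*pi} \<theta> * m (dir \<theta>)"

lemma angular_integrable: "integrable lborel angular"
  unfolding angular_def by (rule integrable_circle_measure[OF m_integrable])

lemma angular_bound: "AE \<theta> in lborel. \<bar>angular \<theta>\<bar> \<le> M * indicator {0..<2*pi} \<theta>"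
  using AE_circle_measure[OF m_bound] by eventually_elim (auto simp: angular_def indicator_def)

lemma integral_angular: "(LINT \<theta>|lborel. angular \<theta>) = 2 * pi"
  using m_mean by (simp add: angular_def)

lemma Phi_angular:
  assumes "0 < r" "r < 1/2" "0 < T"
  shows "Phi m r T = (LINT \<theta>|lborel. angular \<theta> * free_area r T \<theta>) / (2 * pi * free_area r 0 0)"
  using Phi_eq[OF assms m_integrable] by (simp add: angular_def)

lemma free_area_dir_measurable: "0 \<le> T \<Longrightarrow> free_area r T \<in> borel_measurable lborel"
  using free_area_measurable[of "\<lambda>_. r" lborel "\<lambda>_. T" "\<lambda>\<theta>. \<theta>"] by simp

lemma angular_free_area:
  assumes "0 \<le> T"
  shows "integrable lborel (\<lambda>\<theta>. angular \<theta> * free_area r T \<theta>)"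
    "\<bar>LINT \<theta>|lborel. angular \<theta> * free_area r T \<theta>\<bar> \<le> M * (2 * pi * free_area r 0 0)"
proof -
  have "set_integrable lborel {0..<2*pi} (\<lambda>\<theta>. free_area r 0 0)"
    unfolding set_integrable_def by (intro integrable_scaleR_left integrable_real_indicator) auto
  note b = integral_bounded_weight[OF angular_integrable angular_bound this free_area_dir_measurable[OF assms, of r] _ M_nonneg]
  have le: "\<bar>free_area r T \<theta>\<bar> \<le> free_area r 0 0" for \<theta>
    using free_area_le_Yr[OF assms] free_area_nonneg by simp
  show "integrable lborel (\<lambda>\<theta>. angular \<theta> * free_area r T \<theta>)" by (rule b(1)[OF le])
  have "(LINT \<theta>:{0..<2*pi}|lborel. free_area r 0 0) = 2 * pi * free_area r 0 0"
    by (simp add: set_lebesgue_integral_def)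
  then show "\<bar>LINT \<theta>|lborel. angular \<theta> * free_area r T \<theta>\<bar> \<le> M * (2 * pi * free_area r 0 0)"
    using b(2)[OF le] by simp
qed

lemma Phi_bound:
  assumes "0 < r" "r < 1/2" "0 < T"
  shows "\<bar>Phi m r T\<bar> \<le> M"
proof -
  have V: "0 < free_area r 0 0" by (rule free_area_pos[OF assms(1,2)])
  have "\<bar>Phi m r T\<bar> = \<bar>LINT \<theta>|lborel. angular \<theta> * free_area r T \<theta>\<bar> / (2 * pi * free_area r 0 0)"
    using V by (simp add: Phi_angular[OF assms] abs_mult)
  also have "\<dots> \<le> M * (2 * pi * free_area r 0 0) / (2 * pi * free_area r 0 0)"
    using angular_free_area(2)[of T r] assms(3) V by (intro divide_right_mono) auto
  also have "\<dots> = M" using V by simp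
  finally show ?thesis .
qed

lemma Phi_measurable:
  assumes "0 < t"
  shows "(\<lambda>r. indicator {0<..<1/2} r * Phi m r (t / r)) \<in> borel_measurable borel"
proof -
  define \<phi> where "\<phi> r = (LINT \<theta>|lborel. angular \<theta> * free_area r \<bar>t / r\<bar> \<theta>) / (2 * pi * free_area r 0 0)" for r
  have "(\<lambda>p :: real \<times> real. free_area (fst p) \<bar>t / fst p\<bar> (snd p)) \<in> borel_measurable (borel \<Otimes>\<^sub>M lborel)"
    by (rule free_area_measurable) auto
  moreover have "(\<lambda>p :: real \<times> real. angular (snd p)) \<in> borel_measurable (borel \<Otimes>\<^sub>M lborel)"
    by (rule measurable_compose[OF measurable_snd]) (rule borel_measurable_integrable[OF angular_integrable])
  ultimately have "(\<lambda>p :: real \<times> real. angular (snd p) * free_area (fst p) \<bar>t / fst p\<bar> (snd p)) \<in> borel_measurable (borel \<Otimes>\<^sub>M lborel)"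
    by (intro borel_measurable_times)
  then have "(\<lambda>r. LINT \<theta>|lborel. angular \<theta> * free_area r \<bar>t / r\<bar> \<theta>) \<in> borel_measurable borel"
    by (intro lborel.borel_measurable_lebesgue_integral) (simp add: case_prod_unfold)
  moreover have "(\<lambda>r. free_area r 0 0) \<in> borel_measurable (borel :: real measure)"
    by (rule free_area_measurable) auto
  ultimately have "\<phi> \<in> borel_measurable borel" unfolding \<phi>_def by measurable
  then have "(\<lambda>r. indicator {0<..<1/2} r * \<phi> r) \<in> borel_measurable borel" by measurable
  moreover have "indicator {0<..<1/2} r * \<phi> r = indicator {0<..<1/2} r * Phi m r (t / r)" for r
    using Phi_angular[of r "t / r"] assms by (auto simp: indicator_def \<phi>_def)
  ultimately show ?thesis by simp
qed

text \<open>Up to the normalising area, which tends to 1, the distribution is the integral of \<open>free_area\<close> against the density. Replacing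
  \<open>free_area\<close> by \<open>strip_area\<close> costs the averaged corner term times \<open>M\<close>, and the integral of \<open>strip_area\<close> converges.
  All errors are collected in \<open>U\<close>, whose limit is \<open>8 M / (t - 3)\<^sup>2\<close>.\<close>
lemma Phi_error:
  assumes t: "3 < t" and e: "0 < e"
  shows "\<forall>\<^sub>F r in at_right 0. \<bar>Phi m r (t / r) - 2 / (pi\<^sup>2 * t)\<bar> \<le> 8 * M / (t - 3)\<^sup>2 + e"
proof -
  define b where "b = 1 / (t - 3)"
  define S where "S r = (LINT \<theta>|lborel. angular \<theta> * strip_area r t \<theta>) / (2 * pi)" for r
  have "strip_limit t angular"
    by (rule strip_limit_circle[OF _ angular_integrable]) (use t in \<open>auto simp: angular_def\<close>)
  then have "(S \<longlongrightarrow> 2 / (pi\<^sup>2 * t) * (2 * pi) / (2 * pi)) (at_right 0)"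
    unfolding S_def by (intro tendsto_divide tendsto_const) (auto simp: strip_limit_def integral_angular)
  moreover have "2 / (pi\<^sup>2 * t) * (2 * pi) / (2 * pi) = 2 / (pi\<^sup>2 * t)"
    by (rule nonzero_mult_div_cancel_right) simp
  ultimately have S: "(S \<longlongrightarrow> 2 / (pi\<^sup>2 * t)) (at_right 0)" by (simp only:)
  \<comment> \<open>The three terms come from the normalising area, from the corners and from the weak limit.\<close>
  define U where "U r = M * r / (1 - r) + M * (r\<^sup>2 + 4 * b\<^sup>2 * (1 + 5 * r) * (2 + 9 * r)) + \<bar>S r - 2 / (pi\<^sup>2 * t)\<bar>" for r
  have id: "((\<lambda>r. r) \<longlongrightarrow> 0) (at_right (0::real))" by (rule tendsto_ident_at)
  have "(U \<longlongrightarrow> M * 0 / (1 - 0) + M * (0\<^sup>2 + 4 * b\<^sup>2 * (1 + 5 * 0) * (2 + 9 * 0)) + \<bar>2 / (pi\<^sup>2 * t) - 2 / (pi\<^sup>2 * t)\<bar>) (at_right 0)"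
    unfolding U_def by (intro tendsto_intros id S) auto
  moreover have "M * 0 / (1 - 0) + M * (0\<^sup>2 + 4 * b\<^sup>2 * (1 + 5 * 0) * (2 + 9 * 0)) + \<bar>2 / (pi\<^sup>2 * t) - 2 / (pi\<^sup>2 * t)\<bar> = 8 * M / (t - 3)\<^sup>2"
    by (simp add: b_def power_divide)
  ultimately have "\<forall>\<^sub>F r in at_right 0. U r < 8 * M / (t - 3)\<^sup>2 + e"
    using e by (intro order_tendstoD(2)) auto
  moreover have "\<forall>\<^sub>F r in at_right (0::real). r < 1 / 6"
    by (intro eventually_at_rightI[of 0 "1 / 6"]) auto
  moreover have "\<forall>\<^sub>F r :: real in at_right 0. 0 < r" by (simp add: eventually_at_right_less)
  ultimately show ?thesis
  proof eventually_elim
    case (elim r)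
    define F where "F \<theta> = free_area r (t / r) \<theta>" for \<theta>
    define V where "V = free_area r 0 0"
    define B where "B = (LINT \<theta>|lborel. angular \<theta> * F \<theta>) / (2 * pi)"
    have V: "1 - r \<le> V" "V \<le> 1" "0 < V"
      using Yr_area_bounds[of r] free_area_pos[of r] elim by (auto simp: V_def)
    have T: "0 \<le> t / r" using t elim by simp
    have Phi: "Phi m r (t / r) = B / V"
      using Phi_angular[of r "t / r"] elim t by (simp add: B_def V_def F_def)
    have "\<bar>B\<bar> = \<bar>LINT \<theta>|lborel. angular \<theta> * F \<theta>\<bar> / (2 * pi)" by (simp add: B_def)
    also have "\<dots> \<le> M * (2 * pi * V) / (2 * pi)"
      using angular_free_area(2)[OF T, of r] unfolding F_def V_def by (rule divide_right_mono) simp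
    also have "\<dots> = M * V" by simp
    also have "\<dots> \<le> M * 1" using V M_nonneg by (intro mult_left_mono) auto
    finally have B: "\<bar>B\<bar> \<le> M" by simp
    have "B / V - B = B * (1 - V) / V" using V by (simp add: field_simps)
    then have "\<bar>B / V - B\<bar> = \<bar>B\<bar> * (1 - V) / V" using V by (simp add: abs_mult)
    also have "\<dots> \<le> M * r / (1 - r)"
      using B V elim by (intro frac_le mult_mono mult_nonneg_nonneg M_nonneg) auto
    finally have 1: "\<bar>B / V - B\<bar> \<le> M * r / (1 - r)" .
    have gap: "\<bar>F \<theta> - strip_area r t \<theta>\<bar> \<le> r\<^sup>2 + corner_bound r (r * b) \<theta>" for \<theta>
      using free_area_le_strip_area[OF t, of r \<theta>] strip_area_le_free_area[of r t \<theta>] elim t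
      by (simp add: F_def b_def)
    note cb = integral_corner_bound[of r b]
    have b0: "0 \<le> b" using t by (simp add: b_def)
    have c: "set_integrable lborel {0..<2*pi} (\<lambda>\<theta>. r\<^sup>2)"
      unfolding set_integrable_def by (intro integrable_scaleR_left integrable_real_indicator) auto
    have gi: "set_integrable lborel {0..<2*pi} (\<lambda>\<theta>. r\<^sup>2 + corner_bound r (r * b) \<theta>)"
      by (intro set_integral_add(1) c cb(1) elim b0)
    have meas: "(\<lambda>\<theta>. F \<theta> - strip_area r t \<theta>) \<in> borel_measurable lborel"
      using free_area_dir_measurable[OF T, of r] unfolding F_def by measurable
    have "\<bar>LINT \<theta>|lborel. angular \<theta> * (F \<theta> - strip_area r t \<theta>)\<bar>
        \<le> M * (LINT \<theta>:{0..<2*pi}|lborel. r\<^sup>2 + corner_bound r (r * b) \<theta>)"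
      by (rule integral_bounded_weight(2)[OF angular_integrable angular_bound gi meas gap M_nonneg])
    also have "(LINT \<theta>:{0..<2*pi}|lborel. r\<^sup>2 + corner_bound r (r * b) \<theta>)
        = (LINT \<theta>:{0..<2*pi}|lborel. r\<^sup>2) + (LINT \<theta>:{0..<2*pi}|lborel. corner_bound r (r * b) \<theta>)"
      by (intro set_integral_add(2) c cb(1) elim b0)
    also have "(LINT \<theta>:{0..<2*pi}|lborel. r\<^sup>2) = 2 * pi * r\<^sup>2"
      by (simp add: set_lebesgue_integral_def)
    also have "M * (2 * pi * r\<^sup>2 + (LINT \<theta>:{0..<2*pi}|lborel. corner_bound r (r * b) \<theta>))
        \<le> M * (2 * pi * r\<^sup>2 + 2 * pi * (4 * b\<^sup>2 * (1 + 5 * r) * (2 + 9 * r)))"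
      using cb(2) elim b0 M_nonneg by (intro mult_left_mono add_left_mono) auto
    also have "\<dots> = 2 * pi * (M * (r\<^sup>2 + 4 * b\<^sup>2 * (1 + 5 * r) * (2 + 9 * r)))"
      by (simp add: algebra_simps)
    also have "(LINT \<theta>|lborel. angular \<theta> * (F \<theta> - strip_area r t \<theta>))
        = (LINT \<theta>|lborel. angular \<theta> * F \<theta>) - (LINT \<theta>|lborel. angular \<theta> * strip_area r t \<theta>)"
      unfolding right_diff_distrib F_def using t elim
      by (intro Bochner_Integration.integral_diff angular_free_area(1) T integrable_times_strip_area angular_integrable) auto
    also have "\<dots> = 2 * pi * (B - S r)" by (simp add: B_def S_def right_diff_distrib)
    finally have "2 * pi * \<bar>B - S r\<bar> \<le> 2 * pi * (M * (r\<^sup>2 + 4 * b\<^sup>2 * (1 + 5 * r) * (2 + 9 * r)))"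
      by (simp add: abs_mult)
    then have 2: "\<bar>B - S r\<bar> \<le> M * (r\<^sup>2 + 4 * b\<^sup>2 * (1 + 5 * r) * (2 + 9 * r))"
      by (rule mult_left_le_imp_le) simp
    have "\<bar>Phi m r (t / r) - 2 / (pi\<^sup>2 * t)\<bar> \<le> U r"
      unfolding Phi U_def using 1 2 by linarith
    then show ?case using elim(1) by linarith
  qed
qed

end

section \<open>Logarithmic averages\<close>

definition log_avg :: "(real \<Rightarrow> real) \<Rightarrow> real \<Rightarrow> real \<Rightarrow> real" where
  "log_avg f \<delta> \<epsilon> = 1 / \<bar>ln \<epsilon>\<bar> * (LBINT r=\<epsilon>..\<delta>. f r / r)"

lemma const_over_ln_tendsto: "((\<lambda>\<epsilon>. c / \<bar>ln \<epsilon>\<bar>) \<longlongrightarrow> 0) (at_right (0::real))"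
proof -
  have "((\<lambda>\<epsilon>. c / ln \<epsilon>) \<longlongrightarrow> 0) (at_right (0::real))"
    by (intro tendsto_divide_0[OF tendsto_const] filterlim_at_bot_imp_at_infinity ln_at_0)
  then have "((\<lambda>\<epsilon>. \<bar>c / ln \<epsilon>\<bar>) \<longlongrightarrow> 0) (at_right (0::real))" by (rule tendsto_rabs_zero)
  then have "((\<lambda>\<epsilon>. \<bar>c / \<bar>ln \<epsilon>\<bar>\<bar>) \<longlongrightarrow> 0) (at_right (0::real))"
    by (simp only: abs_divide abs_idempotent)
  then show ?thesis by (rule tendsto_rabs_zero_cancel)
qed

locale log_average =
  fixes f :: "real \<Rightarrow> real" and K :: real
  assumes f_measurable: "(\<lambda>r. indicator {0<..<1/2} r * f r) \<in> borel_measurable borel"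
    and f_bound: "\<And>r. 0 < r \<Longrightarrow> r < 1/2 \<Longrightarrow> \<bar>f r\<bar> \<le> K"
begin

lemma f_integrable:
  assumes "0 < a" "b < 1/2"
  shows "set_integrable lborel {a<..<b} (\<lambda>r. f r / r)"
  unfolding set_integrable_def
proof (rule integrableI_bounded_set[where A = "{a<..<b}" and B = "K / a"])
  show "emeasure lborel {a<..<b} < \<infinity>" using emeasure_bounded_finite[of "{a<..<b}"] by simp
  have "(\<lambda>r. (indicator {0<..<1/2} r * f r) * (indicator {a<..<b} r / r)) \<in> borel_measurable borel"
    by (intro borel_measurable_times f_measurable) auto
  moreover have "(indicator {0<..<1/2} r * f r) * (indicator {a<..<b} r / r) = indicator {a<..<b} r *\<^sub>R (f r / r)" for r
    using assms by (auto simp: indicator_def)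
  ultimately have "(\<lambda>r. indicator {a<..<b} r *\<^sub>R (f r / r)) \<in> borel_measurable borel" by (simp only:)
  then show "(\<lambda>r. indicator {a<..<b} r *\<^sub>R (f r / r)) \<in> borel_measurable lborel" by simp
  show "AE r in lborel. r \<in> {a<..<b} \<longrightarrow> norm (indicator {a<..<b} r *\<^sub>R (f r / r)) \<le> K / a"
  proof (intro AE_I2 impI)
    fix r assume r: "r \<in> {a<..<b}"
    then have "\<bar>f r\<bar> / \<bar>r\<bar> \<le> K / a"
      using f_bound[of r] assms by (intro frac_le) auto
    then show "norm (indicator {a<..<b} r *\<^sub>R (f r / r)) \<le> K / a" using r by simp
  qed
qed auto

lemma f_interval_integrable:
  assumes "0 < a" "a \<le> b" "b < 1/2"
  shows "interval_lebesgue_integrable lborel (ereal a) (ereal b) (\<lambda>r. f r / r)"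
  using assms f_integrable[of a b] by (simp add: interval_lebesgue_integrable_def einterval_eq)

lemma integral_split:
  fixes a b c :: real
  assumes "0 < a" "a \<le> b" "b \<le> c" "c < 1/2"
  shows "(LBINT r=a..c. f r / r) = (LBINT r=a..b. f r / r) + (LBINT r=b..c. f r / r)"
proof (rule interval_integral_sum[symmetric])
  show "interval_lebesgue_integrable lborel (min (ereal a) (min (ereal b) (ereal c))) (max (ereal a) (max (ereal b) (ereal c))) (\<lambda>r. f r / r)"
    using f_interval_integrable[of a c] assms by (simp add: min_def max_def)
qed

text \<open>The two averages differ by a fixed integral divided by \<open>|ln \<epsilon>|\<close>.\<close>
lemma log_avg_diff_ordered:
  fixes \<delta> \<delta>' :: real
  assumes "0 < \<delta>" "\<delta> \<le> \<delta>'" "\<delta>' < 1/2"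
  shows "((\<lambda>\<epsilon>. log_avg f \<delta>' \<epsilon> - log_avg f \<delta> \<epsilon>) \<longlongrightarrow> 0) (at_right 0)"
proof (rule Lim_transform_eventually)
  let ?c = "LBINT r=\<delta>..\<delta>'. f r / r"
  show "((\<lambda>\<epsilon>. ?c / \<bar>ln \<epsilon>\<bar>) \<longlongrightarrow> 0) (at_right 0)" by (rule const_over_ln_tendsto)
  show "\<forall>\<^sub>F \<epsilon> in at_right 0. ?c / \<bar>ln \<epsilon>\<bar> = log_avg f \<delta>' \<epsilon> - log_avg f \<delta> \<epsilon>"
  proof (rule eventually_at_rightI[OF _ assms(1)])
    fix \<epsilon> assume "\<epsilon> \<in> {0<..<\<delta>}"
    then show "?c / \<bar>ln \<epsilon>\<bar> = log_avg f \<delta>' \<epsilon> - log_avg f \<delta> \<epsilon>"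
      unfolding log_avg_def using integral_split[of \<epsilon> \<delta> \<delta>'] assms by (simp add: algebra_simps)
  qed
qed

lemma log_avg_diff:
  fixes \<delta> \<delta>' :: real
  assumes "\<delta> \<in> {0<..<1/2}" "\<delta>' \<in> {0<..<1/2}"
  shows "((\<lambda>\<epsilon>. log_avg f \<delta>' \<epsilon> - log_avg f \<delta> \<epsilon>) \<longlongrightarrow> 0) (at_right 0)"
proof (cases "\<delta> \<le> \<delta>'")
  case True
  then show ?thesis using assms by (intro log_avg_diff_ordered) auto
next
  case False
  then have "((\<lambda>\<epsilon>. - (log_avg f \<delta> \<epsilon> - log_avg f \<delta>' \<epsilon>)) \<longlongrightarrow> - 0) (at_right 0)"
    using assms by (intro tendsto_minus log_avg_diff_ordered) auto
  then show ?thesis by simp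
qed

lemma Limsup_log_avg_le:
  assumes "\<delta> \<in> {0<..<1/2}" "\<delta>' \<in> {0<..<1/2}"
  shows "Limsup (at_right 0) (\<lambda>\<epsilon>. ereal (log_avg f \<delta>' \<epsilon>)) \<le> Limsup (at_right 0) (\<lambda>\<epsilon>. ereal (log_avg f \<delta> \<epsilon>))"
proof (rule ereal_le_epsilon2)
  fix e :: real assume e: "0 < e"
  have "\<forall>\<^sub>F \<epsilon> in at_right 0. log_avg f \<delta>' \<epsilon> - log_avg f \<delta> \<epsilon> < e"
    using e by (intro order_tendstoD(2)[OF log_avg_diff[OF assms]]) auto
  then have "Limsup (at_right 0) (\<lambda>\<epsilon>. ereal (log_avg f \<delta>' \<epsilon>)) \<le> Limsup (at_right 0) (\<lambda>\<epsilon>. ereal (log_avg f \<delta> \<epsilon>) + ereal e)"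
    by (intro Limsup_mono) (auto elim!: eventually_mono)
  also have "\<dots> = Limsup (at_right 0) (\<lambda>\<epsilon>. ereal (log_avg f \<delta> \<epsilon>)) + ereal e"
    by (intro Limsup_add_ereal_right) auto
  finally show "Limsup (at_right 0) (\<lambda>\<epsilon>. ereal (log_avg f \<delta>' \<epsilon>)) \<le> Limsup (at_right 0) (\<lambda>\<epsilon>. ereal (log_avg f \<delta> \<epsilon>)) + ereal e" .
qed

lemma Liminf_log_avg_le:
  assumes "\<delta> \<in> {0<..<1/2}" "\<delta>' \<in> {0<..<1/2}"
  shows "Liminf (at_right 0) (\<lambda>\<epsilon>. ereal (log_avg f \<delta>' \<epsilon>)) \<le> Liminf (at_right 0) (\<lambda>\<epsilon>. ereal (log_avg f \<delta> \<epsilon>))"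
proof (rule ereal_le_epsilon2)
  fix e :: real assume e: "0 < e"
  have "\<forall>\<^sub>F \<epsilon> in at_right 0. log_avg f \<delta>' \<epsilon> - log_avg f \<delta> \<epsilon> < e"
    using e by (intro order_tendstoD(2)[OF log_avg_diff[OF assms]]) auto
  then have "Liminf (at_right 0) (\<lambda>\<epsilon>. ereal (log_avg f \<delta>' \<epsilon>)) \<le> Liminf (at_right 0) (\<lambda>\<epsilon>. ereal (log_avg f \<delta> \<epsilon>) + ereal e)"
    by (intro Liminf_mono) (auto elim!: eventually_mono)
  also have "\<dots> = Liminf (at_right 0) (\<lambda>\<epsilon>. ereal (log_avg f \<delta> \<epsilon>)) + ereal e"
    by (intro Liminf_add_ereal_right) auto
  finally show "Liminf (at_right 0) (\<lambda>\<epsilon>. ereal (log_avg f \<delta>' \<epsilon>)) \<le> Liminf (at_right 0) (\<lambda>\<epsilon>. ereal (log_avg f \<delta> \<epsilon>)) + ereal e" .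
qed

lemma integral_over_r_bounds:
  fixes \<epsilon> d l u :: real
  assumes d: "0 < \<epsilon>" "\<epsilon> < d" "d < 1/2" and f: "\<And>r. 0 < r \<Longrightarrow> r < d \<Longrightarrow> l \<le> f r \<and> f r \<le> u"
  shows "l * (ln d - ln \<epsilon>) \<le> (LBINT r=\<epsilon>..d. f r / r)" "(LBINT r=\<epsilon>..d. f r / r) \<le> u * (ln d - ln \<epsilon>)"
proof -
  have FTC: "(LBINT r=\<epsilon>..d. 1 / r) = ln d - ln \<epsilon>"
  proof (rule interval_integral_FTC_finite)
    show "continuous_on {min \<epsilon> d..max \<epsilon> d} (\<lambda>r. 1 / r)" using d by (intro continuous_intros) auto
    fix r assume "min \<epsilon> d \<le> r" "r \<le> max \<epsilon> d"
    then have "0 < r" using d by auto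
    then have "(ln has_real_derivative 1 / r) (at r)" by (auto intro!: derivative_eq_intros)
    then have "(ln has_vector_derivative 1 / r) (at r)" by (simp add: has_real_derivative_iff_has_vector_derivative)
    then show "(ln has_vector_derivative 1 / r) (at r within {min \<epsilon> d..max \<epsilon> d})"
      by (rule has_vector_derivative_at_within)
  qed
  have c: "set_integrable lborel {\<epsilon><..<d} (\<lambda>r. c * (1 / r))" for c :: real
  proof -
    have "set_integrable lborel {\<epsilon>..d} (\<lambda>r. c * (1 / r))"
      using d by (intro borel_integrable_atLeastAtMost' continuous_intros) auto
    then show ?thesis by (rule set_integrable_subset) auto
  qed
  have i: "(LBINT r=\<epsilon>..d. g r) = (LINT r:{\<epsilon><..<d}|lborel. g r)" for g :: "real \<Rightarrow> real"
    using d by (simp add: interval_lebesgue_integral_le_eq einterval_eq)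
  have cI: "(LINT r:{\<epsilon><..<d}|lborel. c * (1 / r)) = c * (ln d - ln \<epsilon>)" for c
    using FTC by (simp only: i[symmetric] interval_lebesgue_integral_mult_right)
  have ge: "l * (1 / r) \<le> f r / r" and le: "f r / r \<le> u * (1 / r)" if "r \<in> {\<epsilon><..<d}" for r
    using f[of r] that d by (auto simp: divide_right_mono)
  show "l * (ln d - ln \<epsilon>) \<le> (LBINT r=\<epsilon>..d. f r / r)"
    unfolding i cI[symmetric] by (rule set_integral_mono[OF c f_integrable[OF d(1,3)] ge])
  show "(LBINT r=\<epsilon>..d. f r / r) \<le> u * (ln d - ln \<epsilon>)"
    unfolding i cI[symmetric] by (rule set_integral_mono[OF f_integrable[OF d(1,3)] c le])
qed

text \<open>Radii bounded away from 0 do not matter, and below \<open>d\<close> the measure \<open>dr / r\<close> gives the interval from \<open>\<epsilon>\<close> to \<open>d\<close> the mass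
  \<open>ln d - ln \<epsilon>\<close>, which is asymptotic to \<open>|ln \<epsilon>|\<close>.\<close>
lemma log_avg_limits:
  assumes \<delta>: "\<delta> \<in> {0<..<1/2}" and ev: "\<forall>\<^sub>F r in at_right 0. l \<le> f r \<and> f r \<le> u"
  shows "ereal l \<le> Liminf (at_right 0) (\<lambda>\<epsilon>. ereal (log_avg f \<delta> \<epsilon>))"
    and "Limsup (at_right 0) (\<lambda>\<epsilon>. ereal (log_avg f \<delta> \<epsilon>)) \<le> ereal u"
proof -
  obtain d0 where d0: "0 < d0" "\<And>r. 0 < r \<Longrightarrow> r < d0 \<Longrightarrow> l \<le> f r \<and> f r \<le> u"
    using ev unfolding eventually_at_right_field by auto
  define d where "d = min d0 (1 / 4)"
  have d: "0 < d" "d < 1/2" "\<And>r. 0 < r \<Longrightarrow> r < d \<Longrightarrow> l \<le> f r \<and> f r \<le> u"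
    using d0 by (auto simp: d_def)
  have dI: "d \<in> {0<..<1/2}" using d by simp
  have ev: "\<forall>\<^sub>F \<epsilon> in at_right 0. l + l * ln d / \<bar>ln \<epsilon>\<bar> \<le> log_avg f d \<epsilon> \<and> log_avg f d \<epsilon> \<le> u + u * ln d / \<bar>ln \<epsilon>\<bar>"
  proof (rule eventually_at_rightI[OF _ d(1)])
    fix \<epsilon> assume "\<epsilon> \<in> {0<..<d}"
    then have \<epsilon>: "0 < \<epsilon>" "\<epsilon> < d" by auto
    have ln: "\<bar>ln \<epsilon>\<bar> = - ln \<epsilon>" "0 < - ln \<epsilon>" using \<epsilon> d by (auto simp: ln_less_zero)
    have eq: "c + c * ln d / \<bar>ln \<epsilon>\<bar> = 1 / \<bar>ln \<epsilon>\<bar> * (c * (ln d - ln \<epsilon>))" for c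
      using ln by (simp add: field_simps)
    show "l + l * ln d / \<bar>ln \<epsilon>\<bar> \<le> log_avg f d \<epsilon> \<and> log_avg f d \<epsilon> \<le> u + u * ln d / \<bar>ln \<epsilon>\<bar>"
      unfolding eq log_avg_def using integral_over_r_bounds[OF \<epsilon> d(2) d(3)] by (intro conjI mult_left_mono) auto
  qed
  have lim: "((\<lambda>\<epsilon>. ereal (c + c * ln d / \<bar>ln \<epsilon>\<bar>)) \<longlongrightarrow> ereal c) (at_right 0)" for c
  proof -
    have "((\<lambda>\<epsilon>. c + c * ln d / \<bar>ln \<epsilon>\<bar>) \<longlongrightarrow> c + 0) (at_right 0)"
      by (intro tendsto_add tendsto_const const_over_ln_tendsto)
    then show ?thesis by simp
  qed
  have "ereal l = Liminf (at_right 0) (\<lambda>\<epsilon>. ereal (l + l * ln d / \<bar>ln \<epsilon>\<bar>))"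
    by (rule lim_imp_Liminf[OF _ lim, symmetric]) simp
  also have "\<dots> \<le> Liminf (at_right 0) (\<lambda>\<epsilon>. ereal (log_avg f d \<epsilon>))"
    using ev by (intro Liminf_mono) (auto elim: eventually_mono)
  also have "\<dots> \<le> Liminf (at_right 0) (\<lambda>\<epsilon>. ereal (log_avg f \<delta> \<epsilon>))"
    by (rule Liminf_log_avg_le[OF \<delta> dI])
  finally show "ereal l \<le> Liminf (at_right 0) (\<lambda>\<epsilon>. ereal (log_avg f \<delta> \<epsilon>))" .
  have "Limsup (at_right 0) (\<lambda>\<epsilon>. ereal (log_avg f \<delta> \<epsilon>)) \<le> Limsup (at_right 0) (\<lambda>\<epsilon>. ereal (log_avg f d \<epsilon>))"
    by (rule Limsup_log_avg_le[OF dI \<delta>])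
  also have "\<dots> \<le> Limsup (at_right 0) (\<lambda>\<epsilon>. ereal (u + u * ln d / \<bar>ln \<epsilon>\<bar>))"
    using ev by (intro Limsup_mono) (auto elim: eventually_mono)
  also have "\<dots> = ereal u" by (rule lim_imp_Limsup[OF _ lim]) simp
  finally show "Limsup (at_right 0) (\<lambda>\<epsilon>. ereal (log_avg f \<delta> \<epsilon>)) \<le> ereal u" .
qed

end

section \<open>Asymptotics of the upper and lower averages\<close>

text \<open>The norm is nonnegative because the circle is not a null set.\<close>
lemma Linf_norm_bound:
  assumes m: "m \<in> borel_measurable circle_measure" and fin: "Linf_norm m < \<infinity>"
  obtains M where "Linf_norm m = ereal M" "0 \<le> M" "AE v in circle_measure. \<bar>m v\<bar> \<le> M"
proof -
  have AE: "AE v in circle_measure. ereal \<bar>m v\<bar> \<le> Linf_norm m"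
    unfolding Linf_norm_def by (rule esssup_AE)
  have "0 \<le> Linf_norm m"
  proof (rule ccontr)
    assume neg: "\<not> 0 \<le> Linf_norm m"
    have "AE v in circle_measure. False"
      using AE
    proof eventually_elim
      case (elim v)
      have "0 \<le> ereal \<bar>m v\<bar>" by simp
      then show ?case using elim neg order_trans by blast
    qed
    then have "AE v in circle_measure. v \<notin> space circle_measure" by eventually_elim simp
    then have "space circle_measure \<in> null_sets circle_measure"
      by (subst AE_iff_null_sets) (auto simp del: space_circle_measure)
    then have "emeasure circle_measure (space circle_measure) = 0" by (rule null_setsD1)
    then show False by (simp add: emeasure_circle_measure)
  qed
  then obtain M where M: "Linf_norm m = ereal M" "0 \<le> M" using fin by (cases "Linf_norm m") auto
  show ?thesis using that[OF M] AE by (simp add: M)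
qed

lemma velocity_density_if_normalized:
  assumes m: "m \<in> borel_measurable circle_measure"
    and M: "0 \<le> M" "AE v in circle_measure. \<bar>m v\<bar> \<le> M"
    and norm: "\<forall>r\<in>{0<..<1/2}. (LINT p|mu r. m (snd p)) = 1"
  shows "velocity_density m M"
proof
  show int: "integrable circle_measure m"
    using M by (intro circle.integrable_const_bound[OF _ m]) simp
  have "(LINT p|mu (1/4). m (snd p)) = 1" using norm by simp
  then show "(LINT \<theta>|lborel. indicator {0..<2*pi} \<theta> * m (dir \<theta>)) = 2 * pi"
    using integral_mu_1[OF _ _ int, of "1/4"] by simp
qed (use M in auto)

context velocity_density
begin

lemma log_average_Phi: "0 < t \<Longrightarrow> log_average (\<lambda>r. Phi m r (t / r)) M"
  by unfold_locales (auto intro: Phi_measurable Phi_bound)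

lemma log_mean_eq: "log_mean m \<delta> t = log_avg (\<lambda>r. Phi m r (t / r)) \<delta>"
  by (simp add: log_mean_def log_avg_def fun_eq_iff)

lemma Lambda_independent:
  assumes "0 < t" "\<delta> \<in> {0<..<1/2}" "\<delta>' \<in> {0<..<1/2}"
  shows "Lambda_plus m \<delta> t = Lambda_plus m \<delta>' t" "Lambda_minus m \<delta> t = Lambda_minus m \<delta>' t"
proof -
  interpret log_average "\<lambda>r. Phi m r (t / r)" M by (rule log_average_Phi[OF assms(1)])
  show "Lambda_plus m \<delta> t = Lambda_plus m \<delta>' t"
    unfolding Lambda_plus_def log_mean_eq by (intro antisym Limsup_log_avg_le assms)
  show "Lambda_minus m \<delta> t = Lambda_minus m \<delta>' t"
    unfolding Lambda_minus_def log_mean_eq by (intro antisym Liminf_log_avg_le assms)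
qed

lemma Lambda_bounds:
  assumes t: "3 < t" and \<delta>: "\<delta> \<in> {0<..<1/2}"
  obtains p q where "Lambda_plus m \<delta> t = ereal p" "\<bar>p - 2 / (pi\<^sup>2 * t)\<bar> \<le> 8 * M / (t - 3)\<^sup>2"
    and "Lambda_minus m \<delta> t = ereal q" "\<bar>q - 2 / (pi\<^sup>2 * t)\<bar> \<le> 8 * M / (t - 3)\<^sup>2"
proof -
  interpret log_average "\<lambda>r. Phi m r (t / r)" M by (rule log_average_Phi) (use t in simp)
  define k where "k = 2 / (pi\<^sup>2 * t)"
  define C where "C = 8 * M / (t - 3)\<^sup>2"
  have lo: "ereal (k - C - e) \<le> Lambda_minus m \<delta> t" and up: "Lambda_plus m \<delta> t \<le> ereal (k + C + e)"
    if e: "0 < e" for e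
  proof -
    have "\<forall>\<^sub>F r in at_right 0. k - C - e \<le> Phi m r (t / r) \<and> Phi m r (t / r) \<le> k + C + e"
      using Phi_error[OF t e] by eventually_elim (auto simp: k_def C_def abs_le_iff)
    from log_avg_limits[OF \<delta> this]
    show "ereal (k - C - e) \<le> Lambda_minus m \<delta> t" "Lambda_plus m \<delta> t \<le> ereal (k + C + e)"
      by (simp_all only: Lambda_minus_def Lambda_plus_def log_mean_eq)
  qed
  have le: "Lambda_minus m \<delta> t \<le> Lambda_plus m \<delta> t"
    unfolding Lambda_minus_def Lambda_plus_def by (rule Liminf_le_Limsup) simp
  obtain p where p: "Lambda_plus m \<delta> t = ereal p"
    using order_trans[OF lo[of 1] le] up[of 1] by (cases "Lambda_plus m \<delta> t") auto
  obtain q where q: "Lambda_minus m \<delta> t = ereal q"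
    using order_trans[OF le up[of 1]] lo[of 1] by (cases "Lambda_minus m \<delta> t") auto
  have qp: "q \<le> p" using le by (simp add: p q)
  have "k - C \<le> q"
  proof (rule field_le_epsilon)
    fix e :: real assume "0 < e"
    from lo[OF this] show "k - C \<le> q + e" by (simp add: q)
  qed
  moreover have "p \<le> k + C"
  proof (rule field_le_epsilon)
    fix e :: real assume "0 < e"
    from up[OF this] show "p \<le> k + C + e" by (simp add: p)
  qed
  ultimately have "\<bar>p - k\<bar> \<le> C" "\<bar>q - k\<bar> \<le> C" using qp by linarith+
  then show ?thesis using that[OF p _ q] unfolding k_def C_def by blast
qed

end

lemma asymp_equiv_if_quadratic_error:
  fixes f :: "real \<Rightarrow> real"
  assumes "c \<noteq> 0" and err: "\<And>t. 3 < t \<Longrightarrow> \<bar>f t - c / t\<bar> \<le> C / (t - 3)\<^sup>2"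
  shows "f \<sim>[at_top] (\<lambda>t. c / t)"
proof (rule asymp_equivI')
  have C: "0 \<le> C" using err[of 4] by simp
  have "((\<lambda>t. f t / (c / t) - 1) \<longlongrightarrow> 0) at_top"
  proof (rule Lim_null_comparison)
    show "\<forall>\<^sub>F t in at_top. norm (f t / (c / t) - 1) \<le> 4 * C / \<bar>c\<bar> * inverse t"
      using eventually_ge_at_top[of 6]
    proof eventually_elim
      case (elim t)
      have "f t / (c / t) - 1 = (f t - c / t) * (t / c)" using assms(1) elim by (simp add: field_simps)
      then have "norm (f t / (c / t) - 1) = \<bar>f t - c / t\<bar> * (t / \<bar>c\<bar>)" using elim by (simp add: abs_mult)
      also have "\<dots> \<le> C / (t / 2)\<^sup>2 * (t / \<bar>c\<bar>)"
      proof (rule mult_right_mono)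
        \<comment> \<open>Here \<open>t - 3 \<ge> t / 2\<close>, because \<open>t \<ge> 6\<close>.\<close>
        have "\<bar>f t - c / t\<bar> \<le> C / (t - 3)\<^sup>2" using elim by (intro err) simp
        also have "\<dots> \<le> C / (t / 2)\<^sup>2"
          using elim C by (intro divide_left_mono power_mono mult_pos_pos) auto
        finally show "\<bar>f t - c / t\<bar> \<le> C / (t / 2)\<^sup>2" .
      qed (use elim in auto)
      also have "\<dots> = 4 * C / \<bar>c\<bar> * inverse t" using elim by (simp add: field_simps power2_eq_square)
      finally show ?case .
    qed
    have "((\<lambda>t. 4 * C / \<bar>c\<bar> * inverse t) \<longlongrightarrow> 4 * C / \<bar>c\<bar> * 0) at_top"
      by (intro tendsto_intros tendsto_inverse_0_at_top filterlim_ident)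
    then show "((\<lambda>t. 4 * C / \<bar>c\<bar> * inverse t) \<longlongrightarrow> 0) at_top" by simp
  qed
  then have "((\<lambda>t. (f t / (c / t) - 1) + 1) \<longlongrightarrow> 0 + 1) at_top" by (intro tendsto_intros)
  then show "((\<lambda>t. f t / (c / t)) \<longlongrightarrow> 1) at_top" by simp
qed

theorem theorem1p1:
  fixes m :: "real^2 \<Rightarrow> real" and \<epsilon>' :: real
  assumes m_measurable: "m \<in> borel_measurable circle_measure"
    and m_bounded: "Linf_norm m < \<infinity>"
    and m_nonneg: "AE v in circle_measure. 0 \<le> m v"
    and m_normalized: "\<forall>r\<in>{0<..<1/2}. (LINT p|mu r. m (snd p)) = 1"
    and eps: "\<epsilon>' \<in> {0<..<1/2}"
  shows
    "(\<forall>t>sqrt 2. \<forall>\<delta>\<in>{0<..<1/2}.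
        Lambda_plus m \<delta> t = Lambda_plus m \<epsilon>' t \<and>
        Lambda_minus m \<delta> t = Lambda_minus m \<epsilon>' t) \<and>
     (\<lambda>t. real_of_ereal (Lambda_plus m \<epsilon>' t)) \<sim>[at_top] (\<lambda>t. 2 / (pi\<^sup>2 * t)) \<and>
     (\<lambda>t. real_of_ereal (Lambda_minus m \<epsilon>' t)) \<sim>[at_top] (\<lambda>t. 2 / (pi\<^sup>2 * t)) \<and>
     (\<forall>t>3.
        \<bar>Lambda_plus m \<epsilon>' t - ereal (2 / (pi\<^sup>2 * t))\<bar> \<le> 8 * Linf_norm m / ereal ((t - 3)\<^sup>2) \<and>
        \<bar>Lambda_minus m \<epsilon>' t - ereal (2 / (pi\<^sup>2 * t))\<bar> \<le> 8 * Linf_norm m / ereal ((t - 3)\<^sup>2))"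
proof -
  obtain M where M: "Linf_norm m = ereal M" "0 \<le> M" "AE v in circle_measure. \<bar>m v\<bar> \<le> M"
    using Linf_norm_bound[OF m_measurable m_bounded] by blast
  interpret velocity_density m M
    by (rule velocity_density_if_normalized[OF m_measurable M(2,3) m_normalized])
  have eq: "2 / (pi\<^sup>2 * t) = (2 / pi\<^sup>2) / t" for t by simp
  have indep: "Lambda_plus m \<delta> t = Lambda_plus m \<epsilon>' t \<and> Lambda_minus m \<delta> t = Lambda_minus m \<epsilon>' t"
    if "sqrt 2 < t" "\<delta> \<in> {0<..<1/2}" for t \<delta>
  proof -
    have "0 \<le> sqrt (2::real)" by simp
    then have "0 < t" using that(1) by linarith
    from Lambda_independent[OF this that(2) eps] show ?thesis by blast
  qed
  have asymp: "(\<lambda>t. real_of_ereal (Lambda_plus m \<epsilon>' t)) \<sim>[at_top] (\<lambda>t. 2 / (pi\<^sup>2 * t))"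
    "(\<lambda>t. real_of_ereal (Lambda_minus m \<epsilon>' t)) \<sim>[at_top] (\<lambda>t. 2 / (pi\<^sup>2 * t))"
  proof -
    have b: "\<bar>real_of_ereal (Lambda_plus m \<epsilon>' t) - 2 / (pi\<^sup>2 * t)\<bar> \<le> 8 * M / (t - 3)\<^sup>2"
        "\<bar>real_of_ereal (Lambda_minus m \<epsilon>' t) - 2 / (pi\<^sup>2 * t)\<bar> \<le> 8 * M / (t - 3)\<^sup>2" if "3 < t" for t
      by (rule Lambda_bounds[OF that eps]; simp)+
    have c: "2 / pi\<^sup>2 \<noteq> 0" by simp
    show "(\<lambda>t. real_of_ereal (Lambda_plus m \<epsilon>' t)) \<sim>[at_top] (\<lambda>t. 2 / (pi\<^sup>2 * t))"
      unfolding eq by (rule asymp_equiv_if_quadratic_error[OF c b(1)[unfolded eq]])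
    show "(\<lambda>t. real_of_ereal (Lambda_minus m \<epsilon>' t)) \<sim>[at_top] (\<lambda>t. 2 / (pi\<^sup>2 * t))"
      unfolding eq by (rule asymp_equiv_if_quadratic_error[OF c b(2)[unfolded eq]])
  qed
  have bounds: "\<bar>Lambda_plus m \<epsilon>' t - ereal (2 / (pi\<^sup>2 * t))\<bar> \<le> 8 * Linf_norm m / ereal ((t - 3)\<^sup>2) \<and>
      \<bar>Lambda_minus m \<epsilon>' t - ereal (2 / (pi\<^sup>2 * t))\<bar> \<le> 8 * Linf_norm m / ereal ((t - 3)\<^sup>2)" if t: "3 < t" for t
  proof -
    have R: "8 * Linf_norm m / ereal ((t - 3)\<^sup>2) = ereal (8 * M / (t - 3)\<^sup>2)"
    proof -
      have "8 * Linf_norm m = ereal (8 * M)" unfolding M(1) by (metis numeral_eq_ereal times_ereal.simps(1))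
      then show ?thesis using t by simp
    qed
    show ?thesis
      unfolding R by (rule Lambda_bounds[OF t eps]) simp
  qed
  show ?thesis using indep asymp bounds by blast
qed

end
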